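(* Let $\{E_i,E_j,E_k\}$ be one of the four distributions $\{E_1,E_2,E_3\}$, $\{E_1,E_5,E_6\}$, $\{E_2,E_4,E_6\}$, $\{E_3,E_4,E_5\}$ on $X$, with indices in increasing order; suppose it is involutive and integrates to a submanifold (a special Lagrangian) $L=L_{ijk}$, with $T^*L=\langle\theta^i,\theta^j,\theta^k\rangle$. Then the space of infinitesimal deformations of $L$ is described by the 1-forms $\alpha=\alpha_i\theta^i+\alpha_j\theta^j+\alpha_k\theta^k$ on $L$ whose coefficients satisfy the following system of differential equations on $L$: $$E_i(\alpha_i)+\alpha_if_{jk}+E_j(\alpha_j)-\alpha_jf_{ik}+E_k(\alpha_k)+\alpha_kf_{ij}=0,$$ $$\begin{aligned}E_i(\alpha_j)-E_j(\alpha_i)&+\alpha_i\big[(1-(-1)^{F(i,\tilde i)})f^i_{ij}+(-1)^{F(i,\tilde i)}f^{\tilde i}_{j\tilde i}-(-1)^{F(j,\tilde j)}f^{\tilde j}_{i\tilde i}\big]\\&+\alpha_j\big[(1-(-1)^{F(j,\tilde j)})f^j_{ij}-(-1)^{F(j,\tilde j)}f^{\tilde j}_{i\tilde j}+(-1)^{F(i,\tilde i)}f^{\tilde i}_{j\tilde j}\big]\\&+\alpha_k\big[(1-(-1)^{F(k,\tilde k)})f^k_{ij}+(-1)^{F(i,\tilde i)}f^{\tilde i}_{j\tilde k}-(-1)^{F(j,\tilde j)}f^{\tilde j}_{i\tilde k}\big]=0,\end{aligned}$$ $$\begin{aligned}E_i(\alpha_k)-E_k(\alpha_i)&+\alpha_i\big[(1-(-1)^{F(i,\tilde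 i)})f^i_{ik}+(-1)^{F(i,\tilde i)}f^{\tilde i}_{k\tilde i}-(-1)^{F(k,\tilde k)}f^{\tilde k}_{i\tilde i}\big]\\&+\alpha_j\big[(1-(-1)^{F(j,\tilde j)})f^j_{ik}-(-1)^{F(k,\tilde k)}f^{\tilde k}_{i\tilde j}+(-1)^{F(i,\tilde i)}f^{\tilde i}_{k\tilde j}\big]\\&+\alpha_k\big[(1-(-1)^{F(k,\tilde k)})f^k_{ik}+(-1)^{F(i,\tilde i)}f^{\tilde i}_{k\tilde k}-(-1)^{F(k,\tilde k)}f^{\tilde k}_{i\tilde k}\big]=0,\end{aligned}$$ $$\begin{aligned}E_j(\alpha_k)-E_k(\alpha_j)&+\alpha_i\big[(1-(-1)^{F(i,\tilde i)})f^i_{jk}+(-1)^{F(j,\tilde j)}f^{\tilde j}_{k\tilde i}-(-1)^{F(k,\tilde k)}f^{\tilde k}_{j\tilde i}\big]\\&+\alpha_j\big[(1-(-1)^{F(j,\tilde j)})f^j_{jk}+(-1)^{F(j,\tilde j)}f^{\tilde j}_{k\tilde j}-(-1)^{F(k,\tilde k)}f^{\tilde k}_{j\tilde j}\big]\\&+\alpha_k\big[(1-(-1)^{F(k,\tilde k)})f^k_{jk}+(-1)^{F(j,\tilde j)}f^{\tilde j}_{k\tilde k}-(-1)^{F(k,\tilde k)}f^{\tilde k}_{j\tilde k}\big]=0.\end{aligned}$$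
   Context: $X=\Gamma\backslash G$ is a compact 6-dimensional manifold, the quotient of a connected and simply connected Lie group $G$ by a lattice $\Gamma$ (discrete co-compact subgroup). $X$ carries the structure of a compact non-Kähler Calabi-Yau manifold, with complex structure $J$ given by a global co-frame of $(1,0)$-forms $\{\varphi^1,\varphi^2,\varphi^3\}$, holomorphic volume form $\Omega=\varphi^1\wedge\varphi^2\wedge\varphi^3$, and Hermitian metric $g$ with fundamental form $\omega=\frac{i}{2}\sum_k\varphi^k\wedge\bar\varphi^k$, assumed balanced: $d\omega^2=0$. Write $\varphi^k=\theta^k+\sqrt{-1}\,\theta^{3+k}$, $k=1,2,3$; $\{\theta^1,\dots,\theta^6\}$ is a global real co-frame, $\{E_1,\dots,E_6\}$ the dual frame, and $\omega=\theta^{14}+\theta^{25}+\theta^{36}$ with $\theta^{rs}=\theta^r\wedge\theta^s$. Structure equations: $d\theta^t=\sum_{1\le r<s\le 6}f^t_{rs}\,\theta^r\wedge\theta^s$ with $f^t_{rs}\in C^\infty(X;\mathbb R)$, extended by $f^t_{sr}=-f^t_{rs}$; in the theorem the $f^t_{rs}$ and $\theta^\bullet$ are restricted to $L$. The functions $f_{rs}$ on $L$ ($r,s\in\{i,j,k\}$) are defined by $d\theta^{rs}=f_{rs}\,\theta^i\wedge\theta^j\wedge\theta^k$ on $L$. For $h\in\{1,\dots,6\}$, $\tilde h$ is the index paired with $h$ by $J$, under the convention $JE_h=E_{\tilde h}$ (so $\tilde h=h+3$ for $h\le 3$ and $\tilde h=h-3$ for $h\ge 4$). $F(a,b)=0$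 if $a\le b$ and $F(a,b)=1$ if $a>b$. Space of infinitesimal deformations of the special Lagrangian $L$: the smooth 1-forms $\alpha$ on $L$ with $d\alpha+T\alpha=0$ and $d( *\alpha)=0$, where $*$ is the Hodge star of the induced metric ($\{\theta^i,\theta^j,\theta^k\}$ orthonormal and positively oriented) and $T\alpha=-d\omega(J\alpha^*,\cdot,\cdot)|_L$, with $\alpha^*=\alpha_iE_i+\alpha_jE_j+\alpha_kE_k$ the $g$-dual vector field and, in the convention $JE_h=E_{\tilde h}$, $J\alpha^*=\alpha_iE_{\tilde i}+\alpha_jE_{\tilde j}+\alpha_kE_{\tilde k}$. *)

theory Defs
  imports "HOL-Analysis.Analysis" "HOL-Algebra.Coset"
begin

section \<open>Smooth manifolds\<close>

text \<open>On an open set \<open>S\<close> this is the usual \<open>C\<^sup>k\<close>, with directional derivatives in all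
  directions; nothing is claimed for sets that are not open.\<close>

fun Ck_on :: "nat \<Rightarrow> 'a::euclidean_space set \<Rightarrow> ('a \<Rightarrow> 'b::euclidean_space) \<Rightarrow> bool" where
  "Ck_on 0 S f \<longleftrightarrow> continuous_on S f"
| "Ck_on (Suc k) S f \<longleftrightarrow> (\<forall>x\<in>S. f differentiable (at x)) \<and>
     (\<forall>v. Ck_on k S (\<lambda>x. frechet_derivative f (at x) v))"

definition Cinf_on :: "'a::euclidean_space set \<Rightarrow> ('a \<Rightarrow> 'b::euclidean_space) \<Rightarrow> bool" where
  "Cinf_on S f \<longleftrightarrow> (\<forall>k. Ck_on k S f)"

text \<open>A chart is a pair of its domain and its coordinate map, which is meaningful on the domain
  only. The dimension of the manifold is the dimension of the model space \<open>'e\<close>, and the underlying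
  set of the manifold is the whole type \<open>'m\<close>.\<close>

type_synonym ('m, 'e) chart = "'m set \<times> ('m \<Rightarrow> 'e)"
type_synonym ('m, 'e) atlas = "('m, 'e) chart set"

definition smooth_manifold ::
    "('m::{t2_space,second_countable_topology}, 'e::euclidean_space) atlas \<Rightarrow> bool" where
  "smooth_manifold A \<longleftrightarrow>
     (\<Union>(U, \<phi>)\<in>A. U) = UNIV \<and>
     (\<forall>(U, \<phi>)\<in>A. open U \<and> open (\<phi> ` U) \<and> homeomorphism U (\<phi> ` U) \<phi> (inv_into U \<phi>)) \<and>
     (\<forall>(U, \<phi>)\<in>A. \<forall>(V, \<psi>)\<in>A. Cinf_on (\<phi> ` (U \<inter> V)) (\<psi> \<circ> inv_into U \<phi>))"

definition smooth_on ::
    "('m::topological_space, 'e::euclidean_space) atlas \<Rightarrow> 'm set \<Rightarrow> ('m \<Rightarrow> real) \<Rightarrow> bool" where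
  "smooth_on A W f \<longleftrightarrow> (\<forall>(U, \<phi>)\<in>A. Cinf_on (\<phi> ` (U \<inter> W)) (f \<circ> inv_into U \<phi>))"

definition smooth_at ::
    "('m::topological_space, 'e::euclidean_space) atlas \<Rightarrow> 'm \<Rightarrow> ('m \<Rightarrow> real) \<Rightarrow> bool" where
  "smooth_at A p f \<longleftrightarrow> (\<exists>W. open W \<and> p \<in> W \<and> smooth_on A W f)"

definition smooth_map_on ::
    "('m::topological_space, 'e::euclidean_space) atlas \<Rightarrow>
     ('n::topological_space, 'f::euclidean_space) atlas \<Rightarrow> 'm set \<Rightarrow> ('m \<Rightarrow> 'n) \<Rightarrow> bool" where
  "smooth_map_on A B W F \<longleftrightarrow> continuous_on W F \<and>
     (\<forall>(U, \<phi>)\<in>A. \<forall>(V, \<psi>)\<in>B. Cinf_on (\<phi> ` (U \<inter> W \<inter> F -` V)) (\<psi> \<circ> F \<circ> inv_into U \<phi>))"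

definition local_diffeomorphism ::
    "('m::topological_space, 'e::euclidean_space) atlas \<Rightarrow>
     ('n::topological_space, 'f::euclidean_space) atlas \<Rightarrow> ('m \<Rightarrow> 'n) \<Rightarrow> bool" where
  "local_diffeomorphism A B F \<longleftrightarrow>
     (\<forall>p. \<exists>W. open W \<and> p \<in> W \<and> open (F ` W) \<and> inj_on F W \<and>
        smooth_map_on A B W F \<and> smooth_map_on B A (F ` W) (inv_into W F))"


section \<open>Lie groups and quotients by lattices\<close>

definition prod_atlas ::
    "('m, 'e) atlas \<Rightarrow> ('n, 'f) atlas \<Rightarrow> ('m \<times> 'n, 'e \<times> 'f) atlas" where
  "prod_atlas A B = {(U \<times> V, map_prod \<phi> \<psi>) | U \<phi> V \<psi>. (U, \<phi>) \<in> A \<and> (V, \<psi>) \<in> B}"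

definition lie_group ::
    "('g::{t2_space,second_countable_topology}, 'e::euclidean_space) atlas \<Rightarrow> 'g monoid \<Rightarrow> bool" where
  "lie_group A G \<longleftrightarrow> smooth_manifold A \<and> group G \<and> carrier G = UNIV \<and>
     smooth_map_on (prod_atlas A A) A UNIV (\<lambda>(x, y). x \<otimes>\<^bsub>G\<^esub> y) \<and>
     smooth_map_on A A UNIV (\<lambda>x. inv\<^bsub>G\<^esub> x)"

definition discrete_subgroup :: "'g::topological_space set \<Rightarrow> 'g monoid \<Rightarrow> bool" where
  "discrete_subgroup \<Gamma> G \<longleftrightarrow> subgroup \<Gamma> G \<and> (\<forall>\<gamma>\<in>\<Gamma>. \<exists>U. open U \<and> U \<inter> \<Gamma> = {\<gamma>})"

text \<open>The manifold \<open>B\<close> is the quotient of \<open>G\<close> by left translations of \<open>\<Gamma>\<close>, with projection \<open>\<pi>\<close>: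
  the points are the cosets \<open>\<Gamma>g\<close>, and being a local diffeomorphism fixes topology and smooth
  structure. Cocompactness of \<open>\<Gamma>\<close> is compactness of this quotient.\<close>

definition lattice_quotient ::
    "('g::{t2_space,second_countable_topology}, 'e::euclidean_space) atlas \<Rightarrow> 'g monoid \<Rightarrow> 'g set \<Rightarrow>
     ('m::{t2_space,second_countable_topology}, 'f::euclidean_space) atlas \<Rightarrow> ('g \<Rightarrow> 'm) \<Rightarrow> bool" where
  "lattice_quotient A G \<Gamma> B \<pi> \<longleftrightarrow>
     lie_group A G \<and> discrete_subgroup \<Gamma> G \<and> smooth_manifold B \<and> compact (UNIV :: 'm set) \<and>
     surj \<pi> \<and> (\<forall>g h. \<pi> g = \<pi> h \<longleftrightarrow> \<Gamma> #>\<^bsub>G\<^esub> g = \<Gamma> #>\<^bsub>G\<^esub> h) \<and> local_diffeomorphism A B \<pi>"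


section \<open>Tangent vectors and vector fields\<close>

text \<open>A tangent vector at \<open>p\<close> is a derivation of the functions that are smooth near \<open>p\<close>, with the
  value \<open>0\<close> on all other functions. (It depends on germs only: a derivation applied to the
  indicator function of an open set containing \<open>p\<close> is \<open>0\<close>.)\<close>

type_synonym 'm tvec = "('m \<Rightarrow> real) \<Rightarrow> real"
type_synonym 'm vfield = "'m \<Rightarrow> 'm tvec"

definition tangent_space ::
    "('m::topological_space, 'e::euclidean_space) atlas \<Rightarrow> 'm \<Rightarrow> 'm tvec set" where
  "tangent_space A p = {v.
     (\<forall>f. \<not> smooth_at A p f \<longrightarrow> v f = 0) \<and>
     (\<forall>f g. smooth_at A p f \<longrightarrow> smooth_at A p g \<longrightarrow>
        v (\<lambda>x. f x + g x) = v f + v g \<and> v (\<lambda>x. f x * g x) = f p * v g + g p * v f) \<and>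
     (\<forall>c f. smooth_at A p f \<longrightarrow> v (\<lambda>x. c * f x) = c * v f)}"

definition tlincomb :: "'i set \<Rightarrow> ('i \<Rightarrow> real) \<Rightarrow> ('i \<Rightarrow> 'm tvec) \<Rightarrow> 'm tvec" where
  "tlincomb I c v = (\<lambda>f. \<Sum>i\<in>I. c i * v i f)"

definition smooth_vfield ::
    "('m::topological_space, 'e::euclidean_space) atlas \<Rightarrow> 'm set \<Rightarrow> 'm vfield \<Rightarrow> bool" where
  "smooth_vfield A W V \<longleftrightarrow> open W \<and> (\<forall>p\<in>W. V p \<in> tangent_space A p) \<and>
     (\<forall>W' f. open W' \<longrightarrow> W' \<subseteq> W \<longrightarrow> smooth_on A W' f \<longrightarrow> smooth_on A W' (\<lambda>q. V q f))"

definition lie_bracket ::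
    "('m::topological_space, 'e::euclidean_space) atlas \<Rightarrow> 'm vfield \<Rightarrow> 'm vfield \<Rightarrow> 'm vfield" where
  "lie_bracket A U V = (\<lambda>p f. if smooth_at A p f then U p (\<lambda>q. V q f) - V p (\<lambda>q. U q f) else 0)"

definition push ::
    "('n::topological_space, 'f::euclidean_space) atlas \<Rightarrow> ('m \<Rightarrow> 'n) \<Rightarrow> 'm \<Rightarrow> 'm tvec \<Rightarrow> 'n tvec" where
  "push B F p v = (\<lambda>f. if smooth_at B (F p) f then v (f \<circ> F) else 0)"

definition distribution :: "nat set \<Rightarrow> (nat \<Rightarrow> 'm vfield) \<Rightarrow> 'm \<Rightarrow> 'm tvec set" where
  "distribution I E p = {tlincomb I c (\<lambda>h. E h p) | c. True}"

definition involutive ::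
    "('m::topological_space, 'e::euclidean_space) atlas \<Rightarrow> ('m \<Rightarrow> 'm tvec set) \<Rightarrow> bool" where
  "involutive A D \<longleftrightarrow>
     (\<forall>W U V. smooth_vfield A W U \<longrightarrow> smooth_vfield A W V \<longrightarrow>
        (\<forall>p\<in>W. U p \<in> D p \<and> V p \<in> D p) \<longrightarrow> (\<forall>p\<in>W. lie_bracket A U V p \<in> D p))"

text \<open>A submanifold is given by an injective immersion \<open>\<iota>\<close> of a manifold with atlas \<open>A\<close>; leaves of
  foliations need not be embedded.\<close>

definition immersed_submanifold ::
    "('l::{t2_space,second_countable_topology}, 'e::euclidean_space) atlas \<Rightarrow>
     ('m::{t2_space,second_countable_topology}, 'f::euclidean_space) atlas \<Rightarrow> ('l \<Rightarrow> 'm) \<Rightarrow> bool" where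
  "immersed_submanifold A B \<iota> \<longleftrightarrow> smooth_manifold A \<and> smooth_map_on A B UNIV \<iota> \<and> inj \<iota> \<and>
     (\<forall>p. inj_on (push B \<iota> p) (tangent_space A p))"

definition integral_submanifold ::
    "('l::{t2_space,second_countable_topology}, 'e::euclidean_space) atlas \<Rightarrow>
     ('m::{t2_space,second_countable_topology}, 'f::euclidean_space) atlas \<Rightarrow> ('l \<Rightarrow> 'm) \<Rightarrow>
     ('m \<Rightarrow> 'm tvec set) \<Rightarrow> bool" where
  "integral_submanifold A B \<iota> D \<longleftrightarrow> immersed_submanifold A B \<iota> \<and>
     (\<forall>p. push B \<iota> p ` tangent_space A p = D (\<iota> p))"

text \<open>The restriction to the submanifold of a vector field that is tangent to it.\<close>

definition restrict_vfield ::
    "('l::topological_space, 'e::euclidean_space) atlas \<Rightarrow>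
     ('m::topological_space, 'f::euclidean_space) atlas \<Rightarrow> ('l \<Rightarrow> 'm) \<Rightarrow> 'm vfield \<Rightarrow> 'l vfield" where
  "restrict_vfield A B \<iota> V p = (THE v. v \<in> tangent_space A p \<and> push B \<iota> p v = V (\<iota> p))"


section \<open>Differential forms\<close>

text \<open>A \<open>k\<close>-form assigns to a point an alternating multilinear function of lists of \<open>k\<close> tangent
  vectors. It is \<open>0\<close> on all other lists, so that equality of forms is equality of functions.\<close>

type_synonym ('m, 'c) form = "'m \<Rightarrow> 'm tvec list \<Rightarrow> 'c"

definition alternating_at ::
    "('m::topological_space, 'e::euclidean_space) atlas \<Rightarrow> nat \<Rightarrow> 'm \<Rightarrow> ('m tvec list \<Rightarrow> real) \<Rightarrow> bool" where
  "alternating_at A k p \<eta> \<longleftrightarrow>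
     (\<forall>vs. \<not> (length vs = k \<and> set vs \<subseteq> tangent_space A p) \<longrightarrow> \<eta> vs = 0) \<and>
     (\<forall>vs i a b u w. length vs = k \<longrightarrow> set vs \<subseteq> tangent_space A p \<longrightarrow> i < k \<longrightarrow>
        u \<in> tangent_space A p \<longrightarrow> w \<in> tangent_space A p \<longrightarrow>
        \<eta> (vs[i := \<lambda>f. a * u f + b * w f]) = a * \<eta> (vs[i := u]) + b * \<eta> (vs[i := w])) \<and>
     (\<forall>vs i j. length vs = k \<longrightarrow> i < j \<longrightarrow> j < k \<longrightarrow> vs ! i = vs ! j \<longrightarrow> \<eta> vs = 0)"

definition smooth_form ::
    "('m::topological_space, 'e::euclidean_space) atlas \<Rightarrow> nat \<Rightarrow> ('m, real) form \<Rightarrow> bool" where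
  "smooth_form A k \<eta> \<longleftrightarrow> (\<forall>p. alternating_at A k p (\<eta> p)) \<and>
     (\<forall>W Vs. length Vs = k \<longrightarrow> open W \<longrightarrow> (\<forall>V\<in>set Vs. smooth_vfield A W V) \<longrightarrow>
        smooth_on A W (\<lambda>p. \<eta> p (map (\<lambda>V. V p) Vs)))"

definition wedge ::
    "nat \<Rightarrow> nat \<Rightarrow> ('m, 'c::field_char_0) form \<Rightarrow> ('m, 'c) form \<Rightarrow> ('m, 'c) form" where
  "wedge k l \<alpha> \<beta> = (\<lambda>p vs. if length vs = k + l then
     (\<Sum>\<sigma> | \<sigma> permutes {..<k+l}. of_int (sign \<sigma>) *
        \<alpha> p (map (\<lambda>i. vs ! \<sigma> i) [0..<k]) * \<beta> p (map (\<lambda>i. vs ! \<sigma> i) [k..<k+l]))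
     / (fact k * fact l) else 0)"

lemma wedge_1_1:
  fixes \<alpha> \<beta> :: "('m, 'c::field_char_0) form"
  shows "wedge 1 1 \<alpha> \<beta> p vs =
    (if length vs = 2 then \<alpha> p [vs ! 0] * \<beta> p [vs ! 1] - \<alpha> p [vs ! 1] * \<beta> p [vs ! 0] else 0)"
proof -
  have eq: "{..<1+1} = insert 0 {1::nat}" by auto
  have perms: "{\<sigma>. \<sigma> permutes {..<1+1}} = {id, Transposition.transpose 0 (1::nat)}"
    unfolding eq by (auto simp: permutes_doubleton_iff)
  have ne: "id \<noteq> Transposition.transpose 0 (1::nat)"
    by (metis id_apply transpose_apply_first zero_neq_one)
  have sg: "sign (Transposition.transpose 0 (1::nat)) = -1" by (simp add: sign_swap_id)
  show ?thesis
    unfolding wedge_def perms using ne sg by (simp add: sign_id)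
qed

definition omit :: "nat \<Rightarrow> 'a list \<Rightarrow> 'a list" where
  "omit i xs = take i xs @ drop (Suc i) xs"

text \<open>The invariant formula for \<open>d\<eta>(V\<^sub>0, \<dots>, V\<^sub>k)\<close> at \<open>p\<close>.\<close>

definition koszul ::
    "('m::topological_space, 'e::euclidean_space) atlas \<Rightarrow> nat \<Rightarrow> ('m, real) form \<Rightarrow>
     'm vfield list \<Rightarrow> 'm \<Rightarrow> real" where
  "koszul A k \<eta> Vs p =
     (\<Sum>i\<le>k. (-1) ^ i * (Vs ! i) p (\<lambda>q. \<eta> q (map (\<lambda>V. V q) (omit i Vs)))) +
     (\<Sum>j\<le>k. \<Sum>i<j. (-1) ^ (i + j) *
        \<eta> p (lie_bracket A (Vs ! i) (Vs ! j) p # map (\<lambda>V. V p) (omit i (omit j Vs))))"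

text \<open>The value on tangent vectors at \<open>p\<close> is computed with any smooth vector fields near \<open>p\<close> that
  extend them.\<close>

definition ext_deriv ::
    "('m::topological_space, 'e::euclidean_space) atlas \<Rightarrow> nat \<Rightarrow> ('m, real) form \<Rightarrow> ('m, real) form" where
  "ext_deriv A k \<eta> = (\<lambda>p vs. if length vs = Suc k \<and> set vs \<subseteq> tangent_space A p then
     (THE r. \<exists>W Vs. p \<in> W \<and> length Vs = Suc k \<and> (\<forall>V\<in>set Vs. smooth_vfield A W V) \<and>
        map (\<lambda>V. V p) Vs = vs \<and> r = koszul A k \<eta> Vs p)
     else 0)"

definition ext_deriv_complex ::
    "('m::topological_space, 'e::euclidean_space) atlas \<Rightarrow> nat \<Rightarrow> ('m, complex) form \<Rightarrow> ('m, complex) form"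
  where
  "ext_deriv_complex A k \<eta> = (\<lambda>p vs.
     Complex (ext_deriv A k (\<lambda>q us. Re (\<eta> q us)) p vs) (ext_deriv A k (\<lambda>q us. Im (\<eta> q us)) p vs))"

definition pullback ::
    "('l::topological_space, 'e::euclidean_space) atlas \<Rightarrow>
     ('m::topological_space, 'f::euclidean_space) atlas \<Rightarrow> ('l \<Rightarrow> 'm) \<Rightarrow>
     ('m, 'c::zero) form \<Rightarrow> ('l, 'c) form" where
  "pullback A B F \<eta> = (\<lambda>p vs. if set vs \<subseteq> tangent_space A p
     then \<eta> (F p) (map (push B F p) vs) else 0)"

definition coframe ::
    "('m::topological_space, 'e::euclidean_space) atlas \<Rightarrow> nat set \<Rightarrow> (nat \<Rightarrow> ('m, real) form) \<Rightarrow> bool" where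
  "coframe A I \<theta> \<longleftrightarrow> (\<forall>t\<in>I. smooth_form A 1 (\<theta> t)) \<and>
     (\<forall>p. (\<forall>\<beta>. alternating_at A 1 p \<beta> \<longrightarrow> (\<exists>c. \<beta> = (\<lambda>vs. \<Sum>t\<in>I. c t * \<theta> t p vs))) \<and>
          (\<forall>c. (\<forall>vs. (\<Sum>t\<in>I. c t * \<theta> t p vs) = 0) \<longrightarrow> (\<forall>t\<in>I. c t = 0)))"

definition dual_frame ::
    "('m::topological_space, 'e::euclidean_space) atlas \<Rightarrow> nat set \<Rightarrow> (nat \<Rightarrow> ('m, real) form) \<Rightarrow>
     (nat \<Rightarrow> 'm vfield) \<Rightarrow> bool" where
  "dual_frame A I \<theta> E \<longleftrightarrow> (\<forall>t\<in>I. smooth_vfield A UNIV (E t)) \<and>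
     (\<forall>p. \<forall>s\<in>I. \<forall>t\<in>I. \<theta> s p [E t p] = (if s = t then 1 else 0))"


section \<open>Riemannian metrics and the Hodge star on 3-manifolds\<close>

type_synonym 'm rmetric = "'m \<Rightarrow> 'm tvec \<Rightarrow> 'm tvec \<Rightarrow> real"

definition induced_metric ::
    "('m::topological_space, 'f::euclidean_space) atlas \<Rightarrow> ('l \<Rightarrow> 'm) \<Rightarrow> 'm rmetric \<Rightarrow> 'l rmetric" where
  "induced_metric B \<iota> g = (\<lambda>p u v. g (\<iota> p) (push B \<iota> p u) (push B \<iota> p v))"

text \<open>The metric dual of a covector at \<open>p\<close>.\<close>

definition sharp ::
    "('m::topological_space, 'e::euclidean_space) atlas \<Rightarrow> 'm rmetric \<Rightarrow> 'm \<Rightarrow> ('m tvec list \<Rightarrow> real) \<Rightarrow>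
     'm tvec" where
  "sharp A g p \<beta> = (THE u. u \<in> tangent_space A p \<and> (\<forall>v\<in>tangent_space A p. g p u v = \<beta> [v]))"

text \<open>The Hodge star of a 1-form on a 3-manifold with metric \<open>g\<close> and volume form \<open>vol\<close>:
  \<open>\<beta> \<and> *\<alpha> = g(\<beta>, \<alpha>) vol\<close> for all covectors \<open>\<beta>\<close>.\<close>

definition hodge_star ::
    "('m::topological_space, 'e::euclidean_space) atlas \<Rightarrow> 'm rmetric \<Rightarrow> ('m, real) form \<Rightarrow>
     ('m, real) form \<Rightarrow> ('m, real) form" where
  "hodge_star A g vol \<alpha> = (\<lambda>p. THE \<eta>. alternating_at A 2 p \<eta> \<and>
     (\<forall>\<beta>. alternating_at A 1 p \<beta> \<longrightarrow>
        (\<forall>vs. wedge 1 2 (\<lambda>_. \<beta>) (\<lambda>_. \<eta>) p vs =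
              g p (sharp A g p \<beta>) (sharp A g p (\<alpha> p)) * vol p vs)))"


section \<open>Complex structures\<close>

definition complex_structure ::
    "('m::topological_space, 'e::euclidean_space) atlas \<Rightarrow> ('m \<Rightarrow> 'm tvec \<Rightarrow> 'm tvec) \<Rightarrow> bool" where
  "complex_structure A J \<longleftrightarrow>
     (\<forall>p. \<forall>v\<in>tangent_space A p. J p v \<in> tangent_space A p \<and> J p (J p v) = (\<lambda>f. - v f)) \<and>
     (\<forall>p a b. \<forall>u\<in>tangent_space A p. \<forall>v\<in>tangent_space A p.
        J p (\<lambda>f. a * u f + b * v f) = (\<lambda>f. a * J p u f + b * J p v f)) \<and>
     (\<forall>W V. smooth_vfield A W V \<longrightarrow> smooth_vfield A W (\<lambda>p. J p (V p))) \<and>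
     \<comment> \<open>integrability: the Nijenhuis tensor vanishes\<close>
     (\<forall>W U V. smooth_vfield A W U \<longrightarrow> smooth_vfield A W V \<longrightarrow> (\<forall>p\<in>W. \<forall>f.
        lie_bracket A (\<lambda>q. J q (U q)) (\<lambda>q. J q (V q)) p f
        - J p (lie_bracket A (\<lambda>q. J q (U q)) V p) f
        - J p (lie_bracket A U (\<lambda>q. J q (V q)) p) f
        - lie_bracket A U V p f = 0))"

definition type_1_0 ::
    "('m::topological_space, 'e::euclidean_space) atlas \<Rightarrow> ('m \<Rightarrow> 'm tvec \<Rightarrow> 'm tvec) \<Rightarrow>
     ('m, complex) form \<Rightarrow> bool" where
  "type_1_0 A J \<phi> \<longleftrightarrow> (\<forall>p. \<forall>v\<in>tangent_space A p. \<phi> p [J p v] = \<i> * \<phi> p [v])"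

definition kaehler_form ::
    "('m::topological_space, 'e::euclidean_space) atlas \<Rightarrow> ('m \<Rightarrow> 'm tvec \<Rightarrow> 'm tvec) \<Rightarrow>
     ('m, real) form \<Rightarrow> bool" where
  "kaehler_form A J \<eta> \<longleftrightarrow> smooth_form A 2 \<eta> \<and> ext_deriv A 2 \<eta> = (\<lambda>_ _. 0) \<and>
     (\<forall>p. \<forall>u\<in>tangent_space A p. \<forall>v\<in>tangent_space A p. \<eta> p [J p u, J p v] = \<eta> p [u, v]) \<and>
     (\<forall>p. \<forall>u\<in>tangent_space A p. u \<noteq> (\<lambda>_. 0) \<longrightarrow> \<eta> p [u, J p u] > 0)"


section \<open>The Calabi-Yau geometry of a coframe\<close>

definition phi :: "(nat \<Rightarrow> ('m, real) form) \<Rightarrow> nat \<Rightarrow> ('m, complex) form" where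
  "phi \<theta> k = (\<lambda>p vs. Complex (\<theta> k p vs) (\<theta> (3 + k) p vs))"

definition theta2 :: "(nat \<Rightarrow> ('m, real) form) \<Rightarrow> nat \<Rightarrow> nat \<Rightarrow> ('m, real) form" where
  "theta2 \<theta> r s = wedge 1 1 (\<theta> r) (\<theta> s)"

definition theta3 :: "(nat \<Rightarrow> ('m, real) form) \<Rightarrow> nat \<Rightarrow> nat \<Rightarrow> nat \<Rightarrow> ('m, real) form" where
  "theta3 \<theta> i j k = wedge 2 1 (theta2 \<theta> i j) (\<theta> k)"

definition Omega :: "(nat \<Rightarrow> ('m, real) form) \<Rightarrow> ('m, complex) form" where
  "Omega \<theta> = wedge 2 1 (wedge 1 1 (phi \<theta> 1) (phi \<theta> 2)) (phi \<theta> 3)"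

definition omega :: "(nat \<Rightarrow> ('m, real) form) \<Rightarrow> ('m, real) form" where
  "omega \<theta> = (\<lambda>p vs. \<Sum>k\<in>{1..3}. theta2 \<theta> k (3 + k) p vs)"

lemma omega_phi:
  "complex_of_real (omega \<theta> p vs) =
     (\<i> / 2) * (\<Sum>k\<in>{1..3}. wedge 1 1 (phi \<theta> k) (\<lambda>q us. cnj (phi \<theta> k q us)) p vs)"
proof -
  have "{1..3} = {1, 2, 3::nat}" by auto
  then show ?thesis
    unfolding omega_def theta2_def wedge_1_1
    by (simp add: phi_def complex_eq_iff field_simps)
qed

text \<open>The Hermitian metric with fundamental form \<open>omega \<theta>\<close>.\<close>

definition hermitian_metric :: "(nat \<Rightarrow> ('m, real) form) \<Rightarrow> 'm rmetric" where
  "hermitian_metric \<theta> = (\<lambda>p u v. \<Sum>t\<in>{1..6}. \<theta> t p [u] * \<theta> t p [v])"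

text \<open>Holomorphicity of the (3,0)-form \<open>Omega \<theta>\<close> is stated as closedness: in complex dimension 3 there
  are no (4,0)-forms, so its exterior derivative is its image under the Dolbeault operator.\<close>

definition balanced_calabi_yau ::
    "('m::topological_space, 'e::euclidean_space) atlas \<Rightarrow> ('m \<Rightarrow> 'm tvec \<Rightarrow> 'm tvec) \<Rightarrow>
     (nat \<Rightarrow> ('m, real) form) \<Rightarrow> bool" where
  "balanced_calabi_yau A J \<theta> \<longleftrightarrow>
     complex_structure A J \<and> coframe A {1..6} \<theta> \<and> (\<forall>k\<in>{1..3}. type_1_0 A J (phi \<theta> k)) \<and>
     ext_deriv_complex A 3 (Omega \<theta>) = (\<lambda>_ _. 0) \<and>
     ext_deriv A 4 (wedge 2 2 (omega \<theta>) (omega \<theta>)) = (\<lambda>_ _. 0)"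

definition non_kaehler ::
    "('m::topological_space, 'e::euclidean_space) atlas \<Rightarrow> ('m \<Rightarrow> 'm tvec \<Rightarrow> 'm tvec) \<Rightarrow> bool" where
  "non_kaehler A J \<longleftrightarrow> (\<nexists>\<eta>. kaehler_form A J \<eta>)"

definition structure_functions ::
    "('m::topological_space, 'e::euclidean_space) atlas \<Rightarrow> (nat \<Rightarrow> ('m, real) form) \<Rightarrow>
     (nat \<Rightarrow> nat \<Rightarrow> nat \<Rightarrow> 'm \<Rightarrow> real) \<Rightarrow> bool" where
  "structure_functions A \<theta> f \<longleftrightarrow>
     (\<forall>t\<in>{1..6}. \<forall>r\<in>{1..6}. \<forall>s\<in>{1..6}. smooth_on A UNIV (f t r s) \<and> (\<forall>p. f t s r p = - f t r s p)) \<and>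
     (\<forall>t\<in>{1..6}. ext_deriv A 1 (\<theta> t) =
        (\<lambda>p vs. \<Sum>r\<in>{1..6}. \<Sum>s\<in>{r+1..6}. f t r s p * theta2 \<theta> r s p vs))"

definition special_lagrangian ::
    "('l::topological_space, 'e::euclidean_space) atlas \<Rightarrow>
     ('m::topological_space, 'f::euclidean_space) atlas \<Rightarrow> ('l \<Rightarrow> 'm) \<Rightarrow>
     (nat \<Rightarrow> ('m, real) form) \<Rightarrow> bool" where
  "special_lagrangian A B \<iota> \<theta> \<longleftrightarrow> 2 * DIM('e) = DIM('f) \<and>
     pullback A B \<iota> (omega \<theta>) = (\<lambda>_ _. 0) \<and>
     pullback A B \<iota> (\<lambda>p vs. Im (Omega \<theta> p vs)) = (\<lambda>_ _. 0)"


section \<open>Infinitesimal deformations\<close>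

definition tilde :: "nat \<Rightarrow> nat" where
  "tilde h = (if h \<le> 3 then h + 3 else h - 3)"

definition F_ind :: "nat \<Rightarrow> nat \<Rightarrow> nat" where
  "F_ind a b = (if a \<le> b then 0 else 1)"

text \<open>The linear operator \<open>E\<^sub>h \<mapsto> E\<^bsub>tilde h\<^esub>\<close> used in \<open>T\<close>. It is not the complex structure \<open>J\<close> for
  which the forms \<open>phi \<theta> k\<close> have type (1,0): that one maps \<open>E\<^sub>h\<close> to \<open>- E\<^bsub>h-3\<^esub>\<close> for \<open>h \<ge> 4\<close>.\<close>

definition frame_J ::
    "(nat \<Rightarrow> ('m, real) form) \<Rightarrow> (nat \<Rightarrow> 'm vfield) \<Rightarrow> 'm \<Rightarrow> 'm tvec \<Rightarrow> 'm tvec" where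
  "frame_J \<theta> E p v = tlincomb {1..6} (\<lambda>h. \<theta> h p [v]) (\<lambda>h. E (tilde h) p)"

definition T_op ::
    "('l::topological_space, 'e::euclidean_space) atlas \<Rightarrow>
     ('m::topological_space, 'f::euclidean_space) atlas \<Rightarrow> ('l \<Rightarrow> 'm) \<Rightarrow>
     (nat \<Rightarrow> ('m, real) form) \<Rightarrow> (nat \<Rightarrow> 'm vfield) \<Rightarrow> ('l, real) form \<Rightarrow> ('l, real) form" where
  "T_op A B \<iota> \<theta> E \<alpha> = (\<lambda>p vs. if set vs \<subseteq> tangent_space A p then
     - ext_deriv B 2 (omega \<theta>) (\<iota> p)
         (frame_J \<theta> E (\<iota> p) (push B \<iota> p (sharp A (induced_metric B \<iota> (hermitian_metric \<theta>)) p (\<alpha> p)))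
          # map (push B \<iota> p) vs)
     else 0)"

text \<open>The orientation of the submanifold is given by the volume form \<open>vol\<close>.\<close>

definition infinitesimal_deformations ::
    "('l::topological_space, 'e::euclidean_space) atlas \<Rightarrow>
     ('m::topological_space, 'f::euclidean_space) atlas \<Rightarrow> ('l \<Rightarrow> 'm) \<Rightarrow>
     (nat \<Rightarrow> ('m, real) form) \<Rightarrow> (nat \<Rightarrow> 'm vfield) \<Rightarrow> ('l, real) form \<Rightarrow> ('l, real) form set" where
  "infinitesimal_deformations A B \<iota> \<theta> E vol =
     {\<alpha>. smooth_form A 1 \<alpha> \<and>
         (\<forall>p vs. ext_deriv A 1 \<alpha> p vs + T_op A B \<iota> \<theta> E \<alpha> p vs = 0) \<and>
         ext_deriv A 2 (hodge_star A (induced_metric B \<iota> (hermitian_metric \<theta>)) vol \<alpha>) = (\<lambda>_ _. 0)}"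

end

theory Submission
  imports Defs
begin

text \<open>
  Both conditions that define an infinitesimal deformation, \<open>d\<alpha> + T\<alpha> = 0\<close> and \<open>d(*\<alpha>) = 0\<close>, are
  equations between forms on the leaf \<open>L\<close>. They hold if and only if they hold on the frame
  \<open>E\<^sub>i, E\<^sub>j, E\<^sub>k\<close> of \<open>L\<close>, and there the invariant formula for the exterior derivative leaves only
  derivatives of the coefficients of \<open>\<alpha>\<close> along the frame and brackets of frame fields. Brackets on \<open>L\<close>
  are those of the ambient frame (\<open>bracket_leaf\<close>), and \<open>\<theta>\<^sub>t([E\<^sub>a, E\<^sub>b]) = - f\<^sup>t\<^sub>a\<^sub>b\<close>
  (\<open>structure_functions_bracket\<close>).

  The coframe of \<open>L\<close> is orthonormal, so \<open>*\<alpha> = \<alpha>\<^sub>i \<theta>\<^sup>j\<^sup>k - \<alpha>\<^sub>j \<theta>\<^sup>i\<^sup>k + \<alpha>\<^sub>k \<theta>\<^sup>i\<^sup>j\<close>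
  (\<open>hodge_star_frame\<close>), and \<open>d(*\<alpha>)\<close> has the first equation as its only component
  (\<open>codifferential_zero_iff\<close>). For the others let \<open>\<epsilon>\<^sub>h\<close> be \<open>1\<close> for \<open>h \<le> 3\<close> and \<open>-1\<close> for \<open>h \<ge> 4\<close>, and
  write \<open>h'\<close> for the index paired with \<open>h\<close>. The components of \<open>\<omega>\<close> in the frame are constant, and
  \<open>\<omega>(\<cdot>, E\<^sub>s) = - \<epsilon>\<^sub>s \<theta>\<^bsub>s'\<^esub>\<close>. Therefore \<open>d\<omega>(E\<^bsub>h'\<^esub>, E\<^sub>r, E\<^sub>s)\<close> is a sum of three structure functions with
  signs (\<open>koszul_omega_frame\<close>), and the component \<open>(r, s)\<close> of \<open>d\<alpha> + T\<alpha>\<close> is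
  \<open>E\<^sub>r(\<alpha>\<^sub>s) - E\<^sub>s(\<alpha>\<^sub>r) + \<Sum>\<^sub>h \<alpha>\<^sub>h (f\<^sup>h\<^sub>r\<^sub>s - d\<omega>(E\<^bsub>h'\<^esub>, E\<^sub>r, E\<^sub>s))\<close>.
  That \<open>L\<close> is special Lagrangian is linear algebra in the frame (\<open>special_lagrangian_leaf\<close>).

  The analytic content lies in the definitions. Tangent vectors are derivations, and an exterior
  derivative is evaluated by extending its arguments to arbitrary smooth fields. So the invariant
  formula has to be linear over functions (\<open>koszul_1_tlincomb\<close>, \<open>koszul_2_tlincomb\<close>), which in a frame
  makes the value independent of the extension (\<open>ext_deriv_1\<close>, \<open>ext_deriv_2\<close>). The ambient frame
  spans because every covector is a combination of the coframe, in particular the evaluation of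
  tangent vectors at a function (\<open>framed_manifold_if_dual_frame\<close>). On \<open>L\<close> the frame is only known
  pointwise, as the preimage of \<open>E\<^sub>i, E\<^sub>j, E\<^sub>k\<close> under the injective push-forward. It is smooth because the
  coordinate fields are as many independent vectors as the frame has: the matrix between them is
  invertible with smooth entries (\<open>frame_matrix_inverse\<close>, \<open>dual_frame_smooth\<close>).
\<close>

section \<open>Functions of class \<open>C\<^sup>k\<close>\<close>

lemma Ck_on_subset: "Ck_on k S f \<Longrightarrow> T \<subseteq> S \<Longrightarrow> Ck_on k T f"
  by (induction k arbitrary: f) (auto intro: continuous_on_subset)

text \<open>The recursion only provides derivatives; continuity comes from differentiability, which makes
  the classes decrease in \<open>k\<close>.\<close>

lemma Ck_on_Suc_imp: "Ck_on (Suc k) S f \<Longrightarrow> Ck_on k S f"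
proof (induction k arbitrary: f)
  case 0
  then have "f differentiable_on S"
    by (simp add: differentiable_on_def differentiable_at_withinI)
  then show ?case by (simp add: differentiable_imp_continuous_on)
next
  case (Suc k)
  then have "Ck_on k S (\<lambda>x. frechet_derivative f (at x) v)" for v
    using Suc.prems unfolding Ck_on.simps(2)[of "Suc k"] by (intro Suc.IH) blast
  with Suc.prems show ?case by simp
qed

lemma frechet_derivative_cong_open:
  assumes "open S" "x \<in> S" "\<And>y. y \<in> S \<Longrightarrow> f y = g y"
  shows "frechet_derivative f (at x) = frechet_derivative g (at x)"
proof -
  have "(f has_derivative D) (at x) \<longleftrightarrow> (g has_derivative D) (at x)" for D
  proof
    show "(g has_derivative D) (at x)" if "(f has_derivative D) (at x)"
      by (rule has_derivative_transform_within_open[OF that assms])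
    show "(f has_derivative D) (at x)" if "(g has_derivative D) (at x)"
      by (rule has_derivative_transform_within_open[OF that assms(1,2)]) (simp add: assms(3))
  qed
  then show ?thesis by (simp add: frechet_derivative_def)
qed

lemma Ck_on_cong:
  assumes "open S" "\<And>x. x \<in> S \<Longrightarrow> f x = g x" "Ck_on k S f"
  shows "Ck_on k S g"
  using assms(2,3)
proof (induction k arbitrary: f g)
  case 0
  then show ?case by (auto cong: continuous_on_cong)
next
  case (Suc k)
  have "g differentiable (at x)" if "x \<in> S" for x
    using Suc.prems that assms(1)
    by (meson Ck_on.simps(2) differentiable_def has_derivative_transform_within_open)
  moreover have "Ck_on k S (\<lambda>x. frechet_derivative g (at x) v)" for v
    by (rule Suc.IH[where f = "\<lambda>x. frechet_derivative f (at x) v"])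
      (use Suc.prems frechet_derivative_cong_open[OF assms(1), of _ f g] in auto)
  ultimately show ?case by simp
qed

text \<open>Being of class \<open>C\<^sup>k\<close> is a local property. This is what allows smoothness to be checked in
  one chart at a time.\<close>

lemma Ck_on_UN:
  assumes "\<And>i. i \<in> I \<Longrightarrow> open (N i)" "\<And>i. i \<in> I \<Longrightarrow> Ck_on k (N i) f"
  shows "Ck_on k (\<Union>i\<in>I. N i) f"
  using assms(2)
proof (induction k arbitrary: f)
  case 0
  then show ?case using assms(1) by (auto intro: continuous_on_open_UN)
qed auto

lemma Ck_on_const: "Ck_on k S (\<lambda>x. c)"
proof (induction k arbitrary: c)
  case (Suc k)
  then show ?case by (simp add: frechet_derivative_const)
qed simp

lemma Ck_on_add:
  assumes "open S" "Ck_on k S f" "Ck_on k S g"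
  shows "Ck_on k S (\<lambda>x. f x + g x)"
  using assms(2,3)
proof (induction k arbitrary: f g)
  case (Suc k)
  have fg: "f differentiable (at x)" "g differentiable (at x)" if "x \<in> S" for x
    using Suc.prems that by auto
  have D: "frechet_derivative (\<lambda>x. f x + g x) (at x) v =
      frechet_derivative f (at x) v + frechet_derivative g (at x) v" if "x \<in> S" for x v
    by (rule frechet_derivative_at[symmetric, THEN fun_cong])
      (intro derivative_intros frechet_derivative_works[THEN iffD1] fg that)
  have "Ck_on k S (\<lambda>x. frechet_derivative (\<lambda>x. f x + g x) (at x) v)" for v
    by (rule Ck_on_cong[OF assms(1) _ Suc.IH[of "\<lambda>x. frechet_derivative f (at x) v"
            "\<lambda>x. frechet_derivative g (at x) v"]])
      (use Suc.prems in \<open>auto simp: D\<close>)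
  with fg show ?case by auto
qed (auto intro: continuous_intros)

lemma Ck_on_mult:
  fixes f g :: "'a::euclidean_space \<Rightarrow> real"
  assumes "open S" "Ck_on k S f" "Ck_on k S g"
  shows "Ck_on k S (\<lambda>x. f x * g x)"
  using assms(2,3)
proof (induction k arbitrary: f g)
  case (Suc k)
  have fg: "f differentiable (at x)" "g differentiable (at x)" if "x \<in> S" for x
    using Suc.prems that by auto
  have D: "frechet_derivative (\<lambda>x. f x * g x) (at x) v =
      f x * frechet_derivative g (at x) v + frechet_derivative f (at x) v * g x" if "x \<in> S" for x v
    by (rule frechet_derivative_at[symmetric, THEN fun_cong])
      (intro derivative_intros frechet_derivative_works[THEN iffD1] fg that)
  have "Ck_on k S (\<lambda>x. f x * frechet_derivative g (at x) v + frechet_derivative f (at x) v * g x)" for v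
    using Suc.prems Suc.prems[THEN Ck_on_Suc_imp] by (intro Ck_on_add[OF assms(1)] Suc.IH) auto
  then have "Ck_on k S (\<lambda>x. frechet_derivative (\<lambda>x. f x * g x) (at x) v)" for v
    by (rule Ck_on_cong[OF assms(1), rotated]) (simp add: D)
  with fg show ?case by auto
qed (auto intro: continuous_intros)

lemma Ck_on_sum:
  assumes "open S" "\<And>i. i \<in> I \<Longrightarrow> Ck_on k S (f i)"
  shows "Ck_on k S (\<lambda>x. \<Sum>i\<in>I. f i x)"
  using assms(2)
proof (induction I rule: infinite_finite_induct)
  case (insert i I)
  then have "Ck_on k S (\<lambda>x. f i x + (\<Sum>j\<in>I. f j x))"
    by (intro Ck_on_add[OF assms(1)]) blast+
  with insert(1,2) show ?case by simp
qed (simp_all add: Ck_on_const)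

text \<open>The derivative of \<open>1/f\<close> is \<open>-(1/f) f' (1/f)\<close>, hence a product of functions that are \<open>C\<^sup>k\<close> by
  induction.\<close>

lemma Ck_on_inverse:
  fixes f :: "'a::euclidean_space \<Rightarrow> real"
  assumes "open S" "\<And>x. x \<in> S \<Longrightarrow> f x \<noteq> 0" "Ck_on k S f"
  shows "Ck_on k S (\<lambda>x. inverse (f x))"
  using assms(3)
proof (induction k)
  case 0
  then show ?case using assms(2) by (auto intro: continuous_intros)
next
  case (Suc k)
  have f: "f differentiable (at x)" if "x \<in> S" for x
    using Suc.prems that by simp
  have HD: "((\<lambda>x. inverse (f x)) has_derivative
      (\<lambda>v. - (inverse (f x) * frechet_derivative f (at x) v * inverse (f x)))) (at x)"
    if "x \<in> S" for x
    by (rule Deriv.has_derivative_inverse[where f = f, OF assms(2)[OF that]])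
      (rule frechet_derivative_works[THEN iffD1, OF f[OF that]])
  have inv: "Ck_on k S (\<lambda>x. inverse (f x))"
    by (rule Suc.IH[OF Ck_on_Suc_imp[OF Suc.prems]])
  have D: "Ck_on k S (\<lambda>x. -1 * ((inverse (f x) * frechet_derivative f (at x) v) * inverse (f x)))" for v
    by (rule Ck_on_mult[OF assms(1) Ck_on_const], rule Ck_on_mult[OF assms(1) _ inv],
        rule Ck_on_mult[OF assms(1) inv]) (use Suc.prems in simp)
  have "Ck_on k S (\<lambda>x. frechet_derivative (\<lambda>x. inverse (f x)) (at x) v)" for v
    by (rule Ck_on_cong[OF assms(1) _ D[of v]])
      (simp add: frechet_derivative_at[OF HD, symmetric])
  moreover have "(\<lambda>x. inverse (f x)) differentiable (at x)" if "x \<in> S" for x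
    using HD[OF that] by (rule differentiableI)
  ultimately show ?case by (simp only: Ck_on.simps(2)) blast
qed

lemma Ck_on_inner:
  assumes "open S" "Ck_on k S f"
  shows "Ck_on k S (\<lambda>x. f x \<bullet> b)"
  using assms(2)
proof (induction k arbitrary: f)
  case 0
  then show ?case by (auto intro: continuous_intros)
next
  case (Suc k)
  have HD: "((\<lambda>x. f x \<bullet> b) has_derivative (\<lambda>v. frechet_derivative f (at x) v \<bullet> b)) (at x)"
    if "x \<in> S" for x
    using Suc.prems that by (intro has_derivative_inner_left) (simp add: frechet_derivative_works)
  have D: "Ck_on k S (\<lambda>x. frechet_derivative f (at x) v \<bullet> b)" for v
    using Suc.prems by (intro Suc.IH) simp
  have "Ck_on k S (\<lambda>x. frechet_derivative (\<lambda>x. f x \<bullet> b) (at x) v)" for v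
    by (rule Ck_on_cong[OF assms(1) _ D[of v]]) (simp add: frechet_derivative_at[OF HD, symmetric])
  moreover have "(\<lambda>x. f x \<bullet> b) differentiable (at x)" if "x \<in> S" for x
    using HD[OF that] by (rule differentiableI)
  ultimately show ?case by (simp only: Ck_on.simps(2)) blast
qed

text \<open>By the chain rule the directional derivative of \<open>f \<circ> g\<close> is a sum over the standard basis of
  products of components of the derivative of \<open>g\<close> with partial derivatives of \<open>f\<close> composed with
  \<open>g\<close>; the induction hypothesis applies to the latter.\<close>

lemma Ck_on_compose:
  fixes f :: "'b::euclidean_space \<Rightarrow> real" and g :: "'a::euclidean_space \<Rightarrow> 'b"
  assumes "open S" "g ` S \<subseteq> T" "Ck_on k T f" "Ck_on k S g"
  shows "Ck_on k S (f \<circ> g)"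
  using assms(3,4)
proof (induction k arbitrary: f)
  case 0
  then show ?case
    using assms(2) by (metis Ck_on.simps(1) continuous_on_compose continuous_on_subset)
next
  case (Suc k)
  have f: "f differentiable (at (g x))" and g: "g differentiable (at x)" if "x \<in> S" for x
    using Suc.prems that assms(2) by (simp_all add: image_subset_iff)
  have HD: "((f \<circ> g) has_derivative
      (frechet_derivative f (at (g x)) \<circ> frechet_derivative g (at x))) (at x)" if "x \<in> S" for x
    using f[OF that] g[OF that] unfolding frechet_derivative_works by (rule diff_chain_at[rotated])
  have lin: "linear (frechet_derivative f (at (g x)))" if "x \<in> S" for x
    using f[OF that] by (rule linear_frechet_derivative)
  have expand: "frechet_derivative f (at (g x)) (frechet_derivative g (at x) v) =
      (\<Sum>b\<in>Basis. (frechet_derivative g (at x) v \<bullet> b) * ((\<lambda>y. frechet_derivative f (at y) b) \<circ> g) x)"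
    if "x \<in> S" for x v
  proof -
    have "frechet_derivative f (at (g x)) (\<Sum>b\<in>Basis. (frechet_derivative g (at x) v \<bullet> b) *\<^sub>R b) =
        (\<Sum>b\<in>Basis. (frechet_derivative g (at x) v \<bullet> b) * frechet_derivative f (at (g x)) b)"
      by (simp only: linear_sum[OF lin[OF that]] linear_cmul[OF lin[OF that]] real_scaleR_def)
    then show ?thesis by (simp only: euclidean_representation o_apply)
  qed
  have sm: "Ck_on k S (\<lambda>x. \<Sum>b\<in>Basis. (frechet_derivative g (at x) v \<bullet> b) *
      ((\<lambda>y. frechet_derivative f (at y) b) \<circ> g) x)" for v
  proof (rule Ck_on_sum[OF assms(1)], rule Ck_on_mult[OF assms(1)])
    show "Ck_on k S (\<lambda>x. frechet_derivative g (at x) v \<bullet> b)" for b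
      using Suc.prems(2) by (intro Ck_on_inner[OF assms(1)]) simp
    show "Ck_on k S (\<lambda>x. ((\<lambda>y. frechet_derivative f (at y) b) \<circ> g) x)" for b
      using Suc.prems(1) Suc.IH[of "\<lambda>y. frechet_derivative f (at y) b", OF _ Ck_on_Suc_imp[OF Suc.prems(2)]]
      by (simp add: o_def)
  qed
  have "Ck_on k S (\<lambda>x. frechet_derivative (f \<circ> g) (at x) v)" for v
    by (rule Ck_on_cong[OF assms(1) _ sm[of v]])
      (simp only: expand frechet_derivative_at[OF HD, symmetric] o_apply)
  moreover have "(f \<circ> g) differentiable (at x)" if "x \<in> S" for x
    using HD[OF that] by (auto simp: differentiable_def)
  ultimately show ?case by (simp only: Ck_on.simps(2)) blast
qed

lemma Cinf_on_frechet: "Cinf_on S f \<Longrightarrow> Cinf_on S (\<lambda>x. frechet_derivative f (at x) v)"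
  unfolding Cinf_on_def using Ck_on.simps(2) by blast

lemma Cinf_on_differentiable: "Cinf_on S f \<Longrightarrow> x \<in> S \<Longrightarrow> f differentiable (at x)"
  by (meson Cinf_on_def Ck_on.simps(2))

section \<open>Smooth functions on a manifold\<close>

lemma chart_open_image:
  assumes "smooth_manifold A" "(U, \<phi>) \<in> A" "open W"
  shows "open (\<phi> ` (U \<inter> W))"
proof -
  have h: "homeomorphism U (\<phi> ` U) \<phi> (inv_into U \<phi>)" and o: "open (\<phi> ` U)"
    using assms(1,2) by (auto simp: smooth_manifold_def)
  have "openin (top_of_set (\<phi> ` U)) (\<phi> ` (U \<inter> W))"
    by (rule homeomorphism_imp_open_map[OF h]) (use assms(3) in blast)
  with o show ?thesis by (simp add: openin_open_eq)
qed

lemma chart_domain_open: "smooth_manifold A \<Longrightarrow> (U, \<phi>) \<in> A \<Longrightarrow> open U"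
  by (auto simp: smooth_manifold_def)

lemma chart_inverse:
  assumes "smooth_manifold A" "(U, \<phi>) \<in> A" "q \<in> U"
  shows "inv_into U \<phi> (\<phi> q) = q"
proof -
  have "homeomorphism U (\<phi> ` U) \<phi> (inv_into U \<phi>)"
    using assms(1,2) by (auto simp: smooth_manifold_def)
  then show ?thesis using assms(3) by (simp add: homeomorphism_def)
qed

lemma chart_exists:
  assumes "smooth_manifold A"
  obtains U \<phi> where "(U, \<phi>) \<in> A" "p \<in> U"
  using assms UNIV_I[of p] unfolding smooth_manifold_def by blast

lemma smooth_onD: "smooth_on A W f \<Longrightarrow> (U, \<phi>) \<in> A \<Longrightarrow> Cinf_on (\<phi> ` (U \<inter> W)) (f \<circ> inv_into U \<phi>)"
  by (auto simp: smooth_on_def)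

lemma smooth_on_subset: "smooth_on A W f \<Longrightarrow> W' \<subseteq> W \<Longrightarrow> smooth_on A W' f"
  unfolding smooth_on_def Cinf_on_def
  by (blast intro: Ck_on_subset image_mono Int_mono)

lemma smooth_on_cong:
  assumes "smooth_manifold A" "open W" "smooth_on A W f" "\<And>q. q \<in> W \<Longrightarrow> f q = g q"
  shows "smooth_on A W g"
  unfolding smooth_on_def Cinf_on_def
proof clarify
  fix U \<phi> k assume c: "(U, \<phi>) \<in> A"
  have "Ck_on k (\<phi> ` (U \<inter> W)) (f \<circ> inv_into U \<phi>)"
    using smooth_onD[OF assms(3) c] by (auto simp: Cinf_on_def)
  then show "Ck_on k (\<phi> ` (U \<inter> W)) (g \<circ> inv_into U \<phi>)"
    by (rule Ck_on_cong[OF chart_open_image[OF assms(1) c assms(2)], rotated])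
      (use chart_inverse[OF assms(1) c] assms(4) in auto)
qed

lemma smooth_on_const: "smooth_on A W (\<lambda>q. c)"
  by (auto simp: smooth_on_def Cinf_on_def o_def Ck_on_const)

lemma smooth_on_add:
  assumes "smooth_manifold A" "open W" "smooth_on A W f" "smooth_on A W g"
  shows "smooth_on A W (\<lambda>q. f q + g q)"
  unfolding smooth_on_def Cinf_on_def
proof clarify
  fix U \<phi> k assume c: "(U, \<phi>) \<in> A"
  have "Ck_on k (\<phi> ` (U \<inter> W)) (\<lambda>x. (f \<circ> inv_into U \<phi>) x + (g \<circ> inv_into U \<phi>) x)"
    using smooth_onD[OF assms(3) c] smooth_onD[OF assms(4) c] unfolding Cinf_on_def
    by (intro Ck_on_add[OF chart_open_image[OF assms(1) c assms(2)]]) blast+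
  then show "Ck_on k (\<phi> ` (U \<inter> W)) ((\<lambda>q. f q + g q) \<circ> inv_into U \<phi>)" by (simp add: o_def)
qed

lemma smooth_on_mult:
  assumes "smooth_manifold A" "open W" "smooth_on A W f" "smooth_on A W g"
  shows "smooth_on A W (\<lambda>q. f q * g q)"
  unfolding smooth_on_def Cinf_on_def
proof clarify
  fix U \<phi> k assume c: "(U, \<phi>) \<in> A"
  have "Ck_on k (\<phi> ` (U \<inter> W)) (\<lambda>x. (f \<circ> inv_into U \<phi>) x * (g \<circ> inv_into U \<phi>) x)"
    using smooth_onD[OF assms(3) c] smooth_onD[OF assms(4) c] unfolding Cinf_on_def
    by (intro Ck_on_mult[OF chart_open_image[OF assms(1) c assms(2)]]) blast+
  then show "Ck_on k (\<phi> ` (U \<inter> W)) ((\<lambda>q. f q * g q) \<circ> inv_into U \<phi>)" by (simp add: o_def)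
qed

lemma smooth_on_diff:
  assumes "smooth_manifold A" "open W" "smooth_on A W f" "smooth_on A W g"
  shows "smooth_on A W (\<lambda>q. f q - g q)"
  using smooth_on_add[OF assms(1-3) smooth_on_mult[OF assms(1,2) smooth_on_const[of _ _ "-1"] assms(4)]]
  by simp

lemma smooth_on_sum:
  assumes "smooth_manifold A" "open W" "\<And>i. i \<in> I \<Longrightarrow> smooth_on A W (f i)"
  shows "smooth_on A W (\<lambda>q. \<Sum>i\<in>I. f i q)"
  using assms(3)
proof (induction I rule: infinite_finite_induct)
  case (insert i I)
  then have "smooth_on A W (\<lambda>q. f i q + (\<Sum>j\<in>I. f j q))"
    by (intro smooth_on_add[OF assms(1,2)]) blast+
  with insert(1,2) show ?case by simp
qed (simp_all add: smooth_on_const)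

lemma smooth_on_prod:
  assumes "smooth_manifold A" "open W" "\<And>i. i \<in> I \<Longrightarrow> smooth_on A W (f i)"
  shows "smooth_on A W (\<lambda>q. \<Prod>i\<in>I. f i q)"
  using assms(3)
proof (induction I rule: infinite_finite_induct)
  case (insert i I)
  then have "smooth_on A W (\<lambda>q. f i q * (\<Prod>j\<in>I. f j q))"
    by (intro smooth_on_mult[OF assms(1,2)]) blast+
  with insert(1,2) show ?case by simp
qed (simp_all add: smooth_on_const)

lemma smooth_on_inverse:
  assumes "smooth_manifold A" "open W" "\<And>q. q \<in> W \<Longrightarrow> f q \<noteq> 0" "smooth_on A W f"
  shows "smooth_on A W (\<lambda>q. inverse (f q))"
  unfolding smooth_on_def Cinf_on_def
proof clarify
  fix U \<phi> k assume c: "(U, \<phi>) \<in> A"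
  have "Ck_on k (\<phi> ` (U \<inter> W)) (\<lambda>x. inverse ((f \<circ> inv_into U \<phi>) x))"
  proof (rule Ck_on_inverse[OF chart_open_image[OF assms(1) c assms(2)]])
    show "(f \<circ> inv_into U \<phi>) x \<noteq> 0" if "x \<in> \<phi> ` (U \<inter> W)" for x
      using that chart_inverse[OF assms(1) c] assms(3) by auto
    show "Ck_on k (\<phi> ` (U \<inter> W)) (f \<circ> inv_into U \<phi>)"
      using smooth_onD[OF assms(4) c] by (simp add: Cinf_on_def)
  qed
  then show "Ck_on k (\<phi> ` (U \<inter> W)) ((\<lambda>q. inverse (f q)) \<circ> inv_into U \<phi>)"
    by (simp add: o_def)
qed

lemma smooth_on_UN:
  assumes "smooth_manifold A" "\<And>i. i \<in> I \<Longrightarrow> open (N i)" "\<And>i. i \<in> I \<Longrightarrow> smooth_on A (N i) f"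
  shows "smooth_on A (\<Union>i\<in>I. N i) f"
  unfolding smooth_on_def Cinf_on_def
proof clarify
  fix U \<phi> k assume c: "(U, \<phi>) \<in> A"
  have "Ck_on k (\<Union>i\<in>I. \<phi> ` (U \<inter> N i)) (f \<circ> inv_into U \<phi>)"
    using smooth_onD[OF assms(3) c] chart_open_image[OF assms(1) c assms(2)]
    by (intro Ck_on_UN) (auto simp: Cinf_on_def)
  moreover have "(\<Union>i\<in>I. \<phi> ` (U \<inter> N i)) = \<phi> ` (U \<inter> (\<Union>i\<in>I. N i))" by blast
  ultimately show "Ck_on k (\<phi> ` (U \<inter> (\<Union>i\<in>I. N i))) (f \<circ> inv_into U \<phi>)" by simp
qed

lemma smooth_atI: "smooth_on A W f \<Longrightarrow> open W \<Longrightarrow> p \<in> W \<Longrightarrow> smooth_at A p f"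
  by (auto simp: smooth_at_def)

lemma smooth_on_if_smooth_at:
  assumes "smooth_manifold A" "\<And>p. p \<in> W \<Longrightarrow> smooth_at A p f"
  shows "smooth_on A W f"
proof -
  obtain N where N: "open (N p)" "p \<in> N p" "smooth_on A (N p) f" if "p \<in> W" for p
    using assms(2) unfolding smooth_at_def by metis
  have "smooth_on A (\<Union>p\<in>W. N p) f"
    using N by (intro smooth_on_UN[OF assms(1)]) auto
  then show ?thesis by (rule smooth_on_subset) (use N in auto)
qed

lemma smooth_map_onD:
  "smooth_map_on A B W F \<Longrightarrow> (U, \<phi>) \<in> A \<Longrightarrow> (V, \<psi>) \<in> B
    \<Longrightarrow> Cinf_on (\<phi> ` (U \<inter> W \<inter> F -` V)) (\<psi> \<circ> F \<circ> inv_into U \<phi>)"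
  unfolding smooth_map_on_def by blast

lemma chart_transition:
  "smooth_manifold A \<Longrightarrow> (U, \<phi>) \<in> A \<Longrightarrow> (V, \<psi>) \<in> A
    \<Longrightarrow> Cinf_on (\<phi> ` (U \<inter> V)) (\<psi> \<circ> inv_into U \<phi>)"
  unfolding smooth_manifold_def by blast

text \<open>The charts of the target cut \<open>F -` W\<close> into open pieces; on each of them \<open>f \<circ> F\<close> factors in
  coordinates through the coordinate expressions of \<open>F\<close> and \<open>f\<close>.\<close>

lemma smooth_on_comp:
  fixes f :: "'n::{t2_space,second_countable_topology} \<Rightarrow> real"
  assumes A: "smooth_manifold A" and B: "smooth_manifold B" and F: "smooth_map_on A B UNIV F"
    and W: "open W" and f: "smooth_on B W f"
  shows "smooth_on A (F -` W) (\<lambda>q. f (F q))"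
  unfolding smooth_on_def Cinf_on_def
proof clarify
  fix U \<phi> k assume c: "(U, \<phi>) \<in> A"
  have opn: "open (F -` V)" if "open V" for V
    using F that by (simp add: smooth_map_on_def continuous_on_open_vimage)
  define N where "N V = \<phi> ` (U \<inter> F -` (V \<inter> W))" for V :: "'n set"
  have "Ck_on k (\<Union>(V, \<psi>)\<in>B. N V) ((\<lambda>q. f (F q)) \<circ> inv_into U \<phi>)"
  proof (rule Ck_on_UN; clarify)
    fix V \<psi> assume d: "(V, \<psi>) \<in> B"
    have oV: "open V" using chart_domain_open[OF B d] .
    then show oN: "open (N V)"
      unfolding N_def using W by (intro chart_open_image[OF A c] opn) auto
    have g: "Ck_on k (N V) (\<psi> \<circ> F \<circ> inv_into U \<phi>)"
      by (rule Ck_on_subset[of k "\<phi> ` (U \<inter> UNIV \<inter> F -` V)"])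
        (use smooth_map_onD[OF F c d] in \<open>auto simp: Cinf_on_def N_def\<close>)
    have h: "Ck_on k (\<psi> ` (V \<inter> W)) (f \<circ> inv_into V \<psi>)"
      using smooth_onD[OF f d] by (simp add: Cinf_on_def)
    have "Ck_on k (N V) ((f \<circ> inv_into V \<psi>) \<circ> (\<psi> \<circ> F \<circ> inv_into U \<phi>))"
      by (rule Ck_on_compose[OF oN _ h g]) (auto simp: N_def chart_inverse[OF A c])
    then show "Ck_on k (N V) ((\<lambda>q. f (F q)) \<circ> inv_into U \<phi>)"
      by (rule Ck_on_cong[OF oN, rotated])
        (auto simp: N_def chart_inverse[OF A c] chart_inverse[OF B d])
  qed
  moreover have "(\<Union>(V, \<psi>)\<in>B. N V) = \<phi> ` (U \<inter> F -` W)"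
    using B chart_exists[OF B] unfolding N_def by (fastforce simp: smooth_manifold_def)
  ultimately show "Ck_on k (\<phi> ` (U \<inter> F -` W)) ((\<lambda>q. f (F q)) \<circ> inv_into U \<phi>)" by simp
qed

text \<open>A single chart suffices to check smoothness inside its domain, because the expressions in the
  other charts arise by composition with transition maps.\<close>

lemma smooth_on_chart:
  assumes A: "smooth_manifold A" and c: "(U, \<phi>) \<in> A" and W: "open W" "W \<subseteq> U"
    and f: "Cinf_on (\<phi> ` W) (f \<circ> inv_into U \<phi>)"
  shows "smooth_on A W f"
  unfolding smooth_on_def Cinf_on_def
proof clarify
  fix V \<psi> k assume d: "(V, \<psi>) \<in> A"
  have o: "open (\<psi> ` (V \<inter> W))" by (rule chart_open_image[OF A d W(1)])
  have "Cinf_on (\<psi> ` (V \<inter> U)) (\<phi> \<circ> inv_into V \<psi>)"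
    using chart_transition[OF A d c] .
  then have g: "Ck_on k (\<psi> ` (V \<inter> W)) (\<phi> \<circ> inv_into V \<psi>)"
    using W(2) by (auto simp: Cinf_on_def intro: Ck_on_subset)
  have "Ck_on k (\<psi> ` (V \<inter> W)) ((f \<circ> inv_into U \<phi>) \<circ> (\<phi> \<circ> inv_into V \<psi>))"
    by (rule Ck_on_compose[OF o _ _ g, of "\<phi> ` W"])
      (use f in \<open>auto simp: chart_inverse[OF A d] Cinf_on_def\<close>)
  then show "Ck_on k (\<psi> ` (V \<inter> W)) (f \<circ> inv_into V \<psi>)"
    by (rule Ck_on_cong[OF o, rotated])
      (use W(2) in \<open>auto simp: chart_inverse[OF A d] chart_inverse[OF A c]\<close>)
qed

lemma smooth_on_coordinate:
  assumes A: "smooth_manifold A" and c: "(U, \<phi>) \<in> A"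
  shows "smooth_on A U (\<lambda>q. \<phi> q \<bullet> b)"
  unfolding smooth_on_def Cinf_on_def
proof clarify
  fix V \<psi> k assume d: "(V, \<psi>) \<in> A"
  have "Ck_on k (\<psi> ` (V \<inter> U)) (\<phi> \<circ> inv_into V \<psi>)"
    using chart_transition[OF A d c] by (simp add: Cinf_on_def)
  then have "Ck_on k (\<psi> ` (V \<inter> U)) (\<lambda>x. (\<phi> \<circ> inv_into V \<psi>) x \<bullet> b)"
    by (rule Ck_on_inner[OF chart_open_image[OF A d chart_domain_open[OF A c]]])
  then show "Ck_on k (\<psi> ` (V \<inter> U)) ((\<lambda>q. \<phi> q \<bullet> b) \<circ> inv_into V \<psi>)"
    by (simp add: o_def)
qed

section \<open>Tangent vectors as derivations\<close>

lemma smooth_at_cong: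
  assumes "smooth_manifold A" "open W" "p \<in> W" "\<And>q. q \<in> W \<Longrightarrow> f q = g q" "smooth_at A p f"
  shows "smooth_at A p g"
proof -
  obtain N where N: "open N" "p \<in> N" "smooth_on A N f"
    using assms(5) by (auto simp: smooth_at_def)
  have "smooth_on A (N \<inter> W) g"
  proof (rule smooth_on_cong[OF assms(1)])
    show "smooth_on A (N \<inter> W) f" by (rule smooth_on_subset[OF N(3)]) simp
  qed (use N assms(2,4) in auto)
  then show ?thesis using N assms(2,3) by (auto intro: smooth_atI)
qed

lemma tangent_spaceD:
  assumes "v \<in> tangent_space A p"
  shows "\<not> smooth_at A p f \<Longrightarrow> v f = 0"
    and "smooth_at A p f \<Longrightarrow> smooth_at A p g \<Longrightarrow> v (\<lambda>x. f x + g x) = v f + v g"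
    and "smooth_at A p f \<Longrightarrow> smooth_at A p g \<Longrightarrow> v (\<lambda>x. f x * g x) = f p * v g + g p * v f"
    and "smooth_at A p f \<Longrightarrow> v (\<lambda>x. c * f x) = c * v f"
  using assms by (auto simp: tangent_space_def)

lemma smooth_at_const: "smooth_at A p (\<lambda>q. c)"
  by (rule smooth_atI[OF smooth_on_const[of A UNIV]]) auto

lemma smooth_at_add:
  assumes "smooth_manifold A" "smooth_at A p f" "smooth_at A p g"
  shows "smooth_at A p (\<lambda>q. f q + g q)"
proof -
  obtain M N where "open M" "p \<in> M" "smooth_on A M f" "open N" "p \<in> N" "smooth_on A N g"
    using assms(2,3) by (auto simp: smooth_at_def)
  then show ?thesis
    by (intro smooth_atI[of A "M \<inter> N"] smooth_on_add[OF assms(1)]) (auto elim: smooth_on_subset)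
qed

lemma smooth_at_mult:
  assumes "smooth_manifold A" "smooth_at A p f" "smooth_at A p g"
  shows "smooth_at A p (\<lambda>q. f q * g q)"
proof -
  obtain M N where "open M" "p \<in> M" "smooth_on A M f" "open N" "p \<in> N" "smooth_on A N g"
    using assms(2,3) by (auto simp: smooth_at_def)
  then show ?thesis
    by (intro smooth_atI[of A "M \<inter> N"] smooth_on_mult[OF assms(1)]) (auto elim: smooth_on_subset)
qed

lemma smooth_at_sum:
  assumes "smooth_manifold A" "\<And>i. i \<in> I \<Longrightarrow> smooth_at A p (f i)"
  shows "smooth_at A p (\<lambda>q. \<Sum>i\<in>I. f i q)"
  using assms(2)
proof (induction I rule: infinite_finite_induct)
  case (insert i I)
  then have "smooth_at A p (\<lambda>q. f i q + (\<Sum>j\<in>I. f j q))"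
    by (intro smooth_at_add[OF assms(1)]) blast+
  with insert(1,2) show ?case by simp
qed (simp_all add: smooth_at_const)

lemma tangent_const:
  assumes "v \<in> tangent_space A p"
  shows "v (\<lambda>q. c) = 0"
proof -
  have "v (\<lambda>q. 1) = v (\<lambda>q. 1) + v (\<lambda>q. 1)"
    using tangent_spaceD(3)[OF assms, of "\<lambda>q. 1" "\<lambda>q. 1"] by (simp add: smooth_at_const)
  moreover have "v (\<lambda>q. c) = c * v (\<lambda>q. 1)"
    using tangent_spaceD(4)[OF assms, of "\<lambda>q. 1" c] by (simp add: smooth_at_const)
  ultimately show ?thesis by simp
qed

text \<open>A derivation sees only germs: the indicator function of \<open>W\<close> is idempotent, so the product rule
  forces every tangent vector at \<open>p\<close> to vanish on it, and multiplying \<open>f\<close> and \<open>g\<close> by it makes them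
  equal without changing the values of \<open>v\<close>. The argument also covers functions that are
  not smooth at \<open>p\<close>, where both values are 0.\<close>

lemma tangent_local:
  assumes A: "smooth_manifold A" and v: "v \<in> tangent_space A p"
    and W: "open W" "p \<in> W" and eq: "\<And>q. q \<in> W \<Longrightarrow> f q = g q"
  shows "v f = v g"
proof (cases "smooth_at A p f")
  case True
  have g: "smooth_at A p g" by (rule smooth_at_cong[OF A W _ True]) (rule eq)
  \<comment> \<open>The indicator function of \<open>W\<close> is locally constant at \<open>p\<close>.\<close>
  define ind where "ind = (\<lambda>q. if q \<in> W then 1 else 0 :: real)"
  have ind: "smooth_at A p ind"
    by (rule smooth_at_cong[OF A W _ smooth_at_const[of A p 1]]) (simp add: ind_def)
  have [simp]: "ind p = 1" using W by (simp add: ind_def)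
  have "(\<lambda>q. ind q * ind q) = ind" by (auto simp: ind_def)
  then have ind0: "v ind = 0" using tangent_spaceD(3)[OF v ind ind] by simp
  have "(\<lambda>q. ind q * f q) = (\<lambda>q. ind q * g q)" using eq by (auto simp: ind_def)
  then show ?thesis
    using tangent_spaceD(3)[OF v ind True] tangent_spaceD(3)[OF v ind g] ind0 by simp
next
  case False
  then have "\<not> smooth_at A p g" using smooth_at_cong[OF A W, of g f] eq by metis
  with False show ?thesis using tangent_spaceD(1)[OF v] by metis
qed

lemma tangent_sum:
  assumes A: "smooth_manifold A" and v: "v \<in> tangent_space A p"
    and f: "\<And>i. i \<in> I \<Longrightarrow> smooth_at A p (f i)"
  shows "v (\<lambda>q. \<Sum>i\<in>I. f i q) = (\<Sum>i\<in>I. v (f i))"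
  using f
proof (induction I rule: infinite_finite_induct)
  case (insert i I)
  then show ?case
    using tangent_spaceD(2)[OF v, of "f i" "\<lambda>q. \<Sum>i\<in>I. f i q"] smooth_at_sum[OF A, of I p f]
    by auto
qed (auto simp: tangent_const[OF v])

lemma tangent_lincomb2:
  assumes "u \<in> tangent_space A p" "w \<in> tangent_space A p"
  shows "(\<lambda>f. a * u f + b * w f) \<in> tangent_space A p"
  using assms by (auto simp: tangent_space_def algebra_simps)

lemma tangent_zero: "(\<lambda>f. 0) \<in> tangent_space A p"
  by (auto simp: tangent_space_def)

lemma tlincomb_insert:
  "finite I \<Longrightarrow> i \<notin> I \<Longrightarrow> tlincomb (insert i I) c v = (\<lambda>f. c i * v i f + 1 * tlincomb I c v f)"
  by (auto simp: tlincomb_def)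

lemma tlincomb_tangent:
  assumes "\<And>i. i \<in> I \<Longrightarrow> v i \<in> tangent_space A p"
  shows "tlincomb I c v \<in> tangent_space A p"
  using assms
proof (induction I rule: infinite_finite_induct)
  case (insert i I)
  then show ?case unfolding tlincomb_insert[OF insert(1,2)] by (intro tangent_lincomb2) auto
qed (auto simp: tlincomb_def tangent_zero)

section \<open>Alternating forms and vector fields\<close>

lemma alternating_at_tangent:
  "alternating_at A k p \<eta> \<Longrightarrow> \<not> (length vs = k \<and> set vs \<subseteq> tangent_space A p) \<Longrightarrow> \<eta> vs = 0"
  by (auto simp: alternating_at_def)

text \<open>Linearity in the definition is stated for list updates; for calculations the argument is
  better displayed between a prefix \<open>xs\<close> and a suffix \<open>ys\<close>.\<close>

lemma alternating_at_linear:
  assumes "alternating_at A k p \<eta>" "length xs + length ys + 1 = k"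
    "set xs \<subseteq> tangent_space A p" "set ys \<subseteq> tangent_space A p"
    "u \<in> tangent_space A p" "w \<in> tangent_space A p"
  shows "\<eta> (xs @ (\<lambda>f. a * u f + b * w f) # ys) = a * \<eta> (xs @ u # ys) + b * \<eta> (xs @ w # ys)"
proof -
  have "\<eta> ((xs @ u # ys)[length xs := \<lambda>f. a * u f + b * w f]) =
      a * \<eta> ((xs @ u # ys)[length xs := u]) + b * \<eta> ((xs @ u # ys)[length xs := w])"
  proof -
    have "length (xs @ u # ys) = k" "set (xs @ u # ys) \<subseteq> tangent_space A p" "length xs < k"
      using assms by auto
    with assms(1,5,6) show ?thesis unfolding alternating_at_def by blast
  qed
  then show ?thesis by simp
qed

lemma alternating_at_tlincomb:
  assumes \<eta>: "alternating_at A k p \<eta>" "length xs + length ys + 1 = k"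
    "set xs \<subseteq> tangent_space A p" "set ys \<subseteq> tangent_space A p"
    and v: "\<And>i. i \<in> I \<Longrightarrow> v i \<in> tangent_space A p"
  shows "\<eta> (xs @ tlincomb I c v # ys) = (\<Sum>i\<in>I. c i * \<eta> (xs @ v i # ys))"
proof -
  have zero: "\<eta> (xs @ (\<lambda>f. 0) # ys) = 0"
    using alternating_at_linear[OF \<eta> tangent_zero tangent_zero, of 0 0] by simp
  show ?thesis using v
  proof (induction I rule: infinite_finite_induct)
    case (insert i I)
    then show ?case
      unfolding tlincomb_insert[OF insert(1,2)]
      by (subst alternating_at_linear[OF \<eta>]) (auto intro!: tlincomb_tangent)
  qed (auto simp: zero tlincomb_def)
qed

text \<open>Polarisation: expand the value on a repeated argument \<open>u + w\<close>.\<close>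

lemma alternating_at_swap:
  assumes \<eta>: "alternating_at A k p \<eta>" and l: "length xs + length ys + 2 = k"
    and t: "set xs \<subseteq> tangent_space A p" "set ys \<subseteq> tangent_space A p"
    "u \<in> tangent_space A p" "w \<in> tangent_space A p"
  shows "\<eta> (xs @ w # u # ys) = - \<eta> (xs @ u # w # ys)"
proof -
  have eq0: "\<eta> (xs @ z # z # ys) = 0" if "z \<in> tangent_space A p" for z
  proof -
    have "length (xs @ z # z # ys) = k \<and> set (xs @ z # z # ys) \<subseteq> tangent_space A p \<and>
       length xs < Suc (length xs) \<and> Suc (length xs) < k \<and>
       (xs @ z # z # ys) ! length xs = (xs @ z # z # ys) ! Suc (length xs)"
      using l t that by (auto simp: nth_append)
    then show ?thesis using \<eta> unfolding alternating_at_def by blast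
  qed
  define s where "s = (\<lambda>f. 1 * u f + 1 * w f)"
  have s: "s \<in> tangent_space A p" unfolding s_def by (rule tangent_lincomb2) fact+
  have "0 = \<eta> (xs @ s # s # ys)" using eq0[OF s] by simp
  also have "\<dots> = \<eta> (xs @ u # s # ys) + \<eta> (xs @ w # s # ys)"
    unfolding s_def[symmetric]
    using alternating_at_linear[OF \<eta>, of xs "s # ys" u w 1 1] l t s by (simp add: s_def)
  also have "\<eta> (xs @ u # s # ys) = \<eta> (xs @ u # u # ys) + \<eta> (xs @ u # w # ys)"
    using alternating_at_linear[OF \<eta>, of "xs @ [u]" "ys" u w 1 1] l t s by (simp add: s_def)
  also have "\<eta> (xs @ w # s # ys) = \<eta> (xs @ w # u # ys) + \<eta> (xs @ w # w # ys)"
    using alternating_at_linear[OF \<eta>, of "xs @ [w]" "ys" u w 1 1] l t s by (simp add: s_def)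
  finally show ?thesis using eq0 t by simp
qed

lemma smooth_form_alternating: "smooth_form A k \<eta> \<Longrightarrow> alternating_at A k p (\<eta> p)"
  by (simp add: smooth_form_def)

lemma smooth_form_on:
  "smooth_form A k \<eta> \<Longrightarrow> length Vs = k \<Longrightarrow> open W \<Longrightarrow> (\<And>V. V \<in> set Vs \<Longrightarrow> smooth_vfield A W V)
    \<Longrightarrow> smooth_on A W (\<lambda>p. \<eta> p (map (\<lambda>V. V p) Vs))"
  by (simp add: smooth_form_def)

lemma smooth_vfieldD:
  assumes "smooth_vfield A W V"
  shows "open W" and "p \<in> W \<Longrightarrow> V p \<in> tangent_space A p"
    and "open W' \<Longrightarrow> W' \<subseteq> W \<Longrightarrow> smooth_on A W' f \<Longrightarrow> smooth_on A W' (\<lambda>q. V q f)"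
  using assms by (auto simp: smooth_vfield_def)

lemma smooth_vfield_subset:
  "smooth_vfield A W V \<Longrightarrow> open W' \<Longrightarrow> W' \<subseteq> W \<Longrightarrow> smooth_vfield A W' V"
  unfolding smooth_vfield_def by blast

lemma smooth_vfield_smooth_at:
  assumes "smooth_vfield A W V" "p \<in> W" "smooth_at A p f"
  shows "smooth_at A p (\<lambda>q. V q f)"
proof -
  obtain N where "open N" "p \<in> N" "smooth_on A N f" using assms(3) by (auto simp: smooth_at_def)
  then show ?thesis
    using smooth_vfieldD(3)[OF assms(1), of "N \<inter> W" f] smooth_vfieldD(1)[OF assms(1)] assms(2)
    by (auto intro!: smooth_atI[of A "N \<inter> W"] intro: smooth_on_subset)
qed

lemma smooth_vfield_tlincomb:
  assumes A: "smooth_manifold A" and W: "open W"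
    and V: "\<And>i. i \<in> I \<Longrightarrow> smooth_vfield A W (V i)" and c: "\<And>i. i \<in> I \<Longrightarrow> smooth_on A W (c i)"
  shows "smooth_vfield A W (\<lambda>p. tlincomb I (\<lambda>i. c i p) (\<lambda>i. V i p))"
  unfolding smooth_vfield_def
proof (intro conjI ballI allI impI)
  show "tlincomb I (\<lambda>i. c i p) (\<lambda>i. V i p) \<in> tangent_space A p" if "p \<in> W" for p
    using V that by (intro tlincomb_tangent) (auto dest: smooth_vfieldD(2))
  show "smooth_on A W' (\<lambda>q. tlincomb I (\<lambda>i. c i q) (\<lambda>i. V i q) f)"
    if "open W'" "W' \<subseteq> W" "smooth_on A W' f" for W' f
    unfolding tlincomb_def using that smooth_on_subset[OF c] smooth_vfieldD(3)[OF V]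
    by (intro smooth_on_sum[OF A] smooth_on_mult[OF A]) auto
qed (rule W)

lemma smooth_form_smooth_at1:
  assumes "smooth_form A 1 \<eta>" "smooth_vfield A W U" "p \<in> W"
  shows "smooth_at A p (\<lambda>q. \<eta> q [U q])"
  using smooth_form_on[OF assms(1), of "[U]" W] smooth_vfieldD(1)[OF assms(2)] assms(2,3)
  by (auto intro: smooth_atI)

lemma smooth_form_smooth_at2:
  assumes "smooth_form A 2 \<eta>" "smooth_vfield A W U" "smooth_vfield A W V" "p \<in> W"
  shows "smooth_at A p (\<lambda>q. \<eta> q [U q, V q])"
  using smooth_form_on[OF assms(1), of "[U, V]" W] smooth_vfieldD(1)[OF assms(2)] assms
  by (auto intro: smooth_atI)

text \<open>In the product rule for \<open>UV - VU\<close> the mixed terms \<open>(Uf)(Vg) + (Ug)(Vf)\<close> are symmetric in \<open>U\<close>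
  and \<open>V\<close> and cancel.\<close>

lemma lie_bracket_tangent:
  assumes A: "smooth_manifold A" and U: "smooth_vfield A W U" and V: "smooth_vfield A W V" and p: "p \<in> W"
  shows "lie_bracket A U V p \<in> tangent_space A p"
proof -
  note W = smooth_vfieldD(1)[OF U]
  note Up = smooth_vfieldD(2)[OF U p] and Vp = smooth_vfieldD(2)[OF V p]
  have sU: "smooth_at A p (\<lambda>q. U q f)" and sV: "smooth_at A p (\<lambda>q. V q f)"
    if "smooth_at A p f" for f
    using smooth_vfield_smooth_at U V p that by metis+
  have loc: "\<exists>M. open M \<and> p \<in> M \<and> M \<subseteq> W \<and> (\<forall>q\<in>M. smooth_at A q f \<and> smooth_at A q g)"
    if "smooth_at A p f" "smooth_at A p g" for f g
  proof -
    obtain N M where "open N" "p \<in> N" "smooth_on A N f" "open M" "p \<in> M" "smooth_on A M g"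
      using \<open>smooth_at A p f\<close> \<open>smooth_at A p g\<close> by (auto simp: smooth_at_def)
    then show ?thesis using W p
      by (intro exI[of _ "N \<inter> M \<inter> W"]) (auto intro: smooth_atI)
  qed
  have add: "X p (\<lambda>q. Y q (\<lambda>x. f x + g x)) = X p (\<lambda>q. Y q f) + X p (\<lambda>q. Y q g)"
    if X: "smooth_vfield A W X" and Y: "smooth_vfield A W Y" and f: "smooth_at A p f" and g: "smooth_at A p g"
    for X Y f g
  proof -
    obtain M where M: "open M" "p \<in> M" "M \<subseteq> W" "\<forall>q\<in>M. smooth_at A q f \<and> smooth_at A q g"
      using loc[OF f g] by blast
    have "X p (\<lambda>q. Y q (\<lambda>x. f x + g x)) = X p (\<lambda>q. Y q f + Y q g)"
      by (rule tangent_local[OF A smooth_vfieldD(2)[OF X p] M(1,2)])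
        (use M smooth_vfieldD(2)[OF Y] in \<open>auto intro!: tangent_spaceD(2)\<close>)
    then show ?thesis
      using tangent_spaceD(2)[OF smooth_vfieldD(2)[OF X p]] smooth_vfield_smooth_at[OF Y p] f g by auto
  qed
  have cmul: "X p (\<lambda>q. Y q (\<lambda>x. c * f x)) = c * X p (\<lambda>q. Y q f)"
    if X: "smooth_vfield A W X" and Y: "smooth_vfield A W Y" and f: "smooth_at A p f" for X Y f c
  proof -
    obtain M where M: "open M" "p \<in> M" "M \<subseteq> W" "\<forall>q\<in>M. smooth_at A q f \<and> smooth_at A q f"
      using loc[OF f f] by blast
    have "X p (\<lambda>q. Y q (\<lambda>x. c * f x)) = X p (\<lambda>q. c * Y q f)"
      by (rule tangent_local[OF A smooth_vfieldD(2)[OF X p] M(1,2)])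
        (use M tangent_spaceD(4)[OF smooth_vfieldD(2)[OF Y]] in auto)
    then show ?thesis
      using tangent_spaceD(4)[OF smooth_vfieldD(2)[OF X p]] smooth_vfield_smooth_at[OF Y p] f by auto
  qed
  have mult: "X p (\<lambda>q. Y q (\<lambda>x. f x * g x)) =
      f p * X p (\<lambda>q. Y q g) + Y p g * X p f + (g p * X p (\<lambda>q. Y q f) + Y p f * X p g)"
    if X: "smooth_vfield A W X" and Y: "smooth_vfield A W Y" and f: "smooth_at A p f" and g: "smooth_at A p g"
    for X Y f g
  proof -
    obtain M where M: "open M" "p \<in> M" "M \<subseteq> W" "\<forall>q\<in>M. smooth_at A q f \<and> smooth_at A q g"
      using loc[OF f g] by blast
    note Xp = smooth_vfieldD(2)[OF X p]
    have s: "smooth_at A p (\<lambda>q. Y q f)" "smooth_at A p (\<lambda>q. Y q g)"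
      using smooth_vfield_smooth_at[OF Y p] f g by auto
    have "X p (\<lambda>q. Y q (\<lambda>x. f x * g x)) = X p (\<lambda>q. f q * Y q g + g q * Y q f)"
      by (rule tangent_local[OF A Xp M(1,2)])
        (use M smooth_vfieldD(2)[OF Y] in \<open>auto intro!: tangent_spaceD(3)\<close>)
    also have "\<dots> = X p (\<lambda>q. f q * Y q g) + X p (\<lambda>q. g q * Y q f)"
      by (intro tangent_spaceD(2)[OF Xp] smooth_at_mult[OF A] f g s)
    also have "X p (\<lambda>q. f q * Y q g) = f p * X p (\<lambda>q. Y q g) + Y p g * X p f"
      by (intro tangent_spaceD(3)[OF Xp] f s)
    also have "X p (\<lambda>q. g q * Y q f) = g p * X p (\<lambda>q. Y q f) + Y p f * X p g"
      by (intro tangent_spaceD(3)[OF Xp] g s)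
    finally show ?thesis .
  qed
  show ?thesis
    unfolding tangent_space_def lie_bracket_def
  proof (intro CollectI conjI allI impI)
    fix f g assume f: "smooth_at A p f" and g: "smooth_at A p g"
    note [simp] = f g smooth_at_add[OF A f g] smooth_at_mult[OF A f g]
    show "(if smooth_at A p (\<lambda>x. f x + g x) then U p (\<lambda>q. V q (\<lambda>x. f x + g x)) - V p (\<lambda>q. U q (\<lambda>x. f x + g x)) else 0) =
          (if smooth_at A p f then U p (\<lambda>q. V q f) - V p (\<lambda>q. U q f) else 0) +
          (if smooth_at A p g then U p (\<lambda>q. V q g) - V p (\<lambda>q. U q g) else 0)"
      using add[OF U V f g] add[OF V U f g] by simp
    show "(if smooth_at A p (\<lambda>x. f x * g x) then U p (\<lambda>q. V q (\<lambda>x. f x * g x)) - V p (\<lambda>q. U q (\<lambda>x. f x * g x)) else 0) =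
          f p * (if smooth_at A p g then U p (\<lambda>q. V q g) - V p (\<lambda>q. U q g) else 0) +
          g p * (if smooth_at A p f then U p (\<lambda>q. V q f) - V p (\<lambda>q. U q f) else 0)"
      using mult[OF U V f g] mult[OF V U f g] by (simp add: algebra_simps)
  next
    fix c f assume f: "smooth_at A p f"
    note [simp] = f smooth_at_mult[OF A smooth_at_const[of A p c] f]
    show "(if smooth_at A p (\<lambda>x. c * f x) then U p (\<lambda>q. V q (\<lambda>x. c * f x)) - V p (\<lambda>q. U q (\<lambda>x. c * f x)) else 0) =
          c * (if smooth_at A p f then U p (\<lambda>q. V q f) - V p (\<lambda>q. U q f) else 0)"
      using cmul[OF U V f] cmul[OF V U f] by (simp add: algebra_simps)
  qed simp
qed

section \<open>Coordinate fields and frames\<close>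

text \<open>The case distinction is part of being a tangent vector: these have the value 0 on functions that
  are not smooth at the point.\<close>

definition coord_field ::
    "('m::{t2_space,second_countable_topology}, 'e::euclidean_space) atlas \<Rightarrow> ('m, 'e) chart \<Rightarrow> 'e \<Rightarrow> 'm vfield" where
  "coord_field A c b = (\<lambda>p f. if smooth_at A p f
     then frechet_derivative (f \<circ> inv_into (fst c) (snd c)) (at (snd c p)) b else 0)"

lemma smooth_at_chart_differentiable:
  assumes "smooth_manifold A" "(U, \<phi>) \<in> A" "p \<in> U" "smooth_at A p f"
  shows "(f \<circ> inv_into U \<phi>) differentiable (at (\<phi> p))"
proof -
  obtain N where N: "open N" "p \<in> N" "smooth_on A N f"
    using assms(4) by (auto simp: smooth_at_def)
  show ?thesis
    by (rule Cinf_on_differentiable[OF smooth_onD[OF N(3) assms(2)]]) (use N assms(3) in blast)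
qed

lemma coord_field_eq:
  assumes "smooth_at A p f" "((f \<circ> inv_into U \<phi>) has_derivative D) (at (\<phi> p))"
  shows "coord_field A (U, \<phi>) b p f = D b"
  using assms by (simp add: coord_field_def frechet_derivative_at[symmetric])

lemma coord_field_tangent:
  assumes A: "smooth_manifold A" and c: "(U, \<phi>) \<in> A" and p: "p \<in> U"
  shows "coord_field A (U, \<phi>) b p \<in> tangent_space A p"
  unfolding tangent_space_def
proof (intro CollectI conjI allI impI)
  let ?i = "inv_into U \<phi>"
  have HD: "((f \<circ> ?i) has_derivative frechet_derivative (f \<circ> ?i) (at (\<phi> p))) (at (\<phi> p))"
    if "smooth_at A p f" for f
    using smooth_at_chart_differentiable[OF A c p that] by (simp add: frechet_derivative_works)
  have val: "coord_field A (U, \<phi>) b p f = frechet_derivative (f \<circ> ?i) (at (\<phi> p)) b"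
    if "smooth_at A p f" for f
    using that by (simp add: coord_field_def)
  fix f g assume f: "smooth_at A p f" and g: "smooth_at A p g"
  have "((\<lambda>x. (f \<circ> ?i) x + (g \<circ> ?i) x) has_derivative
      (\<lambda>v. frechet_derivative (f \<circ> ?i) (at (\<phi> p)) v + frechet_derivative (g \<circ> ?i) (at (\<phi> p)) v)) (at (\<phi> p))"
    by (rule has_derivative_add[OF HD[OF f] HD[OF g]])
  then show "coord_field A (U, \<phi>) b p (\<lambda>x. f x + g x) = coord_field A (U, \<phi>) b p f + coord_field A (U, \<phi>) b p g"
    using coord_field_eq[OF smooth_at_add[OF A f g]] by (simp add: o_def val f g)
  have "((\<lambda>x. (f \<circ> ?i) x * (g \<circ> ?i) x) has_derivative
      (\<lambda>v. (f \<circ> ?i) (\<phi> p) * frechet_derivative (g \<circ> ?i) (at (\<phi> p)) v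
         + frechet_derivative (f \<circ> ?i) (at (\<phi> p)) v * (g \<circ> ?i) (\<phi> p))) (at (\<phi> p))"
    by (rule has_derivative_mult[OF HD[OF f] HD[OF g]])
  then show "coord_field A (U, \<phi>) b p (\<lambda>x. f x * g x) =
      f p * coord_field A (U, \<phi>) b p g + g p * coord_field A (U, \<phi>) b p f"
    using coord_field_eq[OF smooth_at_mult[OF A f g]]
    by (simp add: o_def val f g chart_inverse[OF A c p] mult.commute)
next
  let ?i = "inv_into U \<phi>"
  fix f k assume f: "smooth_at A p f"
  have "((\<lambda>x. k * (f \<circ> ?i) x) has_derivative
      (\<lambda>v. k * frechet_derivative (f \<circ> ?i) (at (\<phi> p)) v)) (at (\<phi> p))"
    using smooth_at_chart_differentiable[OF A c p f]
    by (intro has_derivative_mult_right) (simp only: frechet_derivative_works)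
  then show "coord_field A (U, \<phi>) b p (\<lambda>x. k * f x) = k * coord_field A (U, \<phi>) b p f"
    using coord_field_eq[OF smooth_at_mult[OF A smooth_at_const[of A p k] f]]
    by (simp add: o_def coord_field_def f)
qed (simp add: coord_field_def)

lemma coord_field_smooth:
  assumes A: "smooth_manifold A" and c: "(U, \<phi>) \<in> A"
  shows "smooth_vfield A U (coord_field A (U, \<phi>) b)"
  unfolding smooth_vfield_def
proof (intro conjI ballI allI impI)
  show "open U" by (rule chart_domain_open[OF A c])
  show "coord_field A (U, \<phi>) b p \<in> tangent_space A p" if "p \<in> U" for p
    by (rule coord_field_tangent[OF A c that])
  fix W f assume W: "open W" "W \<subseteq> U" and f: "smooth_on A W f"
  have UW: "U \<inter> W = W" using W by blast
  have o: "open (\<phi> ` W)" using chart_open_image[OF A c W(1)] by (simp add: UW)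
  have "Cinf_on (\<phi> ` W) (f \<circ> inv_into U \<phi>)" using smooth_onD[OF f c] by (simp add: UW)
  then have D: "Ck_on k (\<phi> ` W) (\<lambda>x. frechet_derivative (f \<circ> inv_into U \<phi>) (at x) b)" for k
    using Cinf_on_frechet unfolding Cinf_on_def by blast
  have "Ck_on k (\<phi> ` W) ((\<lambda>q. coord_field A (U, \<phi>) b q f) \<circ> inv_into U \<phi>)" for k
  proof (rule Ck_on_cong[OF o _ D])
    fix x assume "x \<in> \<phi> ` W"
    then obtain q where q: "q \<in> W" "x = \<phi> q" by blast
    have "q \<in> U" using q W by blast
    then show "frechet_derivative (f \<circ> inv_into U \<phi>) (at x) b =
        ((\<lambda>q. coord_field A (U, \<phi>) b q f) \<circ> inv_into U \<phi>) x"
      using smooth_atI[OF f W(1) q(1)] chart_inverse[OF A c, of q]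
      by (simp add: q coord_field_def)
  qed
  then show "smooth_on A W (\<lambda>q. coord_field A (U, \<phi>) b q f)"
    by (intro smooth_on_chart[OF A c W]) (simp add: Cinf_on_def)
qed

lemma coord_field_coordinate:
  assumes A: "smooth_manifold A" and c: "(U, \<phi>) \<in> A" and p: "p \<in> U"
  shows "coord_field A (U, \<phi>) b p (\<lambda>q. \<phi> q \<bullet> b') = b \<bullet> b'"
proof (rule coord_field_eq)
  show "smooth_at A p (\<lambda>q. \<phi> q \<bullet> b')"
    by (rule smooth_atI[OF smooth_on_coordinate[OF A c] chart_domain_open[OF A c] p])
  have o: "open (\<phi> ` U)" using chart_open_image[OF A c open_UNIV] by simp
  have "((\<lambda>x. x \<bullet> b') has_derivative (\<lambda>v. v \<bullet> b')) (at (\<phi> p))"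
    by (rule has_derivative_inner_left[OF has_derivative_ident])
  then show "((\<lambda>q. \<phi> q \<bullet> b') \<circ> inv_into U \<phi> has_derivative (\<lambda>v. v \<bullet> b')) (at (\<phi> p))"
    by (rule has_derivative_transform_within_open[OF _ o]) (use p chart_inverse[OF A c] in auto)
qed

text \<open>Spanning is expressed by the expansion of every tangent vector, with coefficients given by the dual
  forms.\<close>

definition dual_basis_at ::
    "('m::topological_space, 'e::euclidean_space) atlas \<Rightarrow> nat set \<Rightarrow> 'm \<Rightarrow>
     (nat \<Rightarrow> 'm tvec list \<Rightarrow> real) \<Rightarrow> (nat \<Rightarrow> 'm tvec) \<Rightarrow> bool" where
  "dual_basis_at A I p \<theta> E \<longleftrightarrow>
     (\<forall>t\<in>I. alternating_at A 1 p (\<theta> t) \<and> E t \<in> tangent_space A p) \<and>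
     (\<forall>s\<in>I. \<forall>t\<in>I. \<theta> s [E t] = (if s = t then 1 else 0)) \<and>
     (\<forall>v\<in>tangent_space A p. v = tlincomb I (\<lambda>t. \<theta> t [v]) E)"

lemma dual_basis_atD:
  assumes "dual_basis_at A I p \<theta> E"
  shows "t \<in> I \<Longrightarrow> alternating_at A 1 p (\<theta> t)" "t \<in> I \<Longrightarrow> E t \<in> tangent_space A p"
    "s \<in> I \<Longrightarrow> t \<in> I \<Longrightarrow> \<theta> s [E t] = (if s = t then 1 else 0)"
    "v \<in> tangent_space A p \<Longrightarrow> v = tlincomb I (\<lambda>t. \<theta> t [v]) E"
  using assms unfolding dual_basis_at_def by blast+

definition coframe_matrix ::
    "('m::{t2_space,second_countable_topology}, real ^ 'n) atlas \<Rightarrow> ('m, real ^ 'n) chart \<Rightarrow>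
     (nat \<Rightarrow> 'm tvec list \<Rightarrow> real) \<Rightarrow> ('n \<Rightarrow> nat) \<Rightarrow> 'm \<Rightarrow> real ^ 'n ^ 'n" where
  "coframe_matrix A c \<theta> \<sigma> p = (\<chi> a t. \<theta> (\<sigma> t) [coord_field A c (axis a 1) p])"

definition frame_matrix ::
    "('m, real ^ 'n) chart \<Rightarrow> (nat \<Rightarrow> 'm tvec) \<Rightarrow> ('n \<Rightarrow> nat) \<Rightarrow> real ^ 'n ^ 'n" where
  "frame_matrix c E \<sigma> = (\<chi> t a. E (\<sigma> t) (\<lambda>q. snd c q \<bullet> axis a 1))"

text \<open>The coordinate fields are linearly independent, as they are dual to the coordinate functions, and
  their number is the number of elements of the frame. So the matrix that expresses them in the frame
  is invertible, and its inverse consists of the derivatives of the coordinate functions along the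
  frame.\<close>

lemma frame_matrix_inverse:
  fixes A :: "('m::{t2_space,second_countable_topology}, real ^ 'n) atlas"
  assumes A: "smooth_manifold A" and c: "(U, \<phi>) \<in> A" and p: "p \<in> U"
    and B: "dual_basis_at A I p \<theta> E" and \<sigma>: "bij_betw \<sigma> (UNIV :: 'n set) I"
  shows "frame_matrix (U, \<phi>) E \<sigma> ** coframe_matrix A (U, \<phi>) \<theta> \<sigma> p = mat 1"
proof -
  let ?N = "frame_matrix (U, \<phi>) E \<sigma>" and ?M = "coframe_matrix A (U, \<phi>) \<theta> \<sigma> p"
  have "(?M ** ?N) $ a $ b = mat 1 $ a $ b" for a b
  proof -
    let ?x = "\<lambda>q. \<phi> q \<bullet> axis b 1"
    let ?d = "coord_field A (U, \<phi>) (axis a 1) p"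
    have "axis a 1 \<bullet> axis b (1::real) = ?d ?x"
      by (rule coord_field_coordinate[OF A c p, symmetric])
    also have "\<dots> = tlincomb I (\<lambda>t. \<theta> t [?d]) E ?x"
      using dual_basis_atD(4)[OF B coord_field_tangent[OF A c p, of "axis a 1"]] by simp
    also have "\<dots> = (\<Sum>t\<in>UNIV. \<theta> (\<sigma> t) [?d] * E (\<sigma> t) ?x)"
      unfolding tlincomb_def by (rule sum.reindex_bij_betw[OF \<sigma>, symmetric])
    also have "\<dots> = (?M ** ?N) $ a $ b"
      by (simp add: matrix_matrix_mult_def coframe_matrix_def frame_matrix_def)
    finally show ?thesis by (auto simp: inner_axis_axis mat_def)
  qed
  then have "?M ** ?N = mat 1" by (simp add: vec_eq_iff)
  then show ?thesis by (simp add: matrix_left_right_inverse)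
qed

lemma frame_coord_expand:
  fixes A :: "('m::{t2_space,second_countable_topology}, real ^ 'n) atlas"
  assumes A: "smooth_manifold A" and c: "(U, \<phi>) \<in> A" and p: "p \<in> U"
    and B: "dual_basis_at A I p \<theta> E" and \<sigma>: "bij_betw \<sigma> (UNIV :: 'n set) I"
  shows "E (\<sigma> t) f = (\<Sum>a\<in>UNIV. E (\<sigma> t) (\<lambda>q. \<phi> q \<bullet> axis a 1) * coord_field A (U, \<phi>) (axis a 1) p f)"
proof -
  let ?N = "frame_matrix (U, \<phi>) E \<sigma>" and ?M = "coframe_matrix A (U, \<phi>) \<theta> \<sigma> p"
  have d: "coord_field A (U, \<phi>) (axis a 1) p f = (\<Sum>s\<in>UNIV. ?M $ a $ s * E (\<sigma> s) f)" for a
  proof -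
    let ?d = "coord_field A (U, \<phi>) (axis a 1) p"
    have "?d f = tlincomb I (\<lambda>t. \<theta> t [?d]) E f"
      using dual_basis_atD(4)[OF B coord_field_tangent[OF A c p, of "axis a 1"]] by simp
    also have "\<dots> = (\<Sum>s\<in>UNIV. \<theta> (\<sigma> s) [?d] * E (\<sigma> s) f)"
      unfolding tlincomb_def by (rule sum.reindex_bij_betw[OF \<sigma>, symmetric])
    finally show ?thesis by (simp add: coframe_matrix_def)
  qed
  have "(\<Sum>a\<in>UNIV. E (\<sigma> t) (\<lambda>q. \<phi> q \<bullet> axis a 1) * coord_field A (U, \<phi>) (axis a 1) p f) =
      (\<Sum>a\<in>UNIV. \<Sum>s\<in>UNIV. ?N $ t $ a * ?M $ a $ s * E (\<sigma> s) f)"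
    by (simp add: d frame_matrix_def sum_distrib_left mult.assoc)
  also have "\<dots> = (\<Sum>s\<in>UNIV. (?N ** ?M) $ t $ s * E (\<sigma> s) f)"
    by (subst sum.swap) (simp add: matrix_matrix_mult_def sum_distrib_right)
  also have "\<dots> = E (\<sigma> t) f"
    unfolding frame_matrix_inverse[OF A c p B \<sigma>]
    by (simp add: mat_def if_distrib[of "\<lambda>x. x * _"] cong: if_cong)
  finally show ?thesis by simp
qed

text \<open>The classical \<open>v = \<Sum> v(x\<^sub>a) \<partial>\<^sub>a\<close>: it holds for the frame by inversion of the matrix above and
  extends to its linear combinations.\<close>

lemma tangent_coord_expand:
  fixes A :: "('m::{t2_space,second_countable_topology}, real ^ 'n) atlas"
  assumes A: "smooth_manifold A" and c: "(U, \<phi>) \<in> A" and p: "p \<in> U"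
    and B: "dual_basis_at A I p \<theta> E" and \<sigma>: "bij_betw \<sigma> (UNIV :: 'n set) I"
    and v: "v \<in> tangent_space A p"
  shows "v = tlincomb UNIV (\<lambda>a. v (\<lambda>q. \<phi> q \<bullet> axis a 1)) (\<lambda>a. coord_field A (U, \<phi>) (axis a 1) p)"
proof
  fix f
  have ex: "v g = (\<Sum>t\<in>UNIV. \<theta> (\<sigma> t) [v] * E (\<sigma> t) g)" for g
  proof -
    have "v g = tlincomb I (\<lambda>t. \<theta> t [v]) E g" using dual_basis_atD(4)[OF B v] by simp
    also have "\<dots> = (\<Sum>s\<in>UNIV. \<theta> (\<sigma> s) [v] * E (\<sigma> s) g)"
      unfolding tlincomb_def by (rule sum.reindex_bij_betw[OF \<sigma>, symmetric])
    finally show ?thesis .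
  qed
  have "v f = (\<Sum>t\<in>UNIV. \<Sum>a\<in>UNIV. \<theta> (\<sigma> t) [v] * E (\<sigma> t) (\<lambda>q. \<phi> q \<bullet> axis a 1) * coord_field A (U, \<phi>) (axis a 1) p f)"
    unfolding ex[of f]
    by (subst frame_coord_expand[OF A c p B \<sigma>]) (simp add: sum_distrib_left mult.assoc)
  also have "\<dots> = (\<Sum>a\<in>UNIV. v (\<lambda>q. \<phi> q \<bullet> axis a 1) * coord_field A (U, \<phi>) (axis a 1) p f)"
    by (subst sum.swap) (simp add: ex[symmetric] sum_distrib_right[symmetric])
  finally show "v f = tlincomb UNIV (\<lambda>a. v (\<lambda>q. \<phi> q \<bullet> axis a 1)) (\<lambda>a. coord_field A (U, \<phi>) (axis a 1) p) f"
    by (simp add: tlincomb_def)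
qed

lemma smooth_on_det:
  fixes M :: "'m::{t2_space,second_countable_topology} \<Rightarrow> real ^ 'n ^ 'n"
  assumes "smooth_manifold A" "open W" "\<And>a b. smooth_on A W (\<lambda>q. M q $ a $ b)"
  shows "smooth_on A W (\<lambda>q. det (M q))"
  unfolding det_def
  by (rule smooth_on_sum[OF assms(1,2)], rule smooth_on_mult[OF assms(1,2) smooth_on_const],
      rule smooth_on_prod[OF assms(1,2)], rule assms(3))

lemma smooth_vfieldI_local:
  assumes A: "smooth_manifold A" and W: "open W" and V: "\<And>p. p \<in> W \<Longrightarrow> V p \<in> tangent_space A p"
    and loc: "\<And>p f. p \<in> W \<Longrightarrow> smooth_at A p f \<Longrightarrow> smooth_at A p (\<lambda>q. V q f)"
  shows "smooth_vfield A W V"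
  unfolding smooth_vfield_def
proof (intro conjI ballI allI impI)
  fix W' f assume W': "open W'" "W' \<subseteq> W" and f: "smooth_on A W' f"
  show "smooth_on A W' (\<lambda>q. V q f)"
  proof (rule smooth_on_if_smooth_at[OF A])
    fix p assume "p \<in> W'"
    then show "smooth_at A p (\<lambda>q. V q f)"
      using W'(2) loc smooth_atI[OF f W'(1)] by blast
  qed
qed (use W V in auto)

text \<open>The coefficients of the frame with respect to the coordinate fields form the inverse of the matrix
  of the coframe on the coordinate fields, whose entries are smooth. Cramer's rule writes the inverse
  as a quotient of smooth determinants. This applies to the frame of a leaf, which is given pointwise
  while its coframe is a pull-back and hence smooth.\<close>

lemma dual_frame_smooth:
  fixes A :: "('m::{t2_space,second_countable_topology}, real ^ 'n) atlas"
  assumes A: "smooth_manifold A" and B: "\<And>p. dual_basis_at A I p (\<lambda>t. \<theta> t p) (\<lambda>t. E t p)"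
    and \<theta>: "\<And>t. t \<in> I \<Longrightarrow> smooth_form A 1 (\<theta> t)" and \<sigma>: "bij_betw \<sigma> (UNIV :: 'n set) I"
    and h: "h \<in> I"
  shows "smooth_vfield A UNIV (E h)"
proof (rule smooth_vfieldI_local[OF A open_UNIV dual_basis_atD(2)[OF B h]])
  fix p f assume f: "smooth_at A p f"
  obtain t where t: "h = \<sigma> t" using \<sigma> h by (auto simp: bij_betw_def)
  obtain U \<phi> where c: "(U, \<phi>) \<in> A" and p: "p \<in> U" using chart_exists[OF A] .
  have oU: "open U" by (rule chart_domain_open[OF A c])
  \<comment> \<open>A row \<open>N q\<close> of the inverse matrix; the transpose in \<open>M q\<close> makes it the solution of a linear system.\<close>
  define M where "M q = transpose (coframe_matrix A (U, \<phi>) (\<lambda>t. \<theta> t q) \<sigma> q)" for q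
  define N where "N q = frame_matrix (U, \<phi>) (\<lambda>t. E t q) \<sigma> $ t" for q
  have M: "smooth_on A U (\<lambda>q. M q $ a $ b)" for a b
  proof -
    have "smooth_on A U (\<lambda>q. \<theta> (\<sigma> a) q (map (\<lambda>V. V q) [coord_field A (U, \<phi>) (axis b 1)]))"
      using \<sigma> by (intro smooth_form_on[OF \<theta> _ oU]) (auto simp: bij_betw_def coord_field_smooth[OF A c])
    then show ?thesis by (simp add: M_def transpose_def coframe_matrix_def)
  qed
  have MN: "det (M q) \<noteq> 0" "M q *v N q = axis t 1" if "q \<in> U" for q
  proof -
    note inv = frame_matrix_inverse[OF A c that B \<sigma>]
    have "invertible (coframe_matrix A (U, \<phi>) (\<lambda>t. \<theta> t q) \<sigma> q)"
      using inv matrix_left_right_inverse unfolding invertible_def by blast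
    then show "det (M q) \<noteq> 0" by (simp add: M_def invertible_det_nz)
    have "(M q *v N q) $ b = (frame_matrix (U, \<phi>) (\<lambda>t. E t q) \<sigma> ** coframe_matrix A (U, \<phi>) (\<lambda>t. \<theta> t q) \<sigma> q) $ t $ b" for b
      by (simp add: M_def N_def matrix_vector_mult_def matrix_matrix_mult_def transpose_def mult.commute)
    then show "M q *v N q = axis t 1" by (simp add: inv vec_eq_iff mat_def axis_def eq_commute)
  qed
  have N: "smooth_on A U (\<lambda>q. N q $ a)" for a
  proof -
    let ?K = "\<lambda>q. (\<chi> i j. if j = a then axis t 1 $ i else M q $ i $ j) :: real ^ 'n ^ 'n"
    have "smooth_on A U (\<lambda>q. ?K q $ i $ j)" for i j
      by (cases "j = a") (simp_all add: smooth_on_const M)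
    then have "smooth_on A U (\<lambda>q. det (?K q) * inverse (det (M q)))"
      by (intro smooth_on_mult[OF A oU] smooth_on_inverse[OF A oU] smooth_on_det[OF A oU] MN M)
    then show ?thesis
    proof (rule smooth_on_cong[OF A oU])
      fix q assume q: "q \<in> U"
      show "det (?K q) * inverse (det (M q)) = N q $ a"
        using cramer[OF MN(1)[OF q], of "N q" "axis t 1"] MN(2)[OF q]
        by (simp add: vec_eq_iff divide_inverse)
    qed
  qed
  have "smooth_at A p (\<lambda>q. \<Sum>a\<in>UNIV. N q $ a * coord_field A (U, \<phi>) (axis a 1) q f)"
    by (intro smooth_at_sum[OF A] smooth_at_mult[OF A] smooth_atI[OF N oU p]
        smooth_vfield_smooth_at[OF coord_field_smooth[OF A c] p f])
  then show "smooth_at A p (\<lambda>q. E h q f)"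
  proof (rule smooth_at_cong[OF A oU p, rotated])
    fix q assume q: "q \<in> U"
    show "(\<Sum>a\<in>UNIV. N q $ a * coord_field A (U, \<phi>) (axis a 1) q f) = E h q f"
      unfolding t using frame_coord_expand[OF A c q B \<sigma>, of t f]
      by (simp add: N_def frame_matrix_def)
  qed
qed

section \<open>Push-forward and pull-back\<close>

lemma smooth_at_comp:
  assumes "smooth_manifold A" "smooth_manifold B" "smooth_map_on A B UNIV F" "smooth_at B (F p) f"
  shows "smooth_at A p (\<lambda>q. f (F q))"
proof -
  obtain N where N: "open N" "F p \<in> N" "smooth_on B N f"
    using assms(4) by (auto simp: smooth_at_def)
  have "open (F -` N)"
    using assms(3) N(1) by (simp add: smooth_map_on_def continuous_on_open_vimage)
  then show ?thesis
    using smooth_on_comp[OF assms(1-3) N(1,3)] N(2) by (auto intro: smooth_atI)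
qed

lemma push_apply: "smooth_at B (F p) f \<Longrightarrow> push B F p v f = v (\<lambda>q. f (F q))"
  by (simp add: push_def o_def)

lemma push_tangent:
  assumes A: "smooth_manifold A" and B: "smooth_manifold B" and F: "smooth_map_on A B UNIV F"
    and v: "v \<in> tangent_space A p"
  shows "push B F p v \<in> tangent_space B (F p)"
  unfolding tangent_space_def
proof (intro CollectI conjI allI impI)
  fix f g assume f: "smooth_at B (F p) f" and g: "smooth_at B (F p) g"
  note f' = smooth_at_comp[OF A B F f] and g' = smooth_at_comp[OF A B F g]
  show "push B F p v (\<lambda>x. f x + g x) = push B F p v f + push B F p v g"
    by (simp add: push_apply f g smooth_at_add[OF B f g] tangent_spaceD(2)[OF v f' g'])
  show "push B F p v (\<lambda>x. f x * g x) = f (F p) * push B F p v g + g (F p) * push B F p v f"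
    by (simp add: push_apply f g smooth_at_mult[OF B f g] tangent_spaceD(3)[OF v f' g'])
next
  fix k f assume f: "smooth_at B (F p) f"
  show "push B F p v (\<lambda>x. k * f x) = k * push B F p v f"
    by (simp add: push_apply f smooth_at_mult[OF B smooth_at_const[of B "F p" k] f]
        tangent_spaceD(4)[OF v smooth_at_comp[OF A B F f]])
qed (simp add: push_def)

lemma push_lincomb2: "push B F p (\<lambda>f. a * u f + b * w f) = (\<lambda>f. a * push B F p u f + b * push B F p w f)"
  by (auto simp: push_def)

lemma push_tlincomb: "push B F p (tlincomb I c v) = tlincomb I c (\<lambda>i. push B F p (v i))"
  by (auto simp: push_def tlincomb_def)

lemma pullback_alternating:
  assumes A: "smooth_manifold A" and B: "smooth_manifold B" and F: "smooth_map_on A B UNIV F"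
    and \<eta>: "alternating_at B k (F p) (\<eta> (F p))"
  shows "alternating_at A k p (pullback A B F \<eta> p)"
  unfolding alternating_at_def
proof (intro conjI allI impI)
  note push = push_tangent[OF A B F]
  show "pullback A B F \<eta> p vs = 0" if "\<not> (length vs = k \<and> set vs \<subseteq> tangent_space A p)" for vs
    using that alternating_at_tangent[OF \<eta>, of "map (push B F p) vs"] by (auto simp: pullback_def)
  show "pullback A B F \<eta> p (vs[i := \<lambda>f. a * u f + b * w f]) =
      a * pullback A B F \<eta> p (vs[i := u]) + b * pullback A B F \<eta> p (vs[i := w])"
    if h: "length vs = k" "set vs \<subseteq> tangent_space A p" "i < k" "u \<in> tangent_space A p" "w \<in> tangent_space A p"
    for vs i a b u w
  proof -
    have sub: "set (vs[i := z]) \<subseteq> tangent_space A p" if "z \<in> tangent_space A p" for z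
      using h(2) that set_update_subset_insert[of vs i z] by blast
    have "set (map (push B F p) vs) \<subseteq> tangent_space B (F p)" using h(2) push by auto
    then show ?thesis
      using \<eta> h push sub tangent_lincomb2[OF h(4,5), of a b]
      unfolding alternating_at_def pullback_def
      by (simp add: map_update push_lincomb2)
  qed
  show "pullback A B F \<eta> p vs = 0"
    if "length vs = k" "i < j" "j < k" "vs ! i = vs ! j" for vs i j
    using that \<eta> unfolding alternating_at_def pullback_def by auto
qed

text \<open>Near a point, \<open>F*\<eta>(V) = \<Sum> V(y\<^sub>a \<circ> F) (\<eta>(\<partial>\<^sub>a) \<circ> F)\<close> in coordinates \<open>y\<^sub>a\<close> of the target, by
  expansion of the push-forward of \<open>V\<close>.\<close>

lemma pullback_smooth_form_1:
  fixes B :: "('n::{t2_space,second_countable_topology}, real ^ 'k) atlas"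
  assumes A: "smooth_manifold A" and B: "smooth_manifold B" and F: "smooth_map_on A B UNIV F"
    and D: "\<And>p. dual_basis_at B I p (\<lambda>t. \<theta> t p) (\<lambda>t. E t p)" and \<sigma>: "bij_betw \<sigma> (UNIV :: 'k set) I"
    and \<eta>: "smooth_form B 1 \<eta>"
  shows "smooth_form A 1 (pullback A B F \<eta>)"
  unfolding smooth_form_def
proof (intro conjI allI impI)
  show "alternating_at A 1 p (pullback A B F \<eta> p)" for p
    using pullback_alternating[OF A B F] smooth_form_alternating[OF \<eta>] by blast
  fix W and Vs :: "'a vfield list"
  assume l: "length Vs = 1" and W: "open W" and "\<forall>V\<in>set Vs. smooth_vfield A W V"
  then obtain V where Vs: "Vs = [V]" and V: "smooth_vfield A W V"
    by (cases Vs) auto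
  show "smooth_on A W (\<lambda>p. pullback A B F \<eta> p (map (\<lambda>V. V p) Vs))"
  proof (rule smooth_on_if_smooth_at[OF A])
    fix p assume p: "p \<in> W"
    obtain U \<psi> where c: "(U, \<psi>) \<in> B" and pU: "F p \<in> U" using chart_exists[OF B] .
    have oU: "open U" by (rule chart_domain_open[OF B c])
    have oF: "open (F -` U)"
      using F oU by (simp add: smooth_map_on_def continuous_on_open_vimage)
    let ?d = "\<lambda>a. coord_field B (U, \<psi>) (axis a 1)"
    have co: "smooth_at B (F q) (\<lambda>x. \<psi> x \<bullet> axis a 1)" if "F q \<in> U" for q a
      by (rule smooth_atI[OF smooth_on_coordinate[OF B c] oU that])
    have "smooth_at A p (\<lambda>q. \<Sum>a\<in>UNIV. V q (\<lambda>x. \<psi> (F x) \<bullet> axis a 1) * \<eta> (F q) [?d a (F q)])"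
      by (intro smooth_at_sum[OF A] smooth_at_mult[OF A] smooth_vfield_smooth_at[OF V p]
          smooth_at_comp[OF A B F] co smooth_form_smooth_at1[OF \<eta> coord_field_smooth[OF B c]] pU)
    then show "smooth_at A p (\<lambda>q. pullback A B F \<eta> q (map (\<lambda>V. V q) Vs))"
    proof (rule smooth_at_cong[OF A open_Int[OF W oF], rotated 2])
      show "p \<in> W \<inter> F -` U" using p pU by simp
      fix q assume "q \<in> W \<inter> F -` U"
      then have q: "q \<in> W" "F q \<in> U" by auto
      note Vq = smooth_vfieldD(2)[OF V q(1)]
      note PV = push_tangent[OF A B F Vq]
      have e: "push B F q (V q) = tlincomb UNIV (\<lambda>a. V q (\<lambda>x. \<psi> (F x) \<bullet> axis a 1)) (\<lambda>a. ?d a (F q))"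
        using tangent_coord_expand[OF B c q(2) D \<sigma> PV] by (simp add: push_apply co q)
      have "\<eta> (F q) [push B F q (V q)] =
          (\<Sum>a\<in>UNIV. V q (\<lambda>x. \<psi> (F x) \<bullet> axis a 1) * \<eta> (F q) [?d a (F q)])"
        unfolding e
        using alternating_at_tlincomb[OF smooth_form_alternating[OF \<eta>], of "[]" "[]" "F q" UNIV
            "\<lambda>a. ?d a (F q)" "\<lambda>a. V q (\<lambda>x. \<psi> (F x) \<bullet> axis a 1)"]
          coord_field_tangent[OF B c q(2)] by simp
      then show "(\<Sum>a\<in>UNIV. V q (\<lambda>x. \<psi> (F x) \<bullet> axis a 1) * \<eta> (F q) [?d a (F q)]) =
          pullback A B F \<eta> q (map (\<lambda>V. V q) Vs)"
        by (simp add: Vs pullback_def Vq)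
    qed
  qed
qed

section \<open>The exterior derivative in a frame\<close>

lemma koszul_1:
  "koszul A 1 \<eta> [U, V] p =
     U p (\<lambda>q. \<eta> q [V q]) - V p (\<lambda>q. \<eta> q [U q]) - \<eta> p [lie_bracket A U V p]"
  by (simp add: koszul_def omit_def numeral_eq_Suc atMost_Suc lessThan_Suc)

lemma koszul_2:
  "koszul A 2 \<eta> [U, V, Z] p =
     U p (\<lambda>q. \<eta> q [V q, Z q]) - V p (\<lambda>q. \<eta> q [U q, Z q]) + Z p (\<lambda>q. \<eta> q [U q, V q])
     - \<eta> p [lie_bracket A U V p, Z p] + \<eta> p [lie_bracket A U Z p, V p] - \<eta> p [lie_bracket A V Z p, U p]"
  by (simp add: koszul_def omit_def numeral_eq_Suc atMost_Suc lessThan_Suc)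

lemma alternating_at_1_tlincomb:
  assumes "alternating_at A 1 p \<eta>" "\<And>i. i \<in> I \<Longrightarrow> v i \<in> tangent_space A p"
  shows "\<eta> [tlincomb I c v] = (\<Sum>i\<in>I. c i * \<eta> [v i])"
  using alternating_at_tlincomb[of A 1 p \<eta> "[]" "[]" I v c] assms by simp

lemma alternating_at_2_tlincomb:
  assumes "alternating_at A 2 p \<eta>" "\<And>i. i \<in> I \<Longrightarrow> v i \<in> tangent_space A p" "w \<in> tangent_space A p"
  shows "\<eta> [tlincomb I c v, w] = (\<Sum>i\<in>I. c i * \<eta> [v i, w])"
    and "\<eta> [w, tlincomb I c v] = (\<Sum>i\<in>I. c i * \<eta> [w, v i])"
  using alternating_at_tlincomb[of A 2 p \<eta> "[]" "[w]" I v c]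
    alternating_at_tlincomb[of A 2 p \<eta> "[w]" "[]" I v c] assms by simp_all

lemma alternating_at_2_swap:
  assumes "alternating_at A 2 p \<eta>" "u \<in> tangent_space A p" "w \<in> tangent_space A p"
  shows "\<eta> [w, u] = - \<eta> [u, w]"
  using alternating_at_swap[of A 2 p \<eta> "[]" "[]" u w] assms by simp

lemma alternating_at_1_linear:
  assumes "alternating_at A 1 p \<eta>" "u \<in> tangent_space A p" "w \<in> tangent_space A p"
  shows "\<eta> [\<lambda>f. a * u f + b * w f] = a * \<eta> [u] + b * \<eta> [w]"
  using alternating_at_linear[of A 1 p \<eta> "[]" "[]"] assms by simp

lemma alternating_at_2_linear:
  assumes "alternating_at A 2 p \<eta>" "u \<in> tangent_space A p" "w \<in> tangent_space A p" "z \<in> tangent_space A p"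
  shows "\<eta> [\<lambda>f. a * u f + b * w f, z] = a * \<eta> [u, z] + b * \<eta> [w, z]"
  using alternating_at_linear[of A 2 p \<eta> "[]" "[z]"] assms by simp

lemma alternating_at_1_uminus:
  assumes "alternating_at A 1 p \<eta>" "u \<in> tangent_space A p"
  shows "\<eta> [\<lambda>f. - u f] = - \<eta> [u]"
  using alternating_at_1_linear[OF assms(1) assms(2) assms(2), of "-1" 0] by simp

lemma alternating_at_2_uminus:
  assumes "alternating_at A 2 p \<eta>" "u \<in> tangent_space A p" "z \<in> tangent_space A p"
  shows "\<eta> [\<lambda>f. - u f, z] = - \<eta> [u, z]"
  using alternating_at_2_linear[OF assms(1) assms(2) assms(2,3), of "-1" 0] by simp

lemma lie_bracket_swap: "lie_bracket A V U p = (\<lambda>f. - lie_bracket A U V p f)"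
  by (auto simp: lie_bracket_def)

lemma tangent_uminus:
  assumes "v \<in> tangent_space A p" "smooth_at A p f"
  shows "v (\<lambda>q. - f q) = - v f"
  using tangent_spaceD(4)[OF assms, of "-1"] by simp

lemma koszul_1_swap:
  assumes A: "smooth_manifold A" and \<eta>: "smooth_form A 1 \<eta>"
    and U: "smooth_vfield A W U" and V: "smooth_vfield A W V" and p: "p \<in> W"
  shows "koszul A 1 \<eta> [V, U] p = - koszul A 1 \<eta> [U, V] p"
  unfolding koszul_1 lie_bracket_swap[of A V U]
  by (simp add: alternating_at_1_uminus[OF smooth_form_alternating[OF \<eta>] lie_bracket_tangent[OF A U V p]])

lemma koszul_2_swap_01:
  assumes A: "smooth_manifold A" and \<eta>: "smooth_form A 2 \<eta>"
    and U: "smooth_vfield A W U" and V: "smooth_vfield A W V" and Z: "smooth_vfield A W Z" and p: "p \<in> W"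
  shows "koszul A 2 \<eta> [V, U, Z] p = - koszul A 2 \<eta> [U, V, Z] p"
proof -
  note W = smooth_vfieldD(1)[OF U] and alt = smooth_form_alternating[OF \<eta>]
  have "Z p (\<lambda>q. \<eta> q [V q, U q]) = Z p (\<lambda>q. - \<eta> q [U q, V q])"
    by (rule tangent_local[OF A smooth_vfieldD(2)[OF Z p] W p])
      (rule alternating_at_2_swap[OF alt smooth_vfieldD(2)[OF U] smooth_vfieldD(2)[OF V]])
  then show ?thesis
    unfolding koszul_2 lie_bracket_swap[of A V U]
    by (simp add: alternating_at_2_uminus[OF alt lie_bracket_tangent[OF A U V p] smooth_vfieldD(2)[OF Z p]]
        tangent_uminus[OF smooth_vfieldD(2)[OF Z p] smooth_form_smooth_at2[OF \<eta> U V p]])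
qed

lemma koszul_2_swap_12:
  assumes A: "smooth_manifold A" and \<eta>: "smooth_form A 2 \<eta>"
    and U: "smooth_vfield A W U" and V: "smooth_vfield A W V" and Z: "smooth_vfield A W Z" and p: "p \<in> W"
  shows "koszul A 2 \<eta> [U, Z, V] p = - koszul A 2 \<eta> [U, V, Z] p"
proof -
  note W = smooth_vfieldD(1)[OF U] and alt = smooth_form_alternating[OF \<eta>]
  have "U p (\<lambda>q. \<eta> q [Z q, V q]) = U p (\<lambda>q. - \<eta> q [V q, Z q])"
    by (rule tangent_local[OF A smooth_vfieldD(2)[OF U p] W p])
      (rule alternating_at_2_swap[OF alt smooth_vfieldD(2)[OF V] smooth_vfieldD(2)[OF Z]])
  then show ?thesis
    unfolding koszul_2 lie_bracket_swap[of A Z V]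
    by (simp add: alternating_at_2_uminus[OF alt lie_bracket_tangent[OF A V Z p] smooth_vfieldD(2)[OF U p]]
        tangent_uminus[OF smooth_vfieldD(2)[OF U p] smooth_form_smooth_at2[OF \<eta> V Z p]])
qed

lemma tangent_lincomb_product:
  assumes A: "smooth_manifold A" and v: "v \<in> tangent_space A p"
    and a: "\<And>h. h \<in> I \<Longrightarrow> smooth_at A p (a h)" and g: "\<And>h. h \<in> I \<Longrightarrow> smooth_at A p (g h)"
  shows "v (\<lambda>q. \<Sum>h\<in>I. a h q * g h q) = (\<Sum>h\<in>I. a h p * v (g h)) + (\<Sum>h\<in>I. v (a h) * g h p)"
proof -
  have "v (\<lambda>q. \<Sum>h\<in>I. a h q * g h q) = (\<Sum>h\<in>I. v (\<lambda>q. a h q * g h q))"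
    by (intro tangent_sum[OF A v] smooth_at_mult[OF A] a g)
  also have "\<dots> = (\<Sum>h\<in>I. a h p * v (g h) + v (a h) * g h p)"
    using tangent_spaceD(3)[OF v a g] by (intro sum.cong) (auto simp: mult.commute)
  finally show ?thesis by (simp add: sum.distrib)
qed

text \<open>\<open>[\<Sum> a\<^sub>h E\<^sub>h, V] = \<Sum> a\<^sub>h [E\<^sub>h, V] - \<Sum> V(a\<^sub>h) E\<^sub>h\<close>. The result is written as a combination with
  coefficients 1 and -1 so that linearity of forms applies to it directly.\<close>

lemma lie_bracket_tlincomb:
  assumes A: "smooth_manifold A" and V: "smooth_vfield A W V" and p: "p \<in> W"
    and E: "\<And>h. h \<in> I \<Longrightarrow> smooth_vfield A W (E h)" and a: "\<And>h. h \<in> I \<Longrightarrow> smooth_on A W (a h)"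
    and U: "\<And>q. q \<in> W \<Longrightarrow> U q = tlincomb I (\<lambda>h. a h q) (\<lambda>h. E h q)"
  shows "lie_bracket A U V p = (\<lambda>f. 1 * tlincomb I (\<lambda>h. a h p) (\<lambda>h. lie_bracket A (E h) V p) f
      + (-1) * tlincomb I (\<lambda>h. V p (a h)) (\<lambda>h. E h p) f)"
proof
  fix f
  note W = smooth_vfieldD(1)[OF V] and Vp = smooth_vfieldD(2)[OF V p]
  show "lie_bracket A U V p f = 1 * tlincomb I (\<lambda>h. a h p) (\<lambda>h. lie_bracket A (E h) V p) f
      + (-1) * tlincomb I (\<lambda>h. V p (a h)) (\<lambda>h. E h p) f"
  proof (cases "smooth_at A p f")
    case True
    have "V p (\<lambda>q. U q f) = V p (\<lambda>q. \<Sum>h\<in>I. a h q * E h q f)"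
      by (rule tangent_local[OF A Vp W p]) (simp add: U tlincomb_def)
    also have "\<dots> = (\<Sum>h\<in>I. a h p * V p (\<lambda>q. E h q f)) + (\<Sum>h\<in>I. V p (a h) * E h p f)"
      by (intro tangent_lincomb_product[OF A Vp] smooth_atI[OF a W p] smooth_vfield_smooth_at[OF E p True])
    finally show ?thesis
      using True by (simp add: lie_bracket_def U[OF p] tlincomb_def right_diff_distrib sum_subtractf)
  next
    case False
    then show ?thesis
      using tangent_spaceD(1)[OF smooth_vfieldD(2)[OF E p]] by (simp add: lie_bracket_def tlincomb_def)
  qed
qed

text \<open>The invariant formula is linear over functions: the derivatives of the coefficients that come
  from \<open>V(\<eta>(U))\<close> cancel those that come from the bracket.\<close>

lemma koszul_1_tlincomb:
  assumes A: "smooth_manifold A" and \<eta>: "smooth_form A 1 \<eta>" and V: "smooth_vfield A W V" and p: "p \<in> W"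
    and E: "\<And>h. h \<in> I \<Longrightarrow> smooth_vfield A W (E h)" and a: "\<And>h. h \<in> I \<Longrightarrow> smooth_on A W (a h)"
    and U: "\<And>q. q \<in> W \<Longrightarrow> U q = tlincomb I (\<lambda>h. a h q) (\<lambda>h. E h q)"
  shows "koszul A 1 \<eta> [U, V] p = (\<Sum>h\<in>I. a h p * koszul A 1 \<eta> [E h, V] p)"
proof -
  note W = smooth_vfieldD(1)[OF V] and alt = smooth_form_alternating[OF \<eta>]
    and Vp = smooth_vfieldD(2)[OF V p] and Ep = smooth_vfieldD(2)[OF E]
  have 1: "U p (\<lambda>q. \<eta> q [V q]) = (\<Sum>h\<in>I. a h p * E h p (\<lambda>q. \<eta> q [V q]))"
    by (simp add: U[OF p] tlincomb_def)
  have "V p (\<lambda>q. \<eta> q [U q]) = V p (\<lambda>q. \<Sum>h\<in>I. a h q * \<eta> q [E h q])"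
    by (rule tangent_local[OF A Vp W p]) (simp add: U alternating_at_1_tlincomb[OF alt Ep])
  also have "\<dots> = (\<Sum>h\<in>I. a h p * V p (\<lambda>q. \<eta> q [E h q])) + (\<Sum>h\<in>I. V p (a h) * \<eta> p [E h p])"
    by (intro tangent_lincomb_product[OF A Vp] smooth_atI[OF a W p] smooth_form_smooth_at1[OF \<eta> E p])
  finally have 2: "V p (\<lambda>q. \<eta> q [U q]) =
    (\<Sum>h\<in>I. a h p * V p (\<lambda>q. \<eta> q [E h q])) + (\<Sum>h\<in>I. V p (a h) * \<eta> p [E h p])" .
  have 3: "\<eta> p [lie_bracket A U V p] =
      (\<Sum>h\<in>I. a h p * \<eta> p [lie_bracket A (E h) V p]) - (\<Sum>h\<in>I. V p (a h) * \<eta> p [E h p])"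
  proof (subst lie_bracket_tlincomb[where a = a and E = E, OF A V p E a U])
    show "\<eta> p [\<lambda>f. 1 * tlincomb I (\<lambda>h. a h p) (\<lambda>h. lie_bracket A (E h) V p) f
        + (-1) * tlincomb I (\<lambda>h. V p (a h)) (\<lambda>h. E h p) f] =
      (\<Sum>h\<in>I. a h p * \<eta> p [lie_bracket A (E h) V p]) - (\<Sum>h\<in>I. V p (a h) * \<eta> p [E h p])"
      by (subst alternating_at_1_linear[OF alt])
        (use Ep[OF _ p] lie_bracket_tangent[OF A E V p] in
          \<open>auto intro!: tlincomb_tangent simp: alternating_at_1_tlincomb[OF alt]\<close>)
  qed
  show ?thesis
    unfolding koszul_1 1 2 3 by (simp add: right_diff_distrib sum_subtractf)
qed

text \<open>The same cancellation in degree 2, once for \<open>V\<close> and once for \<open>Z\<close>.\<close>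

lemma koszul_2_tlincomb:
  assumes A: "smooth_manifold A" and \<eta>: "smooth_form A 2 \<eta>"
    and V: "smooth_vfield A W V" and Z: "smooth_vfield A W Z" and p: "p \<in> W"
    and E: "\<And>h. h \<in> I \<Longrightarrow> smooth_vfield A W (E h)" and a: "\<And>h. h \<in> I \<Longrightarrow> smooth_on A W (a h)"
    and U: "\<And>q. q \<in> W \<Longrightarrow> U q = tlincomb I (\<lambda>h. a h q) (\<lambda>h. E h q)"
  shows "koszul A 2 \<eta> [U, V, Z] p = (\<Sum>h\<in>I. a h p * koszul A 2 \<eta> [E h, V, Z] p)"
proof -
  note W = smooth_vfieldD(1)[OF V] and alt = smooth_form_alternating[OF \<eta>]
    and Vp = smooth_vfieldD(2)[OF V] and Zp = smooth_vfieldD(2)[OF Z] and Ep = smooth_vfieldD(2)[OF E]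
  have 1: "U p (\<lambda>q. \<eta> q [V q, Z q]) = (\<Sum>h\<in>I. a h p * E h p (\<lambda>q. \<eta> q [V q, Z q]))"
    by (simp add: U[OF p] tlincomb_def)
  have 2: "X p (\<lambda>q. \<eta> q [U q, Y q]) =
      (\<Sum>h\<in>I. a h p * X p (\<lambda>q. \<eta> q [E h q, Y q])) + (\<Sum>h\<in>I. X p (a h) * \<eta> p [E h p, Y p])"
    if X: "smooth_vfield A W X" and Y: "smooth_vfield A W Y" for X Y
  proof -
    note Xp = smooth_vfieldD(2)[OF X p]
    have "X p (\<lambda>q. \<eta> q [U q, Y q]) = X p (\<lambda>q. \<Sum>h\<in>I. a h q * \<eta> q [E h q, Y q])"
      by (rule tangent_local[OF A Xp W p])
        (simp add: U alternating_at_2_tlincomb(1)[OF alt Ep smooth_vfieldD(2)[OF Y]])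
    also have "\<dots> = (\<Sum>h\<in>I. a h p * X p (\<lambda>q. \<eta> q [E h q, Y q])) + (\<Sum>h\<in>I. X p (a h) * \<eta> p [E h p, Y p])"
      by (intro tangent_lincomb_product[OF A Xp] smooth_atI[OF a W p] smooth_form_smooth_at2[OF \<eta> E Y p])
    finally show ?thesis .
  qed
  have 3: "\<eta> p [lie_bracket A U X p, Y p] =
      (\<Sum>h\<in>I. a h p * \<eta> p [lie_bracket A (E h) X p, Y p]) - (\<Sum>h\<in>I. X p (a h) * \<eta> p [E h p, Y p])"
    if X: "smooth_vfield A W X" and Y: "smooth_vfield A W Y" for X Y
  proof (subst lie_bracket_tlincomb[where a = a and E = E, OF A X p E a U])
    show "\<eta> p [\<lambda>f. 1 * tlincomb I (\<lambda>h. a h p) (\<lambda>h. lie_bracket A (E h) X p) f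
        + (-1) * tlincomb I (\<lambda>h. X p (a h)) (\<lambda>h. E h p) f, Y p] =
      (\<Sum>h\<in>I. a h p * \<eta> p [lie_bracket A (E h) X p, Y p]) - (\<Sum>h\<in>I. X p (a h) * \<eta> p [E h p, Y p])"
      by (subst alternating_at_2_linear[OF alt])
        (use Ep[OF _ p] lie_bracket_tangent[OF A E X p] smooth_vfieldD(2)[OF Y p] in
          \<open>auto intro!: tlincomb_tangent simp: alternating_at_2_tlincomb(1)[OF alt]\<close>)
  qed
  have 4: "\<eta> p [lie_bracket A V Z p, U p] = (\<Sum>h\<in>I. a h p * \<eta> p [lie_bracket A V Z p, E h p])"
    by (simp add: U[OF p] alternating_at_2_tlincomb(2)[OF alt Ep[OF _ p] lie_bracket_tangent[OF A V Z p]])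
  show ?thesis
    unfolding koszul_2 1 2[OF V Z] 2[OF Z V] 3[OF V Z] 3[OF Z V] 4
    by (simp add: distrib_left right_diff_distrib sum_subtractf sum.distrib)
qed

text \<open>This setting is used twice, for the ambient manifold and for the leaf. In a frame, a vector field
  is determined by its smooth coefficients and the exterior derivative of a form by the invariant
  formula on the frame fields.\<close>

locale framed_manifold =
  fixes A :: "('m::{t2_space,second_countable_topology}, 'e::euclidean_space) atlas"
    and I :: "nat set" and \<theta> :: "nat \<Rightarrow> ('m, real) form" and E :: "nat \<Rightarrow> 'm vfield"
  assumes manifold: "smooth_manifold A"
    and finite_index: "finite I"
    and coframe_smooth: "\<And>t. t \<in> I \<Longrightarrow> smooth_form A 1 (\<theta> t)"
    and frame_smooth: "\<And>t. t \<in> I \<Longrightarrow> smooth_vfield A UNIV (E t)"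
    and dual_basis: "\<And>p. dual_basis_at A I p (\<lambda>t. \<theta> t p) (\<lambda>t. E t p)"
begin

lemma frame_tangent: "t \<in> I \<Longrightarrow> E t p \<in> tangent_space A p"
  by (rule dual_basis_atD(2)[OF dual_basis])

lemma coframe_frame: "s \<in> I \<Longrightarrow> t \<in> I \<Longrightarrow> \<theta> s p [E t p] = (if s = t then 1 else 0)"
  by (rule dual_basis_atD(3)[OF dual_basis])

lemma frame_expand: "v \<in> tangent_space A p \<Longrightarrow> v = tlincomb I (\<lambda>t. \<theta> t p [v]) (\<lambda>t. E t p)"
  by (rule dual_basis_atD(4)[OF dual_basis])

lemma frame_smooth_on: "t \<in> I \<Longrightarrow> open W \<Longrightarrow> smooth_vfield A W (E t)"
  using smooth_vfield_subset[OF frame_smooth] by blast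

lemma coefficient_smooth: "t \<in> I \<Longrightarrow> smooth_vfield A W V \<Longrightarrow> smooth_on A W (\<lambda>q. \<theta> t q [V q])"
  using smooth_form_on[OF coframe_smooth, of t "[V]" W] smooth_vfieldD(1)[of A W V] by simp

lemma koszul_1_expand_first:
  assumes \<eta>: "smooth_form A 1 \<eta>" and U: "smooth_vfield A W U" and V: "smooth_vfield A W V" and p: "p \<in> W"
  shows "koszul A 1 \<eta> [U, V] p = (\<Sum>r\<in>I. \<theta> r p [U p] * koszul A 1 \<eta> [E r, V] p)"
  by (rule koszul_1_tlincomb[where a = "\<lambda>t q. \<theta> t q [U q]" and E = E, OF manifold \<eta> V p frame_smooth_on[OF _ smooth_vfieldD(1)[OF V]]
        coefficient_smooth[OF _ U] frame_expand[OF smooth_vfieldD(2)[OF U]]])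

lemma koszul_2_expand_first:
  assumes \<eta>: "smooth_form A 2 \<eta>" and U: "smooth_vfield A W U" and V: "smooth_vfield A W V"
    and Z: "smooth_vfield A W Z" and p: "p \<in> W"
  shows "koszul A 2 \<eta> [U, V, Z] p = (\<Sum>r\<in>I. \<theta> r p [U p] * koszul A 2 \<eta> [E r, V, Z] p)"
  by (rule koszul_2_tlincomb[where a = "\<lambda>t q. \<theta> t q [U q]" and E = E, OF manifold \<eta> V Z p frame_smooth_on[OF _ smooth_vfieldD(1)[OF V]]
        coefficient_smooth[OF _ U] frame_expand[OF smooth_vfieldD(2)[OF U]]])

lemma koszul_1_expand:
  assumes \<eta>: "smooth_form A 1 \<eta>" and U: "smooth_vfield A W U" and V: "smooth_vfield A W V" and p: "p \<in> W"
  shows "koszul A 1 \<eta> [U, V] p =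
    (\<Sum>r\<in>I. \<Sum>s\<in>I. \<theta> r p [U p] * \<theta> s p [V p] * koszul A 1 \<eta> [E r, E s] p)"
proof -
  note fr = frame_smooth_on[OF _ smooth_vfieldD(1)[OF V]]
  note swap = koszul_1_swap[OF manifold \<eta> _ _ p]
  have "koszul A 1 \<eta> [E r, V] p = (\<Sum>s\<in>I. \<theta> s p [V p] * koszul A 1 \<eta> [E r, E s] p)" if r: "r \<in> I" for r
  proof -
    have "koszul A 1 \<eta> [E r, V] p = - (\<Sum>s\<in>I. \<theta> s p [V p] * koszul A 1 \<eta> [E s, E r] p)"
      using swap[OF V fr[OF r]] koszul_1_expand_first[OF \<eta> V fr[OF r] p] by simp
    also have "\<dots> = (\<Sum>s\<in>I. \<theta> s p [V p] * koszul A 1 \<eta> [E r, E s] p)"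
      using swap[OF fr[OF r] fr] by (simp add: sum_negf)
    finally show ?thesis .
  qed
  then show ?thesis
    unfolding koszul_1_expand_first[OF \<eta> U V p] by (simp add: sum_distrib_left mult.assoc)
qed

text \<open>Linearity over functions is available in the first argument; antisymmetry carries it to the other
  two.\<close>

lemma koszul_2_expand:
  assumes \<eta>: "smooth_form A 2 \<eta>" and U: "smooth_vfield A W U" and V: "smooth_vfield A W V"
    and Z: "smooth_vfield A W Z" and p: "p \<in> W"
  shows "koszul A 2 \<eta> [U, V, Z] p =
    (\<Sum>r\<in>I. \<Sum>s\<in>I. \<Sum>t\<in>I. \<theta> r p [U p] * \<theta> s p [V p] * \<theta> t p [Z p] * koszul A 2 \<eta> [E r, E s, E t] p)"
proof -
  note fr = frame_smooth_on[OF _ smooth_vfieldD(1)[OF V]]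
  note s01 = koszul_2_swap_01[OF manifold \<eta> _ _ _ p] and s12 = koszul_2_swap_12[OF manifold \<eta> _ _ _ p]
  have second: "koszul A 2 \<eta> [X, V', Y] p = (\<Sum>s\<in>I. \<theta> s p [V' p] * koszul A 2 \<eta> [X, E s, Y] p)"
    if X: "smooth_vfield A W X" and V': "smooth_vfield A W V'" and Y: "smooth_vfield A W Y" for X V' Y
  proof -
    have "koszul A 2 \<eta> [X, V', Y] p = - (\<Sum>s\<in>I. \<theta> s p [V' p] * koszul A 2 \<eta> [E s, X, Y] p)"
      using s01[OF V' X Y] koszul_2_expand_first[OF \<eta> V' X Y p] by simp
    also have "\<dots> = (\<Sum>s\<in>I. \<theta> s p [V' p] * koszul A 2 \<eta> [X, E s, Y] p)"
      using s01[OF X fr Y] by (simp add: sum_negf)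
    finally show ?thesis .
  qed
  have third: "koszul A 2 \<eta> [X, Y, Z] p = (\<Sum>s\<in>I. \<theta> s p [Z p] * koszul A 2 \<eta> [X, Y, E s] p)"
    if X: "smooth_vfield A W X" and Y: "smooth_vfield A W Y" for X Y
  proof -
    have "koszul A 2 \<eta> [X, Y, Z] p = - (\<Sum>s\<in>I. \<theta> s p [Z p] * koszul A 2 \<eta> [X, E s, Y] p)"
      using s12[OF X Z Y] second[OF X Z Y] by simp
    also have "\<dots> = (\<Sum>s\<in>I. \<theta> s p [Z p] * koszul A 2 \<eta> [X, Y, E s] p)"
      using s12[OF X Y fr] by (simp add: sum_negf)
    finally show ?thesis .
  qed
  have "koszul A 2 \<eta> [U, V, Z] p = (\<Sum>r\<in>I. \<theta> r p [U p] * (\<Sum>s\<in>I. \<theta> s p [V p] *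
      (\<Sum>t\<in>I. \<theta> t p [Z p] * koszul A 2 \<eta> [E r, E s, E t] p)))"
    unfolding koszul_2_expand_first[OF \<eta> U V Z p]
    using second[OF fr V Z] third[OF fr fr] by simp
  then show ?thesis by (simp add: sum_distrib_left mult.assoc)
qed

text \<open>Extending by constant coefficients in the frame shows that the definition of the exterior derivative
  always has an extension to work with.\<close>

lemma tangent_extend:
  assumes "v \<in> tangent_space A p"
  obtains V where "smooth_vfield A UNIV V" "V p = v"
proof
  show "smooth_vfield A UNIV (\<lambda>q. tlincomb I (\<lambda>t. \<theta> t p [v]) (\<lambda>t. E t q))"
    by (rule smooth_vfield_tlincomb[OF manifold open_UNIV frame_smooth smooth_on_const])
  show "tlincomb I (\<lambda>t. \<theta> t p [v]) (\<lambda>t. E t p) = v"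
    using frame_expand[OF assms] by simp
qed

text \<open>The expansion depends on the extending fields only through their values at \<open>p\<close>. Hence the number
  that the definition selects exists and is unique.\<close>

lemma ext_deriv_1:
  assumes \<eta>: "smooth_form A 1 \<eta>" and u: "u \<in> tangent_space A p" and v: "v \<in> tangent_space A p"
  shows "ext_deriv A 1 \<eta> p [u, v] =
    (\<Sum>r\<in>I. \<Sum>s\<in>I. \<theta> r p [u] * \<theta> s p [v] * koszul A 1 \<eta> [E r, E s] p)"
proof -
  obtain U where U: "smooth_vfield A UNIV U" "U p = u" by (rule tangent_extend[OF u])
  obtain V where V: "smooth_vfield A UNIV V" "V p = v" by (rule tangent_extend[OF v])
  have "(THE r. \<exists>W Vs. p \<in> W \<and> length Vs = Suc 1 \<and> (\<forall>V\<in>set Vs. smooth_vfield A W V) \<and>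
        map (\<lambda>V. V p) Vs = [u, v] \<and> r = koszul A 1 \<eta> Vs p) =
      (\<Sum>r\<in>I. \<Sum>s\<in>I. \<theta> r p [u] * \<theta> s p [v] * koszul A 1 \<eta> [E r, E s] p)"
  proof (rule the_equality)
    show "\<exists>W Vs. p \<in> W \<and> length Vs = Suc 1 \<and> (\<forall>V\<in>set Vs. smooth_vfield A W V) \<and>
        map (\<lambda>V. V p) Vs = [u, v] \<and>
        (\<Sum>r\<in>I. \<Sum>s\<in>I. \<theta> r p [u] * \<theta> s p [v] * koszul A 1 \<eta> [E r, E s] p) = koszul A 1 \<eta> Vs p"
      using koszul_1_expand[OF \<eta> U(1) V(1), of p] U V
      by (intro exI[of _ UNIV] exI[of _ "[U, V]"] conjI) simp_all
  next
    fix r assume "\<exists>W Vs. p \<in> W \<and> length Vs = Suc 1 \<and> (\<forall>V\<in>set Vs. smooth_vfield A W V) \<and>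
        map (\<lambda>V. V p) Vs = [u, v] \<and> r = koszul A 1 \<eta> Vs p"
    then obtain W Vs where Vs: "p \<in> W" "\<forall>V\<in>set Vs. smooth_vfield A W V"
        "map (\<lambda>V. V p) Vs = [u, v]" "r = koszul A 1 \<eta> Vs p" by (elim exE conjE) (rule that)
    from Vs(3) obtain X Y where XY: "Vs = [X, Y]" "X p = u" "Y p = v"
      by (auto simp: map_eq_Cons_conv)
    then show "r = (\<Sum>r\<in>I. \<Sum>s\<in>I. \<theta> r p [u] * \<theta> s p [v] * koszul A 1 \<eta> [E r, E s] p)"
      using koszul_1_expand[OF \<eta>, of W X Y p] Vs(1,2,4) by simp
  qed
  moreover have "length [u, v] = Suc 1 \<and> set [u, v] \<subseteq> tangent_space A p" using u v by simp
  ultimately show ?thesis by (simp only: ext_deriv_def simp_thms if_True)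
qed

lemma ext_deriv_2:
  assumes \<eta>: "smooth_form A 2 \<eta>"
    and u: "u \<in> tangent_space A p" and v: "v \<in> tangent_space A p" and w: "w \<in> tangent_space A p"
  shows "ext_deriv A 2 \<eta> p [u, v, w] =
    (\<Sum>r\<in>I. \<Sum>s\<in>I. \<Sum>t\<in>I. \<theta> r p [u] * \<theta> s p [v] * \<theta> t p [w] * koszul A 2 \<eta> [E r, E s, E t] p)"
    (is "_ = ?R")
proof -
  obtain U where U: "smooth_vfield A UNIV U" "U p = u" by (rule tangent_extend[OF u])
  obtain V where V: "smooth_vfield A UNIV V" "V p = v" by (rule tangent_extend[OF v])
  obtain Z where Z: "smooth_vfield A UNIV Z" "Z p = w" by (rule tangent_extend[OF w])
  have "(THE r. \<exists>W Vs. p \<in> W \<and> length Vs = Suc 2 \<and> (\<forall>V\<in>set Vs. smooth_vfield A W V) \<and>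
        map (\<lambda>V. V p) Vs = [u, v, w] \<and> r = koszul A 2 \<eta> Vs p) = ?R"
  proof (rule the_equality)
    show "\<exists>W Vs. p \<in> W \<and> length Vs = Suc 2 \<and> (\<forall>V\<in>set Vs. smooth_vfield A W V) \<and>
        map (\<lambda>V. V p) Vs = [u, v, w] \<and> ?R = koszul A 2 \<eta> Vs p"
      using koszul_2_expand[OF \<eta> U(1) V(1) Z(1), of p] U V Z
      by (intro exI[of _ UNIV] exI[of _ "[U, V, Z]"] conjI) simp_all
  next
    fix r assume "\<exists>W Vs. p \<in> W \<and> length Vs = Suc 2 \<and> (\<forall>V\<in>set Vs. smooth_vfield A W V) \<and>
        map (\<lambda>V. V p) Vs = [u, v, w] \<and> r = koszul A 2 \<eta> Vs p"
    then obtain W Vs where Vs: "p \<in> W" "\<forall>V\<in>set Vs. smooth_vfield A W V"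
        "map (\<lambda>V. V p) Vs = [u, v, w]" "r = koszul A 2 \<eta> Vs p" by (elim exE conjE) (rule that)
    from Vs(3) obtain X Y Z' where XY: "Vs = [X, Y, Z']" "X p = u" "Y p = v" "Z' p = w"
      by (auto simp: map_eq_Cons_conv)
    then show "r = ?R"
      using koszul_2_expand[OF \<eta>, of W X Y Z' p] Vs(1,2,4) by simp
  qed
  moreover have "length [u, v, w] = Suc 2 \<and> set [u, v, w] \<subseteq> tangent_space A p" using u v w by simp
  ultimately show ?thesis by (simp only: ext_deriv_def simp_thms if_True)
qed

lemma ext_deriv_1_frame:
  assumes "smooth_form A 1 \<eta>" "r \<in> I" "s \<in> I"
  shows "ext_deriv A 1 \<eta> p [E r p, E s p] = koszul A 1 \<eta> [E r, E s] p"
  using ext_deriv_1[OF assms(1) frame_tangent[OF assms(2)] frame_tangent[OF assms(3)]]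
    koszul_1_expand[OF assms(1) frame_smooth[OF assms(2)] frame_smooth[OF assms(3)], of p] by simp

lemma ext_deriv_2_frame:
  assumes "smooth_form A 2 \<eta>" "r \<in> I" "s \<in> I" "t \<in> I"
  shows "ext_deriv A 2 \<eta> p [E r p, E s p, E t p] = koszul A 2 \<eta> [E r, E s, E t] p"
  using ext_deriv_2[OF assms(1) frame_tangent[OF assms(2)] frame_tangent[OF assms(3)] frame_tangent[OF assms(4)]]
    koszul_2_expand[OF assms(1) frame_smooth[OF assms(2)] frame_smooth[OF assms(3)] frame_smooth[OF assms(4)], of p]
  by simp

end

section \<open>Wedge products of low degree\<close>

lemma wedge_3_sum:
  fixes g :: "(nat \<Rightarrow> nat) \<Rightarrow> 'c::field_char_0"
  shows "(\<Sum>\<sigma> | \<sigma> permutes {..<3}. of_int (sign \<sigma>) * g \<sigma>) =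
    g id - g (Transposition.transpose 1 2) - g (Transposition.transpose 0 1) - g (Transposition.transpose 0 2)
    + g (Transposition.transpose 0 1 \<circ> Transposition.transpose 1 2)
    + g (Transposition.transpose 0 2 \<circ> Transposition.transpose 1 2)"
proof -
  have eq: "{..<3} = insert 0 (insert 1 (insert (2::nat) {}))" by auto
  have sg: "sign (Transposition.transpose a b \<circ> Transposition.transpose c d) =
      sign (Transposition.transpose a b) * sign (Transposition.transpose c (d::nat))" for a b c d :: nat
    by (intro sign_compose permutation_swap_id)
  show ?thesis
    unfolding eq
    by (simp add: sum_over_permutations_insert sg sign_swap_id sign_id o_def[symmetric] del: o_def)
qed

text \<open>Of the six permutations, those that differ by a swap inside the arguments of \<open>\<alpha>\<close> are paired. For
  alternating \<open>\<alpha>\<close> each difference is twice a value and cancels the denominator. Written with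
  differences the formula covers lists with vectors outside the tangent space as well.\<close>

lemma wedge_2_1:
  fixes \<alpha> \<beta> :: "('m, 'c::field_char_0) form"
  shows "wedge 2 1 \<alpha> \<beta> p [u, v, w] =
    ((\<alpha> p [u, v] - \<alpha> p [v, u]) * \<beta> p [w] - (\<alpha> p [u, w] - \<alpha> p [w, u]) * \<beta> p [v]
      + (\<alpha> p [v, w] - \<alpha> p [w, v]) * \<beta> p [u]) / 2"
proof -
  have l: "[0..<2] = [0, 1]" "[2..<2 + 1] = [2::nat]" "{..<2 + 1} = {..<3::nat}"
    by (simp_all add: upt_rec)
  show ?thesis
    unfolding wedge_def l mult.assoc wedge_3_sum
    by (simp add: Transposition.transpose_def numeral_2_eq_2 algebra_simps)
qed

lemma wedge_1_2:
  fixes \<alpha> \<beta> :: "('m, 'c::field_char_0) form"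
  shows "wedge 1 2 \<alpha> \<beta> p [u, v, w] =
    (\<alpha> p [u] * (\<beta> p [v, w] - \<beta> p [w, v]) - \<alpha> p [v] * (\<beta> p [u, w] - \<beta> p [w, u])
      + \<alpha> p [w] * (\<beta> p [u, v] - \<beta> p [v, u])) / 2"
proof -
  have l: "[0..<1] = [0]" "[1..<1 + 2] = [1, 2::nat]" "{..<1 + 2} = {..<3::nat}"
    by (simp_all add: upt_rec)
  show ?thesis
    unfolding wedge_def l mult.assoc wedge_3_sum
    by (simp add: Transposition.transpose_def numeral_2_eq_2 algebra_simps)
qed

lemma wedge_length: "length vs \<noteq> k + l \<Longrightarrow> wedge k l \<alpha> \<beta> p vs = 0"
  by (simp add: wedge_def)

lemma theta2_pair: "theta2 \<theta> r s p [u, v] = \<theta> r p [u] * \<theta> s p [v] - \<theta> r p [v] * \<theta> s p [u]"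
  unfolding theta2_def wedge_1_1 by simp

lemma theta3_triple:
  "theta3 \<theta> i j k p [u, v, w] =
     \<theta> i p [u] * (\<theta> j p [v] * \<theta> k p [w] - \<theta> j p [w] * \<theta> k p [v])
     - \<theta> i p [v] * (\<theta> j p [u] * \<theta> k p [w] - \<theta> j p [w] * \<theta> k p [u])
     + \<theta> i p [w] * (\<theta> j p [u] * \<theta> k p [v] - \<theta> j p [v] * \<theta> k p [u])"
  unfolding theta3_def wedge_2_1 theta2_pair by (simp add: field_simps)

lemma alternating_at_1I:
  assumes "\<And>vs. \<not> (length vs = 1 \<and> set vs \<subseteq> tangent_space A p) \<Longrightarrow> \<eta> vs = 0"
    and "\<And>a b u w. u \<in> tangent_space A p \<Longrightarrow> w \<in> tangent_space A p \<Longrightarrow>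
      \<eta> [\<lambda>f. a * u f + b * w f] = a * \<eta> [u] + b * \<eta> [w]"
  shows "alternating_at A 1 p \<eta>"
  unfolding alternating_at_def
proof (intro conjI allI impI)
  fix vs :: "(('a \<Rightarrow> real) \<Rightarrow> real) list" and i :: nat and a b u w
  assume h: "length vs = 1" "i < 1" "u \<in> tangent_space A p" "w \<in> tangent_space A p"
  then obtain z where "vs = [z]" by (cases vs) auto
  with h assms(2) show "\<eta> (vs[i := \<lambda>f. a * u f + b * w f]) = a * \<eta> (vs[i := u]) + b * \<eta> (vs[i := w])"
    by simp
qed (use assms(1) in auto)

lemma alternating_at_2I:
  assumes "\<And>vs. \<not> (length vs = 2 \<and> set vs \<subseteq> tangent_space A p) \<Longrightarrow> \<eta> vs = 0"
    and "\<And>a b u w z. u \<in> tangent_space A p \<Longrightarrow> w \<in> tangent_space A p \<Longrightarrow> z \<in> tangent_space A p \<Longrightarrow>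
      \<eta> [\<lambda>f. a * u f + b * w f, z] = a * \<eta> [u, z] + b * \<eta> [w, z]"
    and "\<And>u v. u \<in> tangent_space A p \<Longrightarrow> v \<in> tangent_space A p \<Longrightarrow> \<eta> [v, u] = - \<eta> [u, v]"
  shows "alternating_at A 2 p \<eta>"
  unfolding alternating_at_def
proof (intro conjI allI impI)
  fix vs :: "(('a \<Rightarrow> real) \<Rightarrow> real) list" and i :: nat and a b u w
  assume h: "length vs = 2" "set vs \<subseteq> tangent_space A p" "i < 2"
    and t: "u \<in> tangent_space A p" "w \<in> tangent_space A p"
  obtain y z where vs: "vs = [y, z]"
    using h(1) by (auto simp: numeral_2_eq_2 length_Suc_conv)
  have yz: "y \<in> tangent_space A p" "z \<in> tangent_space A p" using h vs by auto
  note s = tangent_lincomb2[OF t, of a b]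
  have "i = 0 \<or> i = 1" using h(3) by auto
  then show "\<eta> (vs[i := \<lambda>f. a * u f + b * w f]) = a * \<eta> (vs[i := u]) + b * \<eta> (vs[i := w])"
  proof
    assume "i = 1"
    then show ?thesis
      using assms(2)[OF t yz(1), of a b] assms(3)[OF s yz(1)] assms(3)[OF t(1) yz(1)] assms(3)[OF t(2) yz(1)]
      by (simp add: vs)
  qed (use assms(2)[OF t yz(2)] vs in simp)
next
  fix vs :: "(('a \<Rightarrow> real) \<Rightarrow> real) list" and i j :: nat
  assume h: "length vs = 2" "i < j" "j < 2" "vs ! i = vs ! j"
  obtain y z where vs: "vs = [y, z]"
    using h(1) by (auto simp: numeral_2_eq_2 length_Suc_conv)
  have ij: "i = 0" "j = 1" using h by auto
  have "y = z" using h(4) by (simp add: ij vs)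
  then show "\<eta> vs = 0" using assms(1)[of vs] assms(3)[of y y] vs by (cases "y \<in> tangent_space A p") auto
qed (use assms(1) in auto)

lemma theta2_smooth_form:
  assumes A: "smooth_manifold A" and r: "smooth_form A 1 (\<theta> r)" and s: "smooth_form A 1 (\<theta> s)"
  shows "smooth_form A 2 (theta2 \<theta> r s)"
  unfolding smooth_form_def
proof (intro conjI allI impI)
  fix p
  note R = smooth_form_alternating[OF r] and S = smooth_form_alternating[OF s]
  show "alternating_at A 2 p (theta2 \<theta> r s p)"
  proof (rule alternating_at_2I)
    fix vs assume h: "\<not> (length vs = 2 \<and> set vs \<subseteq> tangent_space A p)"
    show "theta2 \<theta> r s p vs = 0"
    proof (cases "length vs = 2")
      case True
      then obtain y z where vs: "vs = [y, z]" by (auto simp: numeral_2_eq_2 length_Suc_conv)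
      have "y \<notin> tangent_space A p \<or> z \<notin> tangent_space A p" using h True vs by auto
      then show ?thesis
        using alternating_at_tangent[OF R, of "[y]"] alternating_at_tangent[OF S, of "[y]"]
          alternating_at_tangent[OF R, of "[z]"] alternating_at_tangent[OF S, of "[z]"]
        by (auto simp: vs theta2_pair)
    qed (simp add: theta2_def wedge_length)
  qed (simp_all add: theta2_pair alternating_at_1_linear[OF R] alternating_at_1_linear[OF S] algebra_simps)
next
  fix W and Vs :: "(_ \<Rightarrow> (_ \<Rightarrow> real) \<Rightarrow> real) list"
  assume l: "length Vs = 2" and W: "open W" and V: "\<forall>V\<in>set Vs. smooth_vfield A W V"
  obtain Y Z where Vs: "Vs = [Y, Z]" using l by (auto simp: numeral_2_eq_2 length_Suc_conv)
  have "smooth_on A W (\<lambda>p. \<theta> t p [X p])" if "smooth_form A 1 (\<theta> t)" "X \<in> set Vs" for t X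
    using smooth_form_on[OF that(1), of "[X]" W] that(2) V W by simp
  then show "smooth_on A W (\<lambda>p. theta2 \<theta> r s p (map (\<lambda>V. V p) Vs))"
    unfolding Vs using r s
    by (simp add: theta2_pair smooth_on_diff[OF A W] smooth_on_mult[OF A W])
qed

lemma smooth_form_sum:
  assumes A: "smooth_manifold A" and c: "\<And>t. t \<in> T \<Longrightarrow> smooth_on A UNIV (c t)"
    and \<eta>: "\<And>t. t \<in> T \<Longrightarrow> smooth_form A k (\<eta> t)"
  shows "smooth_form A k (\<lambda>p vs. \<Sum>t\<in>T. c t p * \<eta> t p vs)"
  unfolding smooth_form_def
proof (intro conjI allI impI)
  fix p
  note alt = smooth_form_alternating[OF \<eta>, unfolded alternating_at_def]
  show "alternating_at A k p (\<lambda>vs. \<Sum>t\<in>T. c t p * \<eta> t p vs)"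
    unfolding alternating_at_def
  proof (intro conjI allI impI)
    show "(\<Sum>t\<in>T. c t p * \<eta> t p vs) = 0" if "\<not> (length vs = k \<and> set vs \<subseteq> tangent_space A p)" for vs
      using that smooth_form_alternating[OF \<eta>, THEN alternating_at_tangent, OF _ that] by simp
    show "(\<Sum>t\<in>T. c t p * \<eta> t p vs) = 0"
      if "length vs = k" "i < j" "j < k" "vs ! i = vs ! j" for vs i j
    proof (rule sum.neutral, rule ballI)
      fix t assume "t \<in> T"
      then have "\<eta> t p vs = 0" using alt[of t p] that by blast
      then show "c t p * \<eta> t p vs = 0" by simp
    qed
    show "(\<Sum>t\<in>T. c t p * \<eta> t p (vs[i := \<lambda>f. a * u f + b * w f])) =
        a * (\<Sum>t\<in>T. c t p * \<eta> t p (vs[i := u])) + b * (\<Sum>t\<in>T. c t p * \<eta> t p (vs[i := w]))"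
      if "length vs = k" "set vs \<subseteq> tangent_space A p" "i < k" "u \<in> tangent_space A p" "w \<in> tangent_space A p"
      for vs i a b u w
    proof -
      have "\<eta> t p (vs[i := \<lambda>f. a * u f + b * w f]) = a * \<eta> t p (vs[i := u]) + b * \<eta> t p (vs[i := w])"
        if "t \<in> T" for t
        using alt[OF \<open>t \<in> T\<close>, of p] \<open>length vs = k\<close> \<open>set vs \<subseteq> tangent_space A p\<close> \<open>i < k\<close>
          \<open>u \<in> tangent_space A p\<close> \<open>w \<in> tangent_space A p\<close> by blast
      then show ?thesis by (simp add: sum_distrib_left sum.distrib[symmetric] algebra_simps)
    qed
  qed
next
  fix W and Vs :: "'a vfield list"
  assume h: "length Vs = k" "open W" "\<forall>V\<in>set Vs. smooth_vfield A W V"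
  show "smooth_on A W (\<lambda>p. \<Sum>t\<in>T. c t p * \<eta> t p (map (\<lambda>V. V p) Vs))"
    by (intro smooth_on_sum[OF A] smooth_on_mult[OF A] h smooth_on_subset[OF c] subset_UNIV
        smooth_form_on[OF \<eta>]) (use h in auto)
qed

section \<open>Forms and coframes\<close>

text \<open>The point is that the frame spans. Let \<open>w\<close> be the difference between \<open>v\<close> and its expansion; every
  \<open>\<theta>\<^sub>t\<close> vanishes on it. For each function \<open>g\<close>, evaluation of tangent vectors at \<open>g\<close> is a covector,
  hence a combination of the coframe, and so \<open>w g = 0\<close>.\<close>

lemma framed_manifold_if_dual_frame:
  assumes A: "smooth_manifold A" and I: "finite I"
    and co: "coframe A I \<theta>" and du: "dual_frame A I \<theta> E"
  shows "framed_manifold A I \<theta> E"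
proof
  show \<theta>: "smooth_form A 1 (\<theta> t)" if "t \<in> I" for t
    using co that by (simp add: coframe_def)
  show E: "smooth_vfield A UNIV (E t)" if "t \<in> I" for t
    using du that by (simp add: dual_frame_def)
  fix p
  note alt = smooth_form_alternating[OF \<theta>, of _ p] and Ep = smooth_vfieldD(2)[OF E UNIV_I, of _ p]
  have delta: "\<theta> s p [E t p] = (if s = t then 1 else 0)" if "s \<in> I" "t \<in> I" for s t
    using du that by (simp add: dual_frame_def)
  show "dual_basis_at A I p (\<lambda>t. \<theta> t p) (\<lambda>t. E t p)"
    unfolding dual_basis_at_def
  proof (intro conjI ballI ext)
    fix v g assume v: "v \<in> tangent_space A p"
    define s where "s = tlincomb I (\<lambda>t. \<theta> t p [v]) (\<lambda>t. E t p)"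
    define w where "w = (\<lambda>f. 1 * v f + (-1) * s f)"
    have s: "s \<in> tangent_space A p" unfolding s_def by (rule tlincomb_tangent[OF Ep])
    have w: "w \<in> tangent_space A p" unfolding w_def by (rule tangent_lincomb2[OF v s])
    have "\<theta> t p [s] = \<theta> t p [v]" if t: "t \<in> I" for t
      unfolding s_def using alternating_at_1_tlincomb[OF alt[OF t] Ep, of I] t I
      by (simp add: delta if_distrib[of "\<lambda>x. _ * x"] cong: if_cong)
    then have w0: "\<theta> t p [w] = 0" if t: "t \<in> I" for t
      unfolding w_def using alternating_at_1_linear[OF alt[OF t] v s, of 1 "-1"] t by simp
    \<comment> \<open>Evaluation at \<open>g\<close>, as a covector.\<close>
    define \<beta> where "\<beta> vs = (if length vs = 1 \<and> set vs \<subseteq> tangent_space A p then hd vs g else 0)" for vs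
    have "alternating_at A 1 p \<beta>"
      by (rule alternating_at_1I) (auto simp: \<beta>_def tangent_lincomb2)
    then obtain c where "\<beta> = (\<lambda>vs. \<Sum>t\<in>I. c t * \<theta> t p vs)"
      using co unfolding coframe_def by blast
    then have "\<beta> [w] = 0" using w0 by simp
    then have "w g = 0" using w by (simp add: \<beta>_def)
    then show "v g = tlincomb I (\<lambda>t. \<theta> t p [v]) (\<lambda>t. E t p) g" by (simp add: w_def s_def)
  qed (use alt Ep delta in auto)
qed (fact A, fact I)

lemma omega_eq: "omega \<theta> p vs = theta2 \<theta> 1 4 p vs + theta2 \<theta> 2 5 p vs + theta2 \<theta> 3 6 p vs"
proof -
  have three: "{1..3} = {1, 2, 3::nat}" by auto
  show ?thesis unfolding omega_def three by simp
qed

lemma (in framed_manifold) form_1_expand: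
  assumes \<alpha>: "alternating_at A 1 p \<alpha>"
  shows "\<alpha> vs = (\<Sum>t\<in>I. \<alpha> [E t p] * \<theta> t p vs)"
proof (cases "length vs = 1 \<and> set vs \<subseteq> tangent_space A p")
  case True
  then obtain v where vs: "vs = [v]" and v: "v \<in> tangent_space A p"
    by (auto simp: length_Suc_conv)
  have "\<alpha> [v] = \<alpha> [tlincomb I (\<lambda>t. \<theta> t p [v]) (\<lambda>t. E t p)]"
    using frame_expand[OF v] by simp
  also have "\<dots> = (\<Sum>t\<in>I. \<theta> t p [v] * \<alpha> [E t p])"
    by (rule alternating_at_1_tlincomb[OF \<alpha> frame_tangent])
  finally show ?thesis by (simp add: vs mult.commute)
next
  case False
  then show ?thesis
    using alternating_at_tangent[OF \<alpha> False]
      alternating_at_tangent[OF smooth_form_alternating[OF coframe_smooth] False] by simp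
qed

lemma (in framed_manifold) form_2_eqI:
  assumes \<eta>: "alternating_at A 2 p \<eta>" and \<zeta>: "alternating_at A 2 p \<zeta>"
    and eq: "\<And>r s. r \<in> I \<Longrightarrow> s \<in> I \<Longrightarrow> \<eta> [E r p, E s p] = \<zeta> [E r p, E s p]"
  shows "\<eta> = \<zeta>"
proof
  fix vs
  show "\<eta> vs = \<zeta> vs"
  proof (cases "length vs = 2 \<and> set vs \<subseteq> tangent_space A p")
    case True
    then obtain u v where vs: "vs = [u, v]" and u: "u \<in> tangent_space A p" and v: "v \<in> tangent_space A p"
      by (auto simp: numeral_2_eq_2 length_Suc_conv)
    have expand: "\<xi> [u, v] = (\<Sum>r\<in>I. \<theta> r p [u] * (\<Sum>s\<in>I. \<theta> s p [v] * \<xi> [E r p, E s p]))"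
      if \<xi>: "alternating_at A 2 p \<xi>" for \<xi>
    proof -
      have "\<xi> [u, v] = \<xi> [tlincomb I (\<lambda>t. \<theta> t p [u]) (\<lambda>t. E t p), v]"
        using frame_expand[OF u] by simp
      also have "\<dots> = (\<Sum>r\<in>I. \<theta> r p [u] * \<xi> [E r p, v])"
        by (rule alternating_at_2_tlincomb(1)[OF \<xi> frame_tangent v])
      also have "\<dots> = (\<Sum>r\<in>I. \<theta> r p [u] * \<xi> [E r p, tlincomb I (\<lambda>t. \<theta> t p [v]) (\<lambda>t. E t p)])"
        using frame_expand[OF v] by simp
      also have "\<dots> = (\<Sum>r\<in>I. \<theta> r p [u] * (\<Sum>s\<in>I. \<theta> s p [v] * \<xi> [E r p, E s p]))"
        by (intro sum.cong refl arg_cong2[where f = "(*)"] alternating_at_2_tlincomb(2)[OF \<xi> frame_tangent frame_tangent])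
      finally show ?thesis .
    qed
    show ?thesis unfolding vs expand[OF \<eta>] expand[OF \<zeta>] by (simp add: eq)
  next
    case False
    then show ?thesis using alternating_at_tangent[OF \<eta> False] alternating_at_tangent[OF \<zeta> False] by simp
  qed
qed

lemma ext_deriv_outside:
  "\<not> (length vs = Suc k \<and> set vs \<subseteq> tangent_space A p) \<Longrightarrow> ext_deriv A k \<eta> p vs = 0"
  unfolding ext_deriv_def by (rule if_not_P)

text \<open>In a frame of three fields an alternating expression in three indices is determined by its value
  on one triple.\<close>

lemma (in framed_manifold) ext_deriv_2_zero_iff:
  assumes \<eta>: "smooth_form A 2 \<eta>" and I: "I = {i, j, k}"
  shows "ext_deriv A 2 \<eta> = (\<lambda>_ _. 0) \<longleftrightarrow> (\<forall>p. koszul A 2 \<eta> [E i, E j, E k] p = 0)"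
proof
  assume "ext_deriv A 2 \<eta> = (\<lambda>_ _. 0)"
  then show "\<forall>p. koszul A 2 \<eta> [E i, E j, E k] p = 0"
    using ext_deriv_2_frame[OF \<eta>, of i j k] I by auto
next
  assume K: "\<forall>p. koszul A 2 \<eta> [E i, E j, E k] p = 0"
  have zero: "koszul A 2 \<eta> [E r, E s, E t] p = 0" if rst: "r \<in> I" "s \<in> I" "t \<in> I" for r s t p
  proof -
    define c where "c r s t = koszul A 2 \<eta> [E r, E s, E t] p" for r s t
    have 1: "c s r t = - c r s t" and 2: "c r t s = - c r s t" if "r \<in> I" "s \<in> I" "t \<in> I" for r s t
      unfolding c_def
      by (rule koszul_2_swap_01[OF manifold \<eta> frame_smooth frame_smooth frame_smooth UNIV_I, OF that])
        (rule koszul_2_swap_12[OF manifold \<eta> frame_smooth frame_smooth frame_smooth UNIV_I, OF that])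
    have c0: "c i j k = 0" using K by (simp add: c_def)
    have a: "c x x y = 0" if "x \<in> I" "y \<in> I" for x y using 1[of x x y] that by simp
    have b: "c y x x = 0" if "x \<in> I" "y \<in> I" for x y using 2[of y x x] that by simp
    have d: "c x y x = 0" if "x \<in> I" "y \<in> I" for x y using 2[of x x y] a[of x y] that by simp
    have m: "i \<in> I" "j \<in> I" "k \<in> I" using I by auto
    have p1: "c j i k = 0" using 1[OF m(1,2,3)] c0 by simp
    have p2: "c i k j = 0" using 2[OF m(1,2,3)] c0 by simp
    have p3: "c j k i = 0" using 2[OF m(2,1,3)] p1 by simp
    have p4: "c k i j = 0" using 1[OF m(1,3,2)] p2 by simp
    have p5: "c k j i = 0" using 2[OF m(3,1,2)] p4 by simp
    have "r = i \<or> r = j \<or> r = k" "s = i \<or> s = j \<or> s = k" "t = i \<or> t = j \<or> t = k"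
      using rst by (auto simp: I)
    then have "c r s t = 0"
      by (elim disjE) (simp_all only: c0 p1 p2 p3 p4 p5 a b d m)
    then show ?thesis by (simp add: c_def)
  qed
  show "ext_deriv A 2 \<eta> = (\<lambda>_ _. 0)"
  proof (intro ext)
    fix p vs
    show "ext_deriv A 2 \<eta> p vs = 0"
    proof (cases "length vs = 3 \<and> set vs \<subseteq> tangent_space A p")
      case True
      then obtain u v w where "vs = [u, v, w]" "u \<in> tangent_space A p" "v \<in> tangent_space A p" "w \<in> tangent_space A p"
        by (auto simp: numeral_3_eq_3 length_Suc_conv)
      then show ?thesis by (simp add: ext_deriv_2[OF \<eta>] zero)
    next
      case False
      then have "\<not> (length vs = Suc 2 \<and> set vs \<subseteq> tangent_space A p)" by simp
      then show ?thesis by (rule ext_deriv_outside)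
    qed
  qed
qed

section \<open>The frame of an integral submanifold\<close>

text \<open>In each of the four triples exactly one index of every pair \<open>{h, h + 3}\<close> occurs, and the number of
  indices above 3 is even. The first fact makes the leaf Lagrangian, the second one makes the
  restriction of \<open>\<Omega>\<close> real.\<close>

locale framed_leaf = X: framed_manifold B "{1..6}" \<theta> E
  for B :: "('x::{t2_space,second_countable_topology}, real ^ 6) atlas" and \<theta> and E +
  fixes A :: "('l::{t2_space,second_countable_topology}, real ^ 3) atlas"
    and \<iota> :: "'l \<Rightarrow> 'x" and i j k :: nat
  assumes integral: "integral_submanifold A B \<iota> (distribution {i, j, k} E)"
    and indices: "(i, j, k) \<in> {(1, 2, 3), (1, 5, 6), (2, 4, 6), (3, 4, 5)}"
begin

abbreviation leaf_coframe :: "nat \<Rightarrow> ('l, real) form" where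
  "leaf_coframe t \<equiv> pullback A B \<iota> (\<theta> t)"

abbreviation leaf_frame :: "nat \<Rightarrow> 'l vfield" where
  "leaf_frame h \<equiv> restrict_vfield A B \<iota> (E h)"

lemma leaf_immersion: "smooth_manifold A" "smooth_map_on A B UNIV \<iota>" "inj_on (push B \<iota> p) (tangent_space A p)"
  using integral unfolding integral_submanifold_def immersed_submanifold_def by auto

lemma push_leaf_image: "push B \<iota> p ` tangent_space A p = distribution {i, j, k} E (\<iota> p)"
  using integral unfolding integral_submanifold_def by auto

lemma index_cases:
  obtains "i = 1" "j = 2" "k = 3" | "i = 1" "j = 5" "k = 6" | "i = 2" "j = 4" "k = 6" | "i = 3" "j = 4" "k = 5"
  using indices by auto

lemma distinct_indices: "i \<noteq> j" "i \<noteq> k" "j \<noteq> k"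
  using indices by auto

lemma index_range: "h \<in> {i, j, k} \<Longrightarrow> h \<in> {1..6}"
  using indices by auto

lemmas push_leaf = push_tangent[OF leaf_immersion(1) X.manifold leaf_immersion(2)]

lemma restricted_frame:
  assumes "h \<in> {i, j, k}"
  shows "leaf_frame h p \<in> tangent_space A p" and "push B \<iota> p (leaf_frame h p) = E h (\<iota> p)"
proof -
  have "E h (\<iota> p) = tlincomb {i, j, k} (\<lambda>t. if t = h then 1 else 0) (\<lambda>t. E t (\<iota> p))"
    using assms by (auto simp: tlincomb_def if_distrib[of "\<lambda>x. x * _"] cong: if_cong)
  then have "E h (\<iota> p) \<in> push B \<iota> p ` tangent_space A p"
    unfolding push_leaf_image distribution_def by blast
  then obtain v where v: "v \<in> tangent_space A p" "push B \<iota> p v = E h (\<iota> p)" by auto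
  have "leaf_frame h p \<in> tangent_space A p \<and> push B \<iota> p (leaf_frame h p) = E h (\<iota> p)"
    unfolding restrict_vfield_def
  proof (rule theI[of _ v])
    show "x = v" if "x \<in> tangent_space A p \<and> push B \<iota> p x = E h (\<iota> p)" for x
      by (rule inj_onD[OF leaf_immersion(3)[of p]]) (use that v in simp_all)
  qed (use v in simp)
  then show "leaf_frame h p \<in> tangent_space A p" "push B \<iota> p (leaf_frame h p) = E h (\<iota> p)" by auto
qed

lemma leaf_coframe_apply: "v \<in> tangent_space A p \<Longrightarrow> leaf_coframe t p [v] = \<theta> t (\<iota> p) [push B \<iota> p v]"
  by (simp add: pullback_def)

text \<open>The push-forward of a vector tangent to the leaf lies in the distribution, and the ambient coframe
  reads off its coefficients.\<close>

lemma push_leaf_expand: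
  assumes v: "v \<in> tangent_space A p"
  shows "push B \<iota> p v = tlincomb {i, j, k} (\<lambda>t. leaf_coframe t p [v]) (\<lambda>t. E t (\<iota> p))"
    and "t \<in> {1..6} \<Longrightarrow> t \<notin> {i, j, k} \<Longrightarrow> \<theta> t (\<iota> p) [push B \<iota> p v] = 0"
proof -
  have "push B \<iota> p v \<in> distribution {i, j, k} E (\<iota> p)" using push_leaf_image v by blast
  then obtain c where c: "push B \<iota> p v = tlincomb {i, j, k} c (\<lambda>t. E t (\<iota> p))"
    unfolding distribution_def by blast
  have coef: "\<theta> t (\<iota> p) [push B \<iota> p v] = (\<Sum>h\<in>{i, j, k}. c h * (if t = h then 1 else 0))"
    if t: "t \<in> {1..6}" for t
    unfolding c
    using alternating_at_1_tlincomb[where I = "{i, j, k}" and c = c and v = "\<lambda>t. E t (\<iota> p)",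
        OF smooth_form_alternating[OF X.coframe_smooth[OF t]] X.frame_tangent[OF index_range]]
      X.coframe_frame[OF t index_range]
    by simp
  then show "\<theta> t (\<iota> p) [push B \<iota> p v] = 0" if "t \<in> {1..6}" "t \<notin> {i, j, k}"
    using that by (auto intro!: sum.neutral)
  have "leaf_coframe t p [v] = c t" if "t \<in> {i, j, k}" for t
    using coef[OF index_range[OF that]] that
    by (auto simp: leaf_coframe_apply[OF v] if_distrib[of "\<lambda>x. _ * x"] cong: if_cong)
  then show "push B \<iota> p v = tlincomb {i, j, k} (\<lambda>t. leaf_coframe t p [v]) (\<lambda>t. E t (\<iota> p))"
    unfolding c tlincomb_def by auto
qed

lemma leaf_dual_basis: "dual_basis_at A {i, j, k} p (\<lambda>t. leaf_coframe t p) (\<lambda>t. leaf_frame t p)"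
  unfolding dual_basis_at_def
proof (intro conjI ballI)
  fix t assume t: "t \<in> {i, j, k}"
  show "alternating_at A 1 p (leaf_coframe t p)"
    using pullback_alternating[OF leaf_immersion(1) X.manifold leaf_immersion(2)]
      smooth_form_alternating[OF X.coframe_smooth[OF index_range[OF t]]] by blast
  show "leaf_frame t p \<in> tangent_space A p" by (rule restricted_frame(1)[OF t])
  fix s assume s: "s \<in> {i, j, k}"
  show "leaf_coframe t p [leaf_frame s p] = (if t = s then 1 else 0)"
    using X.coframe_frame[OF index_range[OF t] index_range[OF s]]
    by (simp add: leaf_coframe_apply restricted_frame[OF s])
next
  fix v assume v: "v \<in> tangent_space A p"
  let ?w = "tlincomb {i, j, k} (\<lambda>t. leaf_coframe t p [v]) (\<lambda>t. leaf_frame t p)"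
  have w: "?w \<in> tangent_space A p" by (rule tlincomb_tangent[OF restricted_frame(1)])
  have "push B \<iota> p ?w = push B \<iota> p v"
    unfolding push_tlincomb push_leaf_expand(1)[OF v] using restricted_frame(2) by (auto simp: tlincomb_def)
  then show "v = ?w" using inj_onD[OF leaf_immersion(3) _ v w] by simp
qed

lemma leaf_framed: "framed_manifold A {i, j, k} leaf_coframe leaf_frame"
proof
  obtain \<sigma> where \<sigma>: "bij_betw \<sigma> (UNIV :: 6 set) {1..6::nat}"
    using finite_same_card_bij[of "UNIV :: 6 set" "{1..6::nat}"] by auto
  have "card {i, j, k} = 3" using distinct_indices by simp
  then obtain \<tau> where \<tau>: "bij_betw \<tau> (UNIV :: 3 set) {i, j, k}"
    using finite_same_card_bij[of "UNIV :: 3 set" "{i, j, k}"] by auto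
  show co: "smooth_form A 1 (leaf_coframe t)" if "t \<in> {i, j, k}" for t
    by (rule pullback_smooth_form_1[OF leaf_immersion(1) X.manifold leaf_immersion(2) X.dual_basis \<sigma>
          X.coframe_smooth[OF index_range[OF that]]])
  show "smooth_vfield A UNIV (leaf_frame t)" if "t \<in> {i, j, k}" for t
    by (rule dual_frame_smooth[where \<theta> = leaf_coframe, OF leaf_immersion(1) leaf_dual_basis co \<tau> that])
  show "dual_basis_at A {i, j, k} p (\<lambda>t. leaf_coframe t p) (\<lambda>t. leaf_frame t p)" for p
    by (rule leaf_dual_basis)
qed (auto simp: leaf_immersion(1))

sublocale L: framed_manifold A "{i, j, k}" leaf_coframe leaf_frame
  by (rule leaf_framed)

lemma special_lagrangian_leaf: "special_lagrangian A B \<iota> \<theta>"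
  unfolding special_lagrangian_def
proof (intro conjI ext)
  show "2 * DIM(real ^ 3) = DIM(real ^ 6)" by simp
  fix p and vs :: "'l tvec list"
  note zero = push_leaf_expand(2)[of _ p]
  show "pullback A B \<iota> (omega \<theta>) p vs = 0"
  proof (cases "set vs \<subseteq> tangent_space A p \<and> length vs = 2")
    case True
    then obtain u v where vs: "vs = [u, v]" "u \<in> tangent_space A p" "v \<in> tangent_space A p"
      by (auto simp: numeral_2_eq_2 length_Suc_conv)
    show ?thesis
      by (rule index_cases) (use vs zero[OF vs(2)] zero[OF vs(3)] in
          \<open>simp_all add: pullback_def omega_eq theta2_pair\<close>)
  qed (auto simp: pullback_def omega_eq theta2_def wedge_length)
  show "pullback A B \<iota> (\<lambda>p vs. Im (Omega \<theta> p vs)) p vs = 0"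
  proof (cases "set vs \<subseteq> tangent_space A p \<and> length vs = 3")
    case True
    then obtain u v w where vs: "vs = [u, v, w]" "u \<in> tangent_space A p" "v \<in> tangent_space A p" "w \<in> tangent_space A p"
      by (auto simp: numeral_3_eq_3 length_Suc_conv)
    show ?thesis
      by (rule index_cases) (use vs zero[OF vs(2)] zero[OF vs(3)] zero[OF vs(4)] in
          \<open>simp_all add: pullback_def Omega_def wedge_2_1[unfolded One_nat_def] wedge_1_1[unfolded One_nat_def] phi_def\<close>)
  qed (auto simp: pullback_def Omega_def wedge_length)
qed

end

section \<open>Hodge star and codifferential in an orthonormal frame\<close>

context framed_manifold
begin

lemma coframe_tlincomb: "s \<in> I \<Longrightarrow> \<theta> s p [tlincomb I c (\<lambda>t. E t p)] = c s"
  using alternating_at_1_tlincomb[where I = I and c = c and v = "\<lambda>t. E t p",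
      OF smooth_form_alternating[OF coframe_smooth] frame_tangent] finite_index
  by (simp add: coframe_frame if_distrib[of "\<lambda>x. _ * x"] cong: if_cong)

text \<open>In an orthonormal frame the metric dual of a covector has the same components.\<close>

lemma sharp_frame:
  assumes g: "\<And>u v. u \<in> tangent_space A p \<Longrightarrow> v \<in> tangent_space A p \<Longrightarrow>
      g p u v = (\<Sum>t\<in>I. \<theta> t p [u] * \<theta> t p [v])"
    and \<beta>: "alternating_at A 1 p \<beta>"
  shows "sharp A g p \<beta> = tlincomb I (\<lambda>t. \<beta> [E t p]) (\<lambda>t. E t p)"
  unfolding sharp_def
proof (rule the_equality)
  let ?s = "tlincomb I (\<lambda>t. \<beta> [E t p]) (\<lambda>t. E t p)"
  have s: "?s \<in> tangent_space A p" by (rule tlincomb_tangent[OF frame_tangent])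
  show "?s \<in> tangent_space A p \<and> (\<forall>v\<in>tangent_space A p. g p ?s v = \<beta> [v])"
  proof (intro conjI ballI s)
    fix v assume v: "v \<in> tangent_space A p"
    show "g p ?s v = \<beta> [v]"
      unfolding g[OF s v] form_1_expand[OF \<beta>, of "[v]"] by (simp add: coframe_tlincomb)
  qed
  fix u assume u: "u \<in> tangent_space A p \<and> (\<forall>v\<in>tangent_space A p. g p u v = \<beta> [v])"
  have "\<theta> t p [u] = \<beta> [E t p]" if t: "t \<in> I" for t
  proof -
    have "\<beta> [E t p] = g p u (E t p)" using u frame_tangent[OF t] by simp
    also have "\<dots> = \<theta> t p [u]"
      using g[of u "E t p"] u frame_tangent[OF t] t finite_index
      by (simp add: coframe_frame if_distrib[of "\<lambda>x. _ * x"] cong: if_cong)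
    finally show ?thesis by simp
  qed
  then show "u = ?s"
    using frame_expand[of u p] u by (simp add: tlincomb_def)
qed

text \<open>The three coefficients are forced by the defining equation for \<open>\<beta> = \<theta>\<^sub>r\<close> on the frame, since
  \<open>\<theta>\<^sub>r \<and> \<eta>\<close> picks out the value of \<open>\<eta>\<close> on the other two frame vectors. That they solve it is
  an identity of polynomials in the components.\<close>

lemma hodge_star_frame:
  assumes g: "\<And>p u v. u \<in> tangent_space A p \<Longrightarrow> v \<in> tangent_space A p \<Longrightarrow>
      g p u v = (\<Sum>t\<in>I. \<theta> t p [u] * \<theta> t p [v])"
    and I: "I = {i, j, k}" "i \<noteq> j" "i \<noteq> k" "j \<noteq> k"
    and \<alpha>: "smooth_form A 1 \<alpha>"
  shows "hodge_star A g (theta3 \<theta> i j k) \<alpha> = (\<lambda>p vs. \<alpha> p [E i p] * theta2 \<theta> j k p vs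
      - \<alpha> p [E j p] * theta2 \<theta> i k p vs + \<alpha> p [E k p] * theta2 \<theta> i j p vs)" (is "_ = ?h")
    and "smooth_form A 2 (\<lambda>p vs. \<alpha> p [E i p] * theta2 \<theta> j k p vs
      - \<alpha> p [E j p] * theta2 \<theta> i k p vs + \<alpha> p [E k p] * theta2 \<theta> i j p vs)"
proof -
  have m: "i \<in> I" "j \<in> I" "k \<in> I" using I by auto
  have sum3: "(\<Sum>t\<in>I. x t) = x i + x j + x k" for x :: "nat \<Rightarrow> real"
    using I by (simp add: add.assoc)
  have coeff: "smooth_on A UNIV (\<lambda>p. \<alpha> p [E t p])" if "t \<in> I" for t
    using smooth_form_on[OF \<alpha>, of "[E t]" UNIV] frame_smooth[OF that] by simp
  \<comment> \<open>The formula as a sum over the index of the coefficient, with the form belonging to each index.\<close>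
  have "smooth_form A 2 (\<lambda>p vs. \<Sum>t\<in>{i, j, k}. (if t = j then - \<alpha> p [E j p] else \<alpha> p [E t p]) *
      (if t = i then theta2 \<theta> j k else if t = j then theta2 \<theta> i k else theta2 \<theta> i j) p vs)"
  proof (rule smooth_form_sum[OF manifold])
    fix t assume t: "t \<in> {i, j, k}"
    have "smooth_on A UNIV (\<lambda>p. 0 - \<alpha> p [E j p])"
      by (rule smooth_on_diff[OF manifold open_UNIV smooth_on_const coeff[OF m(2)]])
    then show "smooth_on A UNIV (\<lambda>p. if t = j then - \<alpha> p [E j p] else \<alpha> p [E t p])"
      using coeff[of t] t I by (cases "t = j") auto
    show "smooth_form A 2 (if t = i then theta2 \<theta> j k else if t = j then theta2 \<theta> i k else theta2 \<theta> i j)"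
      using theta2_smooth_form[OF manifold coframe_smooth coframe_smooth] m by simp
  qed
  then show smooth: "smooth_form A 2 ?h"
    using I by (simp add: algebra_simps)
  have unique: "\<eta> = \<zeta>"
    if \<eta>: "alternating_at A 2 p \<eta>" and \<zeta>: "alternating_at A 2 p \<zeta>"
      and eq: "\<And>\<beta> vs. alternating_at A 1 p \<beta> \<Longrightarrow> wedge 1 2 (\<lambda>_. \<beta>) (\<lambda>_. \<eta>) p vs = wedge 1 2 (\<lambda>_. \<beta>) (\<lambda>_. \<zeta>) p vs"
    for p \<eta> \<zeta>
  proof (rule form_2_eqI[OF \<eta> \<zeta>])
    note swap = alternating_at_2_swap[OF _ frame_tangent frame_tangent]
    have W: "\<eta> [E s p, E t p] = \<zeta> [E s p, E t p]"
      if h: "r \<in> I" "s \<in> I" "t \<in> I" "r \<noteq> s" "r \<noteq> t" for r s t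
      using eq[OF smooth_form_alternating[OF coframe_smooth[OF h(1)]], of "[E r p, E s p, E t p]"]
        swap[OF \<eta> h(2,3)] swap[OF \<zeta> h(2,3)] h
      by (simp add: wedge_1_2[unfolded One_nat_def] coframe_frame)
    have D: "\<eta> [E s p, E s p] = \<zeta> [E s p, E s p]" if "s \<in> I" for s
      using swap[OF \<eta> that that] swap[OF \<zeta> that that] by simp
    fix r s assume rs: "r \<in> I" "s \<in> I"
    \<comment> \<open>Testing with \<open>\<theta>\<^sub>t\<close> for an index \<open>t\<close> different from \<open>r\<close> and \<open>s\<close>.\<close>
    have "\<exists>t\<in>I. t \<noteq> r \<and> t \<noteq> s" using rs I by auto
    then show "\<eta> [E r p, E s p] = \<zeta> [E r p, E s p]" using W rs by blast
  qed
  have star: "wedge 1 2 (\<lambda>_. \<beta>) (\<lambda>_. ?h p) p vs =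
      g p (sharp A g p \<beta>) (sharp A g p (\<alpha> p)) * theta3 \<theta> i j k p vs"
    if \<beta>: "alternating_at A 1 p \<beta>" for p \<beta> vs
  proof (cases "length vs = 3")
    case True
    then obtain u v w where vs: "vs = [u, v, w]" by (auto simp: numeral_3_eq_3 length_Suc_conv)
    have b: "\<beta> [x] = \<beta> [E i p] * \<theta> i p [x] + \<beta> [E j p] * \<theta> j p [x] + \<beta> [E k p] * \<theta> k p [x]" for x
      using form_1_expand[OF \<beta>, of "[x]"] sum3 by simp
    have gs: "g p (tlincomb I x (\<lambda>t. E t p)) (tlincomb I y (\<lambda>t. E t p)) = (\<Sum>t\<in>I. x t * y t)" for x y
    proof -
      have "tlincomb I c (\<lambda>t. E t p) \<in> tangent_space A p" for c
        by (rule tlincomb_tangent[OF frame_tangent])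
      then show ?thesis by (simp add: g coframe_tlincomb)
    qed
    have sharp: "sharp A g p \<xi> = tlincomb I (\<lambda>t. \<xi> [E t p]) (\<lambda>t. E t p)"
      if "alternating_at A 1 p \<xi>" for \<xi>
      by (rule sharp_frame[OF _ that]) (rule g)
    have gp: "g p (sharp A g p \<beta>) (sharp A g p (\<alpha> p)) =
        \<beta> [E i p] * \<alpha> p [E i p] + \<beta> [E j p] * \<alpha> p [E j p] + \<beta> [E k p] * \<alpha> p [E k p]"
      by (simp only: sharp \<beta> smooth_form_alternating[OF \<alpha>] gs sum3)
    show ?thesis
      unfolding vs gp wedge_1_2 theta3_triple theta2_pair b[of u] b[of v] b[of w]
      by (simp add: field_simps)
  next
    case False
    then show ?thesis by (simp add: wedge_length theta3_def)
  qed
  show "hodge_star A g (theta3 \<theta> i j k) \<alpha> = ?h"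
  proof
    fix p
    show "hodge_star A g (theta3 \<theta> i j k) \<alpha> p = ?h p"
      unfolding hodge_star_def
    proof (rule the_equality)
      show "alternating_at A 2 p (?h p) \<and> (\<forall>\<beta>. alternating_at A 1 p \<beta> \<longrightarrow> (\<forall>vs.
          wedge 1 2 (\<lambda>_. \<beta>) (\<lambda>_. ?h p) p vs =
          g p (sharp A g p \<beta>) (sharp A g p (\<alpha> p)) * theta3 \<theta> i j k p vs))"
        using star smooth_form_alternating[OF smooth] by blast
    next
      fix \<eta> assume "alternating_at A 2 p \<eta> \<and> (\<forall>\<beta>. alternating_at A 1 p \<beta> \<longrightarrow> (\<forall>vs.
          wedge 1 2 (\<lambda>_. \<beta>) (\<lambda>_. \<eta>) p vs =
          g p (sharp A g p \<beta>) (sharp A g p (\<alpha> p)) * theta3 \<theta> i j k p vs))"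
      then show "\<eta> = ?h p"
        by (intro unique[OF _ smooth_form_alternating[OF smooth]]) (simp_all only: star)
    qed
  qed
qed

lemma koszul_theta2_frame:
  assumes "r \<in> I" "s \<in> I" "a \<in> I" "b \<in> I" "c \<in> I"
  shows "koszul A 2 (theta2 \<theta> r s) [E a, E b, E c] p =
    - theta2 \<theta> r s p [lie_bracket A (E a) (E b) p, E c p]
    + theta2 \<theta> r s p [lie_bracket A (E a) (E c) p, E b p]
    - theta2 \<theta> r s p [lie_bracket A (E b) (E c) p, E a p]"
proof -
  have const: "V p (\<lambda>q. theta2 \<theta> r s q [E x q, E y q]) = 0"
    if "V p \<in> tangent_space A p" "x \<in> I" "y \<in> I" for V x y
    using tangent_const[OF that(1)] that assms by (simp add: theta2_pair coframe_frame)
  show ?thesis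
    unfolding koszul_2 using assms by (simp add: const frame_tangent)
qed

text \<open>By the product rule,
  \<open>d(*\<alpha>) = d\<alpha>\<^sub>i \<and> \<theta>\<^sup>j\<^sup>k - d\<alpha>\<^sub>j \<and> \<theta>\<^sup>i\<^sup>k + d\<alpha>\<^sub>k \<and> \<theta>\<^sup>i\<^sup>j + \<alpha>\<^sub>i d\<theta>\<^sup>j\<^sup>k - \<alpha>\<^sub>j d\<theta>\<^sup>i\<^sup>k + \<alpha>\<^sub>k d\<theta>\<^sup>i\<^sup>j\<close>.
  In the invariant formula on the frame the first three terms are the derivatives of the
  coefficients and the others are the bracket terms.\<close>

lemma codifferential_zero_iff:
  assumes g: "\<And>p u v. u \<in> tangent_space A p \<Longrightarrow> v \<in> tangent_space A p \<Longrightarrow>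
      g p u v = (\<Sum>t\<in>I. \<theta> t p [u] * \<theta> t p [v])"
    and I: "I = {i, j, k}" "i \<noteq> j" "i \<noteq> k" "j \<noteq> k"
    and \<alpha>: "smooth_form A 1 \<alpha>"
    and f2: "\<forall>r\<in>I. \<forall>s\<in>I. ext_deriv A 2 (theta2 \<theta> r s) = (\<lambda>p vs. f2 r s p * theta3 \<theta> i j k p vs)"
  shows "ext_deriv A 2 (hodge_star A g (theta3 \<theta> i j k) \<alpha>) = (\<lambda>_ _. 0) \<longleftrightarrow>
    (\<forall>p. E i p (\<lambda>q. \<alpha> q [E i q]) + \<alpha> p [E i p] * f2 j k p
       + E j p (\<lambda>q. \<alpha> q [E j q]) - \<alpha> p [E j p] * f2 i k p
       + E k p (\<lambda>q. \<alpha> q [E k q]) + \<alpha> p [E k p] * f2 i j p = 0)"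
proof -
  have m: "i \<in> I" "j \<in> I" "k \<in> I" using I by auto
  let ?h = "\<lambda>p vs. \<alpha> p [E i p] * theta2 \<theta> j k p vs
      - \<alpha> p [E j p] * theta2 \<theta> i k p vs + \<alpha> p [E k p] * theta2 \<theta> i j p vs"
  have star: "hodge_star A g (theta3 \<theta> i j k) \<alpha> = ?h"
    by (rule hodge_star_frame(1)[OF _ I \<alpha>]) (rule g)
  have smooth: "smooth_form A 2 ?h"
    by (rule hodge_star_frame(2)[OF _ I \<alpha>, of g]) (rule g)
  have f2_eq: "koszul A 2 (theta2 \<theta> r s) [E i, E j, E k] p = f2 r s p" if "r \<in> I" "s \<in> I" for r s p
  proof -
    have "koszul A 2 (theta2 \<theta> r s) [E i, E j, E k] p = ext_deriv A 2 (theta2 \<theta> r s) p [E i p, E j p, E k p]"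
      by (rule ext_deriv_2_frame[symmetric, OF theta2_smooth_form[where \<theta> = \<theta>,
              OF manifold coframe_smooth[OF that(1)] coframe_smooth[OF that(2)]] m])
    also have "\<dots> = f2 r s p * theta3 \<theta> i j k p [E i p, E j p, E k p]" using f2 that by simp
    also have "theta3 \<theta> i j k p [E i p, E j p, E k p] = 1"
      using I m by (simp add: theta3_triple coframe_frame)
    finally show ?thesis by simp
  qed
  have K: "koszul A 2 ?h [E i, E j, E k] p =
      E i p (\<lambda>q. \<alpha> q [E i q]) + \<alpha> p [E i p] * f2 j k p
       + E j p (\<lambda>q. \<alpha> q [E j q]) - \<alpha> p [E j p] * f2 i k p
       + E k p (\<lambda>q. \<alpha> q [E k q]) + \<alpha> p [E k p] * f2 i j p" for p
  proof -
    have v: "?h q [E j q, E k q] = \<alpha> q [E i q]" "?h q [E i q, E k q] = - \<alpha> q [E j q]"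
        "?h q [E i q, E j q] = \<alpha> q [E k q]" for q
      using I m by (simp_all add: theta2_pair coframe_frame)
    have neg: "E j p (\<lambda>q. - \<alpha> q [E j q]) = - E j p (\<lambda>q. \<alpha> q [E j q])"
      by (rule tangent_uminus[OF frame_tangent[OF m(2)]
            smooth_form_smooth_at1[OF \<alpha> frame_smooth[OF m(2)] UNIV_I]])
    have F: "f2 r s p = - theta2 \<theta> r s p [lie_bracket A (E i) (E j) p, E k p]
        + theta2 \<theta> r s p [lie_bracket A (E i) (E k) p, E j p]
        - theta2 \<theta> r s p [lie_bracket A (E j) (E k) p, E i p]" if "r \<in> I" "s \<in> I" for r s
      by (rule trans[OF f2_eq[OF that, symmetric] koszul_theta2_frame[OF that m]])
    show ?thesis
      unfolding koszul_2 v neg F[OF m(2,3)] F[OF m(1,3)] F[OF m(1,2)]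
      by (simp add: algebra_simps)
  qed
  have "ext_deriv A 2 ?h = (\<lambda>_ _. 0) \<longleftrightarrow> (\<forall>p. koszul A 2 ?h [E i, E j, E k] p = 0)"
    by (rule ext_deriv_2_zero_iff[OF smooth I(1)])
  then show ?thesis unfolding star K .
qed

end

lemma (in framed_manifold) koszul_1_frame:
  assumes \<alpha>: "smooth_form A 1 \<alpha>"
  shows "koszul A 1 \<alpha> [E r, E s] p = E r p (\<lambda>q. \<alpha> q [E s q]) - E s p (\<lambda>q. \<alpha> q [E r q])
    - (\<Sum>t\<in>I. \<alpha> p [E t p] * \<theta> t p [lie_bracket A (E r) (E s) p])"
proof -
  have "\<alpha> p [lie_bracket A (E r) (E s) p] = (\<Sum>t\<in>I. \<alpha> p [E t p] * \<theta> t p [lie_bracket A (E r) (E s) p])"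
    by (rule form_1_expand[OF smooth_form_alternating[OF \<alpha>]])
  then show ?thesis by (simp only: koszul_1)
qed

section \<open>Brackets and structure functions\<close>

text \<open>The functions \<open>\<theta>\<^sub>t(E\<^sub>b)\<close> are constant, so the invariant formula reduces to
  \<open>d\<theta>\<^sub>t(E\<^sub>a, E\<^sub>b) = - \<theta>\<^sub>t([E\<^sub>a, E\<^sub>b])\<close>, and the left hand side is \<open>f\<^sup>t\<^sub>a\<^sub>b\<close>.\<close>

lemma structure_functions_bracket:
  assumes X: "framed_manifold B {1..6} \<theta> E" and f: "structure_functions B \<theta> f"
    and t: "t \<in> {1..6}" and a: "a \<in> {1..6}" and b: "b \<in> {1..6}"
  shows "\<theta> t x [lie_bracket B (E a) (E b) x] = - f t a b x"
proof -
  interpret framed_manifold B "{1..6}" \<theta> E by (rule X)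
  have anti: "f t s r x = - f t r s x" if "r \<in> {1..6}" "s \<in> {1..6}" for r s
    using f t that unfolding structure_functions_def by blast
  have d: "ext_deriv B 1 (\<theta> t) = (\<lambda>p vs. \<Sum>r\<in>{1..6}. \<Sum>s\<in>{r+1..6}. f t r s p * theta2 \<theta> r s p vs)"
    using f t unfolding structure_functions_def by blast
  have "koszul B 1 (\<theta> t) [E a, E b] x = - \<theta> t x [lie_bracket B (E a) (E b) x]"
    unfolding koszul_1
    using tangent_const[OF frame_tangent[OF a]] tangent_const[OF frame_tangent[OF b]] t a b
    by (simp add: coframe_frame)
  moreover have "koszul B 1 (\<theta> t) [E a, E b] x = f t a b x"
  proof -
    have "koszul B 1 (\<theta> t) [E a, E b] x =
        (\<Sum>r\<in>{1..6}. \<Sum>s\<in>{r+1..6}. f t r s x * theta2 \<theta> r s x [E a x, E b x])"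
      unfolding ext_deriv_1_frame[OF coframe_smooth[OF t] a b, symmetric] d ..
    \<comment> \<open>For \<open>a \<noteq> b\<close> there is one term, with \<open>(r, s) = (a, b)\<close>, or with \<open>(r, s) = (b, a)\<close> and a sign;
      for \<open>a = b\<close> there is none.\<close>
    also have "\<dots> = (\<Sum>r\<in>{1..6}. (if r = a then (if a < b then f t a b x else 0) else 0)
        + (if r = b then (if b < a then - f t b a x else 0) else 0))"
    proof (intro sum.cong refl)
      fix r assume r: "r \<in> {1..6::nat}"
      have "(\<Sum>s\<in>{r+1..6}. f t r s x * theta2 \<theta> r s x [E a x, E b x]) =
          (\<Sum>s\<in>{r+1..6}. (if s = b then (if r = a then f t r b x else 0) else 0)
             + (if s = a then (if r = b then - f t r a x else 0) else 0))"
        using r a b by (intro sum.cong refl) (auto simp: theta2_pair coframe_frame)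
      also have "\<dots> = (if r = a then (if a < b then f t a b x else 0) else 0)
        + (if r = b then (if b < a then - f t b a x else 0) else 0)"
        using a b by (auto simp: sum.distrib)
      finally show "(\<Sum>s\<in>{r+1..6}. f t r s x * theta2 \<theta> r s x [E a x, E b x]) =
        (if r = a then (if a < b then f t a b x else 0) else 0)
        + (if r = b then (if b < a then - f t b a x else 0) else 0)" .
    qed
    also have "\<dots> = (if a < b then f t a b x else 0) + (if b < a then - f t b a x else 0)"
      unfolding sum.distrib using a b by simp
    also have "\<dots> = f t a b x"
      using anti[OF a b] anti[OF a a] by (cases a b rule: linorder_cases) auto
    finally show ?thesis .
  qed
  ultimately show ?thesis by simp
qed

section \<open>The deformation equations\<close>

context framed_leaf
begin

text \<open>The frame of the leaf is related to the ambient frame by the immersion, and brackets of related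
  fields are related.\<close>

lemma bracket_leaf:
  assumes r: "r \<in> {i, j, k}" and s: "s \<in> {i, j, k}"
  shows "push B \<iota> p (lie_bracket A (leaf_frame r) (leaf_frame s) p) = lie_bracket B (E r) (E s) (\<iota> p)"
proof
  fix F
  show "push B \<iota> p (lie_bracket A (leaf_frame r) (leaf_frame s) p) F = lie_bracket B (E r) (E s) (\<iota> p) F"
  proof (cases "smooth_at B (\<iota> p) F")
    case True
    obtain N where N: "open N" "\<iota> p \<in> N" "smooth_on B N F" using True by (auto simp: smooth_at_def)
    have oN: "open (\<iota> -` N)"
      using leaf_immersion(2) N(1) by (simp add: smooth_map_on_def continuous_on_open_vimage)
    have Ff: "smooth_at A p (\<lambda>q. F (\<iota> q))"
      by (rule smooth_at_comp[OF leaf_immersion(1) X.manifold leaf_immersion(2) True])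
    have step: "leaf_frame a p (\<lambda>q. leaf_frame b q (\<lambda>q. F (\<iota> q))) = E a (\<iota> p) (\<lambda>x. E b x F)"
      if a: "a \<in> {i, j, k}" and b: "b \<in> {i, j, k}" for a b
    proof -
      have "leaf_frame a p (\<lambda>q. leaf_frame b q (\<lambda>q. F (\<iota> q))) = leaf_frame a p (\<lambda>q. E b (\<iota> q) F)"
      proof (rule tangent_local[OF leaf_immersion(1) restricted_frame(1)[OF a] oN])
        fix q assume "q \<in> \<iota> -` N"
        then have "smooth_at B (\<iota> q) F" using N by (auto intro: smooth_atI)
        then show "leaf_frame b q (\<lambda>q. F (\<iota> q)) = E b (\<iota> q) F"
          unfolding restricted_frame(2)[OF b, symmetric] by (rule push_apply[symmetric])
      qed (use N in simp)
      also have "\<dots> = push B \<iota> p (leaf_frame a p) (\<lambda>x. E b x F)"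
        by (rule push_apply[where F = \<iota> and f = "\<lambda>x. E b x F", symmetric,
              OF smooth_vfield_smooth_at[OF X.frame_smooth[OF index_range[OF b]] UNIV_I True]])
      finally show ?thesis by (simp only: restricted_frame(2)[OF a])
    qed
    show ?thesis
      unfolding push_apply[where F = \<iota> and f = F, OF True] by (simp add: lie_bracket_def Ff True step[OF r s] step[OF s r])
  next
    case False
    then show ?thesis by (simp add: push_def lie_bracket_def)
  qed
qed

lemma induced_metric_leaf:
  assumes "u \<in> tangent_space A p" "v \<in> tangent_space A p"
  shows "induced_metric B \<iota> (hermitian_metric \<theta>) p u v =
    (\<Sum>t\<in>{i, j, k}. leaf_coframe t p [u] * leaf_coframe t p [v])"
proof -
  have "induced_metric B \<iota> (hermitian_metric \<theta>) p u v =
      (\<Sum>t\<in>{1..6}. \<theta> t (\<iota> p) [push B \<iota> p u] * \<theta> t (\<iota> p) [push B \<iota> p v])"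
    by (simp add: induced_metric_def hermitian_metric_def)
  also have "\<dots> = (\<Sum>t\<in>{i, j, k}. \<theta> t (\<iota> p) [push B \<iota> p u] * \<theta> t (\<iota> p) [push B \<iota> p v])"
    by (rule sum.mono_neutral_right) (use index_range push_leaf_expand(2)[OF assms(1)] in auto)
  finally show ?thesis by (simp only: leaf_coframe_apply assms)
qed

lemma omega_smooth: "smooth_form B 2 (omega \<theta>)"
proof -
  have "smooth_form B 2 (\<lambda>p vs. \<Sum>m\<in>{1..3}. 1 * theta2 \<theta> m (3 + m) p vs)"
    by (rule smooth_form_sum[OF X.manifold smooth_on_const theta2_smooth_form[OF X.manifold]])
      (rule X.coframe_smooth, simp)+
  then show ?thesis by (simp add: omega_def[abs_def])
qed

text \<open>Contraction with \<open>E\<^sub>s\<close> leaves the coframe form of the paired index, with a sign that tells whether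
  \<open>s\<close> is the first or the second member of its pair.\<close>

lemma omega_frame:
  assumes "s \<in> {1..6}"
  shows "omega \<theta> x [v, E s x] = - ((-1) ^ F_ind s (tilde s) * \<theta> (tilde s) x [v])"
proof -
  have "s = 1 \<or> s = 2 \<or> s = 3 \<or> s = 4 \<or> s = 5 \<or> s = 6" using assms by auto
  then show ?thesis
    by (elim disjE)
      (simp_all add: omega_eq theta2_pair X.coframe_frame F_ind_def tilde_def)
qed

text \<open>Since \<open>\<omega>\<close> is constant on the frame, only the three bracket terms remain. Each of them is a structure
  function by contraction. The sign of the paired index is opposite to that of \<open>h\<close>, and antisymmetry
  of the structure functions brings the index paired with \<open>h\<close> to the last place.\<close>

lemma koszul_omega_frame:
  assumes f: "structure_functions B \<theta> f" and h: "h \<in> {1..6}" and r: "r \<in> {1..6}" and s: "s \<in> {1..6}"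
  shows "koszul B 2 (omega \<theta>) [E (tilde h), E r, E s] x =
    (-1) ^ F_ind h (tilde h) * f h r s x
    - (-1) ^ F_ind r (tilde r) * f (tilde r) s (tilde h) x
    + (-1) ^ F_ind s (tilde s) * f (tilde s) r (tilde h) x"
proof -
  have tilde: "tilde a \<in> {1..6}" if "a \<in> {1..6}" for a using that by (auto simp: tilde_def)
  have tilde_tilde: "tilde (tilde h) = h" using h by (auto simp: tilde_def)
  have sign: "(-1) ^ F_ind (tilde h) h = - ((-1) ^ F_ind h (tilde h) :: real)"
    using h by (auto simp: tilde_def F_ind_def)
  note br = structure_functions_bracket[OF X.framed_manifold_axioms f]
  have anti: "f t a b x = - f t b a x" if "t \<in> {1..6}" "a \<in> {1..6}" "b \<in> {1..6}" for t a b
    using f that unfolding structure_functions_def by blast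
  have const: "E a x (\<lambda>q. omega \<theta> q [E b q, E c q]) = 0"
    if "a \<in> {1..6}" "b \<in> {1..6}" "c \<in> {1..6}" for a b c
    unfolding omega_frame[OF that(3)] X.coframe_frame[OF tilde[OF that(3)] that(2)]
    by (rule tangent_const[OF X.frame_tangent[OF that(1)]])
  show ?thesis
    unfolding koszul_2 const[OF tilde[OF h] r s] const[OF r tilde[OF h] s] const[OF s tilde[OF h] r]
    unfolding omega_frame[OF r] omega_frame[OF s] omega_frame[OF tilde[OF h]] tilde_tilde sign
      br[OF tilde[OF s] tilde[OF h] r] br[OF tilde[OF r] tilde[OF h] s] br[OF h r s]
      anti[OF tilde[OF s] tilde[OF h] r] anti[OF tilde[OF r] tilde[OF h] s]
    by simp
qed

lemma sharp_leaf:
  assumes "alternating_at A 1 p \<beta>"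
  shows "sharp A (induced_metric B \<iota> (hermitian_metric \<theta>)) p \<beta> =
    tlincomb {i, j, k} (\<lambda>t. \<beta> [leaf_frame t p]) (\<lambda>t. leaf_frame t p)"
  by (rule L.sharp_frame[OF _ assms]) (rule induced_metric_leaf)

text \<open>The vector \<open>J\<alpha>*\<close> has components \<open>\<alpha>\<^sub>h\<close> at the paired indices, and vectors tangent to the leaf have no
  components outside the triple. So of the sum over all triples of ambient frame fields only the terms
  with paired indices in the first slot and leaf indices in the other two remain.\<close>

lemma T_op_leaf:
  assumes \<alpha>: "smooth_form A 1 \<alpha>" and u: "u \<in> tangent_space A p" and v: "v \<in> tangent_space A p"
  shows "T_op A B \<iota> \<theta> E \<alpha> p [u, v] = - (\<Sum>r\<in>{i, j, k}. \<Sum>s\<in>{i, j, k}.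
    leaf_coframe r p [u] * leaf_coframe s p [v] *
      (\<Sum>h\<in>{i, j, k}. \<alpha> p [leaf_frame h p] * koszul B 2 (omega \<theta>) [E (tilde h), E r, E s] (\<iota> p)))"
proof -
  let ?I = "{i, j, k}" and ?x = "\<iota> p"
  define K where "K a r s = koszul B 2 (omega \<theta>) [E a, E r, E s] ?x" for a r s
  define c where "c h = \<alpha> p [leaf_frame h p]" for h
  define n where "n = push B \<iota> p (sharp A (induced_metric B \<iota> (hermitian_metric \<theta>)) p (\<alpha> p))"
  have n_eq: "n = tlincomb ?I c (\<lambda>t. E t ?x)"
    unfolding n_def sharp_leaf[OF smooth_form_alternating[OF \<alpha>]] push_tlincomb
    using restricted_frame(2) by (auto simp: tlincomb_def c_def)
  have \<theta>n: "\<theta> a ?x [n] = (if a \<in> ?I then c a else 0)" if a: "a \<in> {1..6}" for a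
  proof -
    have "\<theta> a ?x [n] = (\<Sum>h\<in>?I. c h * \<theta> a ?x [E h ?x])"
      unfolding n_eq
      by (rule alternating_at_1_tlincomb[OF smooth_form_alternating[OF X.coframe_smooth[OF a]]
            X.frame_tangent[OF index_range]])
    also have "\<dots> = (\<Sum>h\<in>?I. if a = h then c h else 0)"
      using X.coframe_frame[OF a index_range] by (intro sum.cong) auto
    finally show ?thesis by simp
  qed
  have tilde: "tilde a \<in> {1..6}" if "a \<in> {1..6}" for a using that by (auto simp: tilde_def)
  \<comment> \<open>\<open>n\<close> is \<open>\<alpha>*\<close> as a vector tangent to the ambient manifold, and \<open>m\<close> is \<open>J\<alpha>*\<close>.\<close>
  define m where "m = frame_J \<theta> E ?x n"
  have m: "m \<in> tangent_space B ?x"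
    unfolding m_def frame_J_def by (intro tlincomb_tangent X.frame_tangent tilde)
  have \<theta>m: "\<theta> a ?x [m] = (\<Sum>h\<in>?I. c h * (if a = tilde h then 1 else 0))" if a: "a \<in> {1..6}" for a
  proof -
    have "\<theta> a ?x [m] = (\<Sum>h\<in>{1..6}. \<theta> h ?x [n] * \<theta> a ?x [E (tilde h) ?x])"
      unfolding m_def frame_J_def
      by (rule alternating_at_1_tlincomb[OF smooth_form_alternating[OF X.coframe_smooth[OF a]]
            X.frame_tangent[OF tilde]])
    also have "\<dots> = (\<Sum>h\<in>{1..6}. if h \<in> ?I then c h * (if a = tilde h then 1 else 0) else 0)"
      by (intro sum.cong refl) (simp add: \<theta>n X.coframe_frame[OF a tilde])
    also have "\<dots> = (\<Sum>h\<in>?I. if h \<in> ?I then c h * (if a = tilde h then 1 else 0) else 0)"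
      by (rule sum.mono_neutral_right) (use index_range in auto)
    finally show ?thesis by simp
  qed
  have restrict: "(\<Sum>r\<in>{1..6}. \<theta> r ?x [push B \<iota> p w] * g r) = (\<Sum>r\<in>?I. leaf_coframe r p [w] * g r)"
    if w: "w \<in> tangent_space A p" for w g
  proof -
    have "(\<Sum>r\<in>{1..6}. \<theta> r ?x [push B \<iota> p w] * g r) = (\<Sum>r\<in>?I. \<theta> r ?x [push B \<iota> p w] * g r)"
      by (rule sum.mono_neutral_right) (use index_range push_leaf_expand(2)[OF w] in auto)
    then show ?thesis by (simp only: leaf_coframe_apply[OF w])
  qed
  have pick: "(\<Sum>a\<in>{1..6}. \<theta> a ?x [m] * g a) = (\<Sum>h\<in>?I. c h * g (tilde h))" for g
  proof -
    have "(\<Sum>a\<in>{1..6}. \<theta> a ?x [m] * g a) =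
        (\<Sum>a\<in>{1..6}. \<Sum>h\<in>?I. c h * (if a = tilde h then g a else 0))"
      by (rule sum.cong) (auto simp: \<theta>m sum_distrib_right intro!: sum.cong)
    also have "\<dots> = (\<Sum>h\<in>?I. \<Sum>a\<in>{1..6}. c h * (if a = tilde h then g a else 0))"
      by (rule sum.swap)
    also have "\<dots> = (\<Sum>h\<in>?I. c h * g (tilde h))"
      using tilde[OF index_range] by (intro sum.cong refl) (simp add: sum_distrib_left[symmetric])
    finally show ?thesis .
  qed
  have "T_op A B \<iota> \<theta> E \<alpha> p [u, v] = - ext_deriv B 2 (omega \<theta>) ?x [m, push B \<iota> p u, push B \<iota> p v]"
    using u v by (simp add: T_op_def m_def n_def)
  also have "ext_deriv B 2 (omega \<theta>) ?x [m, push B \<iota> p u, push B \<iota> p v] =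
      (\<Sum>a\<in>{1..6}. \<theta> a ?x [m] * (\<Sum>r\<in>{1..6}. \<theta> r ?x [push B \<iota> p u] *
        (\<Sum>s\<in>{1..6}. \<theta> s ?x [push B \<iota> p v] * K a r s)))"
    unfolding X.ext_deriv_2[OF omega_smooth m push_leaf[OF u] push_leaf[OF v]] K_def
    by (simp add: sum_distrib_left mult.assoc)
  also have "\<dots> = (\<Sum>h\<in>?I. c h * (\<Sum>r\<in>?I. leaf_coframe r p [u] *
        (\<Sum>s\<in>?I. leaf_coframe s p [v] * K (tilde h) r s)))"
    by (simp only: pick restrict[OF u] restrict[OF v])
  also have "\<dots> = (\<Sum>h\<in>?I. \<Sum>r\<in>?I. \<Sum>s\<in>?I.
      leaf_coframe r p [u] * leaf_coframe s p [v] * (c h * K (tilde h) r s))"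
    by (simp only: sum_distrib_left mult_ac)
  also have "\<dots> = (\<Sum>r\<in>?I. \<Sum>h\<in>?I. \<Sum>s\<in>?I.
      leaf_coframe r p [u] * leaf_coframe s p [v] * (c h * K (tilde h) r s))"
    by (rule sum.swap)
  also have "\<dots> = (\<Sum>r\<in>?I. \<Sum>s\<in>?I. \<Sum>h\<in>?I.
      leaf_coframe r p [u] * leaf_coframe s p [v] * (c h * K (tilde h) r s))"
    by (intro sum.cong refl sum.swap)
  finally show ?thesis by (simp only: sum_distrib_left[symmetric] c_def K_def)
qed

text \<open>The coefficient of \<open>\<alpha>\<^sub>h\<close> in the component \<open>(r, s)\<close> of \<open>d\<alpha> + T\<alpha>\<close>: the bracket term \<open>f\<^sup>h\<^sub>r\<^sub>s\<close> of \<open>d\<alpha>\<close>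
  minus the value of \<open>d\<omega>\<close> on \<open>E\<^bsub>h'\<^esub>, E\<^sub>r, E\<^sub>s\<close>, where \<open>h'\<close> is paired with \<open>h\<close>.\<close>

definition deformation_coefficient ::
    "(nat \<Rightarrow> nat \<Rightarrow> nat \<Rightarrow> 'x \<Rightarrow> real) \<Rightarrow> nat \<Rightarrow> nat \<Rightarrow> nat \<Rightarrow> 'x \<Rightarrow> real" where
  "deformation_coefficient f h r s x = (1 - (-1) ^ F_ind h (tilde h)) * f h r s x
     + (-1) ^ F_ind r (tilde r) * f (tilde r) s (tilde h) x
     - (-1) ^ F_ind s (tilde s) * f (tilde s) r (tilde h) x"

text \<open>Both sides are alternating in the frame indices, so the form \<open>d\<alpha> + T\<alpha>\<close> vanishes exactly when its
  three components for \<open>r < s\<close> do.\<close>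

lemma deformation_form_equation_iff:
  assumes f: "structure_functions B \<theta> f" and \<alpha>: "smooth_form A 1 \<alpha>"
  defines "Q \<equiv> \<lambda>r s p. leaf_frame r p (\<lambda>q. \<alpha> q [leaf_frame s q]) - leaf_frame s p (\<lambda>q. \<alpha> q [leaf_frame r q])
     + (\<Sum>h\<in>{i, j, k}. \<alpha> p [leaf_frame h p] * deformation_coefficient f h r s (\<iota> p))"
  shows "(\<forall>p vs. ext_deriv A 1 \<alpha> p vs + T_op A B \<iota> \<theta> E \<alpha> p vs = 0) \<longleftrightarrow>
    (\<forall>p. Q i j p = 0 \<and> Q i k p = 0 \<and> Q j k p = 0)"
proof -
  let ?I = "{i, j, k}"
  have Q: "koszul A 1 \<alpha> [leaf_frame r, leaf_frame s] p
      - (\<Sum>h\<in>?I. \<alpha> p [leaf_frame h p] * koszul B 2 (omega \<theta>) [E (tilde h), E r, E s] (\<iota> p)) = Q r s p"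
    if r: "r \<in> ?I" and s: "s \<in> ?I" for r s p
  proof -
    have "leaf_coframe h p [lie_bracket A (leaf_frame r) (leaf_frame s) p] = - f h r s (\<iota> p)"
      if h: "h \<in> ?I" for h
      using structure_functions_bracket[OF X.framed_manifold_axioms f index_range[OF h] index_range[OF r] index_range[OF s]]
        lie_bracket_tangent[OF leaf_immersion(1) L.frame_smooth[OF r] L.frame_smooth[OF s] UNIV_I]
      by (simp add: leaf_coframe_apply bracket_leaf[OF r s])
    then have "koszul A 1 \<alpha> [leaf_frame r, leaf_frame s] p =
        leaf_frame r p (\<lambda>q. \<alpha> q [leaf_frame s q]) - leaf_frame s p (\<lambda>q. \<alpha> q [leaf_frame r q])
        + (\<Sum>h\<in>?I. \<alpha> p [leaf_frame h p] * f h r s (\<iota> p))"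
      unfolding L.koszul_1_frame[OF \<alpha>] by (simp add: sum_negf)
    moreover have "(\<Sum>h\<in>?I. \<alpha> p [leaf_frame h p] * koszul B 2 (omega \<theta>) [E (tilde h), E r, E s] (\<iota> p)) =
        (\<Sum>h\<in>?I. \<alpha> p [leaf_frame h p] * f h r s (\<iota> p))
        - (\<Sum>h\<in>?I. \<alpha> p [leaf_frame h p] * deformation_coefficient f h r s (\<iota> p))"
      unfolding sum_subtractf[symmetric]
      by (intro sum.cong refl)
        (simp add: koszul_omega_frame[OF f index_range index_range[OF r] index_range[OF s]]
          deformation_coefficient_def algebra_simps)
    ultimately show ?thesis by (simp add: Q_def)
  qed
  have sum_eq: "ext_deriv A 1 \<alpha> p [u, v] + T_op A B \<iota> \<theta> E \<alpha> p [u, v] =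
      (\<Sum>r\<in>?I. \<Sum>s\<in>?I. leaf_coframe r p [u] * leaf_coframe s p [v] * Q r s p)"
    if u: "u \<in> tangent_space A p" and v: "v \<in> tangent_space A p" for p u v
  proof -
    have "ext_deriv A 1 \<alpha> p [u, v] + T_op A B \<iota> \<theta> E \<alpha> p [u, v] =
      (\<Sum>r\<in>?I. \<Sum>s\<in>?I. leaf_coframe r p [u] * leaf_coframe s p [v] *
        (koszul A 1 \<alpha> [leaf_frame r, leaf_frame s] p
         - (\<Sum>h\<in>?I. \<alpha> p [leaf_frame h p] * koszul B 2 (omega \<theta>) [E (tilde h), E r, E s] (\<iota> p))))"
      unfolding L.ext_deriv_1[OF \<alpha> u v] T_op_leaf[OF \<alpha> u v]
      by (simp only: right_diff_distrib sum_subtractf add_uminus_conv_diff)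
    also have "\<dots> = (\<Sum>r\<in>?I. \<Sum>s\<in>?I. leaf_coframe r p [u] * leaf_coframe s p [v] * Q r s p)"
      by (intro sum.cong refl) (simp only: Q)
    finally show ?thesis .
  qed
  have anti: "f t a b x = - f t b a x" if "t \<in> {1..6}" "a \<in> {1..6}" "b \<in> {1..6}" for t a b x
    using f that unfolding structure_functions_def by blast
  have Q_swap: "Q s r p = - Q r s p" if r: "r \<in> ?I" and s: "s \<in> ?I" for r s p
  proof -
    have "deformation_coefficient f h s r (\<iota> p) = - deformation_coefficient f h r s (\<iota> p)" if "h \<in> ?I" for h
      using anti[OF index_range[OF that] index_range[OF r] index_range[OF s]]
      by (simp add: deformation_coefficient_def algebra_simps)
    then show ?thesis by (simp add: Q_def sum_negf)
  qed
  show ?thesis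
  proof (intro iffI allI)
    fix p assume "\<forall>p vs. ext_deriv A 1 \<alpha> p vs + T_op A B \<iota> \<theta> E \<alpha> p vs = 0"
    then have "Q a b p = 0" if a: "a \<in> ?I" and b: "b \<in> ?I" for a b
    proof -
      have "(\<Sum>r\<in>?I. \<Sum>s\<in>?I. leaf_coframe r p [leaf_frame a p] * leaf_coframe s p [leaf_frame b p] * Q r s p) = 0"
        unfolding sum_eq[OF restricted_frame(1)[OF a] restricted_frame(1)[OF b], symmetric]
        using \<open>\<forall>p vs. ext_deriv A 1 \<alpha> p vs + T_op A B \<iota> \<theta> E \<alpha> p vs = 0\<close> by blast
      moreover have "(\<Sum>r\<in>?I. \<Sum>s\<in>?I. leaf_coframe r p [leaf_frame a p] * leaf_coframe s p [leaf_frame b p] * Q r s p) =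
          (\<Sum>r\<in>?I. if r = a then (\<Sum>s\<in>?I. if s = b then Q r s p else 0) else 0)"
      proof (intro sum.cong refl)
        fix r assume r: "r \<in> ?I"
        show "(\<Sum>s\<in>?I. leaf_coframe r p [leaf_frame a p] * leaf_coframe s p [leaf_frame b p] * Q r s p) =
          (if r = a then (\<Sum>s\<in>?I. if s = b then Q r s p else 0) else 0)"
        proof -
          have "(\<Sum>s\<in>?I. leaf_coframe r p [leaf_frame a p] * leaf_coframe s p [leaf_frame b p] * Q r s p) =
              (\<Sum>s\<in>?I. if r = a then (if s = b then Q r s p else 0) else 0)"
            by (rule sum.cong) (simp_all only: L.coframe_frame[OF r a] L.coframe_frame[OF _ b], simp)
          then show ?thesis by (cases "r = a") (simp_all only: if_True if_False simp_thms sum.neutral_const)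
        qed
      qed
      ultimately show ?thesis using a b by simp
    qed
    then show "Q i j p = 0 \<and> Q i k p = 0 \<and> Q j k p = 0" by simp
  next
    fix p vs assume H: "\<forall>p. Q i j p = 0 \<and> Q i k p = 0 \<and> Q j k p = 0"
    have m: "i \<in> ?I" "j \<in> ?I" "k \<in> ?I" by auto
    have diag: "Q r r p = 0" if "r \<in> ?I" for r using Q_swap[OF that that, of p] by simp
    have Q0: "Q r s p = 0" if "r \<in> ?I" "s \<in> ?I" for r s
    proof -
      have "r = i \<or> r = j \<or> r = k" "s = i \<or> s = j \<or> s = k" using that by auto
      moreover have "Q i j p = 0" "Q i k p = 0" "Q j k p = 0" using H by auto
      moreover have "Q j i p = 0" "Q k i p = 0" "Q k j p = 0"
        using Q_swap[OF m(1,2), of p] Q_swap[OF m(1,3), of p] Q_swap[OF m(2,3), of p] H by auto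
      moreover note diag[OF m(1)] diag[OF m(2)] diag[OF m(3)]
      ultimately show ?thesis by (elim disjE) simp_all
    qed
    show "ext_deriv A 1 \<alpha> p vs + T_op A B \<iota> \<theta> E \<alpha> p vs = 0"
    proof (cases "length vs = Suc 1 \<and> set vs \<subseteq> tangent_space A p")
      case True
      then obtain u v where "vs = [u, v]" "u \<in> tangent_space A p" "v \<in> tangent_space A p"
        by (auto simp: length_Suc_conv)
      then show ?thesis by (simp only: sum_eq) (simp add: Q0)
    next
      case False
      have "T_op A B \<iota> \<theta> E \<alpha> p vs = 0"
      proof (cases "set vs \<subseteq> tangent_space A p")
        case True
        with False have "length vs \<noteq> 2" by simp
        then show ?thesis unfolding T_op_def by (simp add: ext_deriv_outside)
      qed (simp add: T_op_def)
      then show ?thesis using ext_deriv_outside[OF False] by simp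
    qed
  qed
qed

text \<open>A smooth 1-form on the leaf and its three coefficient functions determine each other, which turns the
  conditions on forms into the system for functions.\<close>

lemma infinitesimal_deformations_leaf:
  assumes f: "structure_functions B \<theta> f"
    and f2: "\<forall>r\<in>{i, j, k}. \<forall>s\<in>{i, j, k}.
      ext_deriv A 2 (theta2 leaf_coframe r s) = (\<lambda>p vs. f2 r s p * theta3 leaf_coframe i j k p vs)"
  shows "infinitesimal_deformations A B \<iota> \<theta> E (theta3 leaf_coframe i j k) =
    {\<alpha>. \<exists>a b c. smooth_on A UNIV a \<and> smooth_on A UNIV b \<and> smooth_on A UNIV c \<and>
       \<alpha> = (\<lambda>p vs. a p * leaf_coframe i p vs + b p * leaf_coframe j p vs + c p * leaf_coframe k p vs) \<and>
       (\<forall>p. leaf_frame i p a + a p * f2 j k p + leaf_frame j p b - b p * f2 i k p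
             + leaf_frame k p c + c p * f2 i j p = 0 \<and>
          leaf_frame i p b - leaf_frame j p a + a p * deformation_coefficient f i i j (\<iota> p)
            + b p * deformation_coefficient f j i j (\<iota> p) + c p * deformation_coefficient f k i j (\<iota> p) = 0 \<and>
          leaf_frame i p c - leaf_frame k p a + a p * deformation_coefficient f i i k (\<iota> p)
            + b p * deformation_coefficient f j i k (\<iota> p) + c p * deformation_coefficient f k i k (\<iota> p) = 0 \<and>
          leaf_frame j p c - leaf_frame k p b + a p * deformation_coefficient f i j k (\<iota> p)
            + b p * deformation_coefficient f j j k (\<iota> p) + c p * deformation_coefficient f k j k (\<iota> p) = 0)}"
    (is "_ = {\<alpha>. \<exists>a b c. ?S a \<and> ?S b \<and> ?S c \<and> \<alpha> = ?form a b c \<and> (\<forall>p. ?eqs a b c p)}")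
proof -
  have m: "i \<in> {i, j, k}" "j \<in> {i, j, k}" "k \<in> {i, j, k}" by auto
  have sum3: "(\<Sum>h\<in>{i, j, k}. x h) = x i + x j + x k" for x :: "nat \<Rightarrow> real"
    using distinct_indices by (simp add: add.assoc)
  have iff: "\<alpha> \<in> infinitesimal_deformations A B \<iota> \<theta> E (theta3 leaf_coframe i j k) \<longleftrightarrow>
      (\<forall>p. ?eqs (\<lambda>q. \<alpha> q [leaf_frame i q]) (\<lambda>q. \<alpha> q [leaf_frame j q]) (\<lambda>q. \<alpha> q [leaf_frame k q]) p)"
    if \<alpha>: "smooth_form A 1 \<alpha>" for \<alpha>
  proof -
    have star: "ext_deriv A 2 (hodge_star A (induced_metric B \<iota> (hermitian_metric \<theta>)) (theta3 leaf_coframe i j k) \<alpha>)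
        = (\<lambda>_ _. 0) \<longleftrightarrow>
      (\<forall>p. leaf_frame i p (\<lambda>q. \<alpha> q [leaf_frame i q]) + \<alpha> p [leaf_frame i p] * f2 j k p
         + leaf_frame j p (\<lambda>q. \<alpha> q [leaf_frame j q]) - \<alpha> p [leaf_frame j p] * f2 i k p
         + leaf_frame k p (\<lambda>q. \<alpha> q [leaf_frame k q]) + \<alpha> p [leaf_frame k p] * f2 i j p = 0)"
      by (rule L.codifferential_zero_iff[OF _ refl distinct_indices \<alpha> f2]) (rule induced_metric_leaf)
    show ?thesis
      unfolding infinitesimal_deformations_def mem_Collect_eq star deformation_form_equation_iff[OF f \<alpha>]
        sum3 add.assoc[symmetric]
      by (simp only: \<alpha> simp_thms all_conj_distrib conj_ac)
  qed
  show ?thesis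
  proof (intro Set.set_eqI iffI)
    fix \<alpha> assume d: "\<alpha> \<in> infinitesimal_deformations A B \<iota> \<theta> E (theta3 leaf_coframe i j k)"
    then have \<alpha>: "smooth_form A 1 \<alpha>" by (simp add: infinitesimal_deformations_def)
    have form: "\<alpha> = ?form (\<lambda>q. \<alpha> q [leaf_frame i q]) (\<lambda>q. \<alpha> q [leaf_frame j q]) (\<lambda>q. \<alpha> q [leaf_frame k q])"
      by (intro ext) (rule trans[OF L.form_1_expand[OF smooth_form_alternating[OF \<alpha>]] sum3])
    have sm: "?S (\<lambda>q. \<alpha> q [leaf_frame h q])" if "h \<in> {i, j, k}" for h
      using smooth_form_on[OF \<alpha>, of "[leaf_frame h]" UNIV] L.frame_smooth[OF that] by simp
    show "\<alpha> \<in> {\<alpha>. \<exists>a b c. ?S a \<and> ?S b \<and> ?S c \<and> \<alpha> = ?form a b c \<and> (\<forall>p. ?eqs a b c p)}"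
      unfolding mem_Collect_eq
      by (intro exI conjI)
        (rule sm[OF m(1)], rule sm[OF m(2)], rule sm[OF m(3)], rule form, rule iff[OF \<alpha>, THEN iffD1, OF d])
  next
    fix \<alpha> assume "\<alpha> \<in> {\<alpha>. \<exists>a b c. ?S a \<and> ?S b \<and> ?S c \<and> \<alpha> = ?form a b c \<and> (\<forall>p. ?eqs a b c p)}"
    then obtain a b c where s: "?S a" "?S b" "?S c" and \<alpha>: "\<alpha> = ?form a b c" and eqs: "\<forall>p. ?eqs a b c p"
      by (elim CollectE exE conjE) (rule that)
    have "smooth_form A 1 (\<lambda>p vs. \<Sum>h\<in>{i, j, k}. (if h = i then a else if h = j then b else c) p * leaf_coframe h p vs)"
      by (rule smooth_form_sum[OF leaf_immersion(1) _ L.coframe_smooth]) (use s in auto)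
    then have smooth: "smooth_form A 1 \<alpha>"
      unfolding \<alpha> sum3 using distinct_indices by simp
    have val: "\<alpha> q [leaf_frame i q] = a q" "\<alpha> q [leaf_frame j q] = b q" "\<alpha> q [leaf_frame k q] = c q" for q
      unfolding \<alpha> using distinct_indices L.coframe_frame m by simp_all
    show "\<alpha> \<in> infinitesimal_deformations A B \<iota> \<theta> E (theta3 leaf_coframe i j k)"
      unfolding iff[OF smooth] val by (rule eqs)
  qed
qed

end

theorem theorem4p1:
  fixes A\<^sub>G :: "('g::{t2_space,second_countable_topology}, real ^ 6) atlas"
    and G :: "'g monoid" and \<Gamma> :: "'g set"
    and A\<^sub>X :: "('x::{t2_space,second_countable_topology}, real ^ 6) atlas"
    and A\<^sub>L :: "('l::{t2_space,second_countable_topology}, real ^ 3) atlas"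
    and \<pi> :: "'g \<Rightarrow> 'x" and \<iota> :: "'l \<Rightarrow> 'x"
    and J :: "'x \<Rightarrow> 'x tvec \<Rightarrow> 'x tvec"
    and \<theta> :: "nat \<Rightarrow> ('x, real) form" and E :: "nat \<Rightarrow> 'x vfield"
    and f :: "nat \<Rightarrow> nat \<Rightarrow> nat \<Rightarrow> 'x \<Rightarrow> real"
    and f2 :: "nat \<Rightarrow> nat \<Rightarrow> 'l \<Rightarrow> real"
    and i j k :: nat
  defines "\<theta>L \<equiv> \<lambda>t. pullback A\<^sub>L A\<^sub>X \<iota> (\<theta> t)"
    and "EL \<equiv> \<lambda>h. restrict_vfield A\<^sub>L A\<^sub>X \<iota> (E h)"
    and "fL \<equiv> \<lambda>t r s p. f t r s (\<iota> p)"
  assumes "connected (UNIV :: 'g set)" and "simply_connected (UNIV :: 'g set)"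
    and "lattice_quotient A\<^sub>G G \<Gamma> A\<^sub>X \<pi>"
    and "balanced_calabi_yau A\<^sub>X J \<theta>" and "non_kaehler A\<^sub>X J"
    and "dual_frame A\<^sub>X {1..6} \<theta> E"
    and "structure_functions A\<^sub>X \<theta> f"
    and "(i, j, k) \<in> {(1, 2, 3), (1, 5, 6), (2, 4, 6), (3, 4, 5)}"
    and "involutive A\<^sub>X (distribution {i, j, k} E)"
    and "integral_submanifold A\<^sub>L A\<^sub>X \<iota> (distribution {i, j, k} E)"
    and "\<forall>r\<in>{i, j, k}. \<forall>s\<in>{i, j, k}.
           ext_deriv A\<^sub>L 2 (theta2 \<theta>L r s) = (\<lambda>p vs. f2 r s p * theta3 \<theta>L i j k p vs)"
  shows "special_lagrangian A\<^sub>L A\<^sub>X \<iota> \<theta> \<and>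
    infinitesimal_deformations A\<^sub>L A\<^sub>X \<iota> \<theta> E (theta3 \<theta>L i j k) =
    {\<alpha>. \<exists>\<alpha>\<^sub>i \<alpha>\<^sub>j \<alpha>\<^sub>k.
       smooth_on A\<^sub>L UNIV \<alpha>\<^sub>i \<and> smooth_on A\<^sub>L UNIV \<alpha>\<^sub>j \<and> smooth_on A\<^sub>L UNIV \<alpha>\<^sub>k \<and>
       \<alpha> = (\<lambda>p vs. \<alpha>\<^sub>i p * \<theta>L i p vs + \<alpha>\<^sub>j p * \<theta>L j p vs + \<alpha>\<^sub>k p * \<theta>L k p vs) \<and>
       (\<forall>p.
          EL i p \<alpha>\<^sub>i + \<alpha>\<^sub>i p * f2 j k p + EL j p \<alpha>\<^sub>j - \<alpha>\<^sub>j p * f2 i k p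
            + EL k p \<alpha>\<^sub>k + \<alpha>\<^sub>k p * f2 i j p = 0 \<and>
          EL i p \<alpha>\<^sub>j - EL j p \<alpha>\<^sub>i
            + \<alpha>\<^sub>i p * ((1 - (-1) ^ F_ind i (tilde i)) * fL i i j p
                + (-1) ^ F_ind i (tilde i) * fL (tilde i) j (tilde i) p
                - (-1) ^ F_ind j (tilde j) * fL (tilde j) i (tilde i) p)
            + \<alpha>\<^sub>j p * ((1 - (-1) ^ F_ind j (tilde j)) * fL j i j p
                - (-1) ^ F_ind j (tilde j) * fL (tilde j) i (tilde j) p
                + (-1) ^ F_ind i (tilde i) * fL (tilde i) j (tilde j) p)
            + \<alpha>\<^sub>k p * ((1 - (-1) ^ F_ind k (tilde k)) * fL k i j p
                + (-1) ^ F_ind i (tilde i) * fL (tilde i) j (tilde k) p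
                - (-1) ^ F_ind j (tilde j) * fL (tilde j) i (tilde k) p) = 0 \<and>
          EL i p \<alpha>\<^sub>k - EL k p \<alpha>\<^sub>i
            + \<alpha>\<^sub>i p * ((1 - (-1) ^ F_ind i (tilde i)) * fL i i k p
                + (-1) ^ F_ind i (tilde i) * fL (tilde i) k (tilde i) p
                - (-1) ^ F_ind k (tilde k) * fL (tilde k) i (tilde i) p)
            + \<alpha>\<^sub>j p * ((1 - (-1) ^ F_ind j (tilde j)) * fL j i k p
                - (-1) ^ F_ind k (tilde k) * fL (tilde k) i (tilde j) p
                + (-1) ^ F_ind i (tilde i) * fL (tilde i) k (tilde j) p)
            + \<alpha>\<^sub>k p * ((1 - (-1) ^ F_ind k (tilde k)) * fL k i k p
                + (-1) ^ F_ind i (tilde i) * fL (tilde i) k (tilde k) p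
                - (-1) ^ F_ind k (tilde k) * fL (tilde k) i (tilde k) p) = 0 \<and>
          EL j p \<alpha>\<^sub>k - EL k p \<alpha>\<^sub>j
            + \<alpha>\<^sub>i p * ((1 - (-1) ^ F_ind i (tilde i)) * fL i j k p
                + (-1) ^ F_ind j (tilde j) * fL (tilde j) k (tilde i) p
                - (-1) ^ F_ind k (tilde k) * fL (tilde k) j (tilde i) p)
            + \<alpha>\<^sub>j p * ((1 - (-1) ^ F_ind j (tilde j)) * fL j j k p
                + (-1) ^ F_ind j (tilde j) * fL (tilde j) k (tilde j) p
                - (-1) ^ F_ind k (tilde k) * fL (tilde k) j (tilde j) p)
            + \<alpha>\<^sub>k p * ((1 - (-1) ^ F_ind k (tilde k)) * fL k j k p
                + (-1) ^ F_ind j (tilde j) * fL (tilde j) k (tilde k) p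
                - (-1) ^ F_ind k (tilde k) * fL (tilde k) j (tilde k) p) = 0)}"
  proof -
  note L = assms(1-3) and quotient = assms(6) and calabi_yau = assms(7) and frame = assms(9)
    and f = assms(10) and indices = assms(11) and integral = assms(13) and f2 = assms(14)
  have "smooth_manifold A\<^sub>X" using quotient by (simp add: lattice_quotient_def)
  moreover have "coframe A\<^sub>X {1..6} \<theta>" using calabi_yau by (simp add: balanced_calabi_yau_def)
  ultimately have X: "framed_manifold A\<^sub>X {1..6} \<theta> E"
    by (intro framed_manifold_if_dual_frame frame) auto
  interpret framed_leaf A\<^sub>X \<theta> E A\<^sub>L \<iota> i j k
    by (intro framed_leaf.intro X framed_leaf_axioms.intro integral indices)
  \<comment> \<open>The system orders the two last terms differently in the coefficients of \<open>\<alpha>\<^sub>j\<close> with \<open>r = i\<close>.\<close>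
  have alt: "deformation_coefficient f h r s x = (1 - (-1) ^ F_ind h (tilde h)) * f h r s x
     - (-1) ^ F_ind s (tilde s) * f (tilde s) r (tilde h) x
     + (-1) ^ F_ind r (tilde r) * f (tilde r) s (tilde h) x" for h r s x
    by (simp add: deformation_coefficient_def)
  show ?thesis
    using special_lagrangian_leaf infinitesimal_deformations_leaf[OF f f2[unfolded L]]
    unfolding L unfolding alt[of j i j] alt[of j i k] unfolding deformation_coefficient_def by (rule conjI)
qed

end
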